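(* Divisor classes are represented by valid triples $(W^{3g+1}_D,\tilde s,\tilde t)$, as defined in the context. The following procedures hold. (1) Addflip. Let two classes be represented by the divisors $D$ and $D'$. First apply the intersection procedure to $W^{3g+1}_D$ and $W^{3g+1}_{D'}$. This succeeds if and only if $D$ and $D'$ are disjoint and $D+D'$ is semi-typical; one then obtains $s,t\in W^{3g+1}_{D+D'}$ with $\deg s=3g$, $\deg t=3g+1$ and $\operatorname{div}s=D+D'+D''$. Second, apply the flipping procedure with $N=3g+1$ to $D+D'$ with $(s,t)$, to compute $W^{3g+1}_{D''}$. This step succeeds precisely when $D+D'$ is typical, and implies that $D''$ is semi-typical. Return $(W^{3g+1}_{D''},s,t)$, where $[D''-gP_\infty]=-([D-gP_\infty]+[D'-gP_\infty])$. The whole procedure succeeds if and only if $D,D'$ are disjoint and $D+D'$ is typical. (2) Doubleflip. Let a class be represented by the triple $(W^{3g+1}_D,\tilde s,\tilde t)$. Apply the combined flip-and-double procedure to $(\tilde s,\tilde t)$ with $N=3g+1$ to obtain $s,t\in W^{3g+1}_{2D}$ (of degrees $3g$, $3g+1$); since $\tilde D$ is typical, this succeeds if and only if $2D$ is semi-typical. Then apply the flipping procedure with $N=3g+1$ to $2D$ with $(s,t)$, to produce $W^{3g+1}_{D''}$, where $\operatorname{div}s=2D+D''$, and to certify that $2D$ is typical. If successful, return $(W^{3g+1}_{D''},s,t)$, where $[D''-gP_\infty]=-2[D-gP_\infty]$. The whole procedure succeeds if and only if $2D$ is typical. (3) Negation. Given the space $W^{3g+1}_D$ of a valid triple, take the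 first two elements $s\in W^{2g}_D$, $t\in W^{2g+1}_D$ of its echelon basis, with $\operatorname{div}s=D+A$, and apply the flipping procedure with $N=3g+1$ to $D$ with $(s,t)$. If successful, this produces $W^{3g+1}_A$ while certifying that $D$ was typical ($A$ being typical because $\tilde D$ is). Return $(W^{3g+1}_A,s,t)$. This procedure succeeds if and only if $D$ is typical.
   Context: $K$ is a field and $C$ is a smooth projective (geometrically irreducible) curve of genus $g\ge1$ over $K$ with a $K$-rational point $P_\infty$; $R$ is the coordinate ring of the affine curve $C-\{P_\infty\}$; for nonzero $f\in R$, $\deg f$ is the order of the pole of $f$ at $P_\infty$ ($\deg 0=-\infty$). $W^N=\{f\in R:\deg f\le N\}$. A good divisor is an effective $K$-rational divisor whose support does not contain $P_\infty$. For $f\in R$ nonzero, $\operatorname{div} f$ denotes only the affine part of the divisor of $f$ (the component at $P_\infty$ is ignored), so $\operatorname{div} f$ is a good divisor of degree $\deg f$. For a good divisor $D$, $I_D=\{f\in R: f=0 \text{ or } \operatorname{div} f\ge D\}$ and $W^N_D=W^N\cap I_D$. A divisor $D$ is typical if it is good of degree $d\ge g$ and there exist $s\in W^{d+g}_D$, $t\in W^{d+g+1}_D$ with $sW^{2g}+tW^{2g-1}+W^{d+g-1}=W^{d+3g}$. A divisor $D$ is semi-typical if it is good of degree $d\ge g$ and $W^{d+g-1}_D=0$. Bases of subspaces of $R$ are echelon: ordered by strictly increasing degree of their elements. Valid triple: $(W^{3g+1}_D,\tilde s,\tilde t)$ where $D$ is a semi-typical divisor of degree $g$, $W^{3g+1}_D$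 is given by an echelon basis, and there is a typical divisor $\tilde D$ of degree $\tilde d\in\{g,2g\}$ with $\tilde s\in W^{\tilde d+g}_{\tilde D}$, $\tilde t\in W^{\tilde d+g+1}_{\tilde D}$ of degrees exactly $\tilde d+g$, $\tilde d+g+1$, and $\operatorname{div}\tilde s=D+\tilde D$ (i.e. $D$ is the flip of $\tilde D$). It represents the class $[D-gP_\infty]\in\mathrm{Pic}^0(C)$. Intersection procedure for $D,D'$ of degree $g$, with $N=3g+1$: compute $W^N_D\cap W^N_{D'}$ together with $W^{3g-1}_D\cap W^{3g-1}_{D'}$. It fails if the latter is nonzero; otherwise it succeeds and returns the echelon basis of $W^N_D\cap W^N_{D'}$ as a basis of $W^N_{D+D'}$. Flipping procedure for a good divisor $D$ of degree $d\ge g$, with $s\in W^{d+g}_D$, $t\in W^{d+g+1}_D$ of degrees exactly $d+g$, $d+g+1$, and $N\ge2g-1$: with $\operatorname{div}s=D+A$, compute $W'=\{\ell\in W^N:\ell t\in sW^{N+1}+W^{d+g-1}\}$ and $\hat W=W'\cap W^{2g-1}$. It fails if $\hat W\neq0$; otherwise it succeeds and returns an echelon basis of $W'$ as a basis of $W^N_A$. Combined flip-and-double procedure for a pair $(\tilde s,\tilde t)$, where $\tilde s\in W^{\tilde d+g}_{\tilde D}$ and $\tilde t\in W^{\tilde d+g+1}_{\tilde D}$ have degrees exactly $\tilde d+g$ and $\tilde d+g+1$, and $\tilde D$ is a typical divisor of degree $\tilde d\in\{g,2g\}$, with $N\ge3g-1$: write $\operatorname{div}\tilde s=D+\tilde D$,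 $\operatorname{div}\tilde t=E+\tilde D$. Compute $\tilde W=\{(\ell,\ell')\in W^{N+1}\times W^{N+2}:\tilde t\ell+\tilde s\ell'\in W^{\tilde d+g-1}\}$, failing unless the images in $W^{\tilde d+3g}/W^{\tilde d+g-1}$ of the elements $\tilde s m$ ($m$ in a basis of $W^{2g}$) and $\tilde t m$ ($m$ in a basis of $W^{2g-1}$) are linearly independent. From an echelon basis $\{(\ell_j,\ell'_j):1\le j\le N-2g+2\}$ of $\tilde W$ with $\deg\ell_j=2g-1+j$, $\deg\ell_j'=2g+j$ (the $\ell_j$ giving a basis of $W^{N+1}_D$ and the $\ell'_j$ with $j\le N-2g+1$ a basis of $W^{N+1}_E$), compute the space of tuples $(c_1,\dots,c_{N-2g+1})$ with $\sum_jc_j\ell'_j\in W^{N+1}_D$, thereby computing $W^{N+1}_{D+E}=W^{N+1}_D\cap W^{N+1}_E$ and $\hat W=W^{3g}_{D+E}$; the corresponding elements $\sum_jc_j\ell_j$ form the computed space $W^N_{2D}$. In (2), success of this step means that the computation is carried out and $\hat W=0$. A composite procedure succeeds if all its steps succeed. *)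

theory Defs
  imports
    "HOL-Computational_Algebra.Polynomial"
    "HOL-Library.Poly_Mapping"
    "HOL-Library.Extended"
    "HOL-Library.Function_Algebras"
    "HOL-Library.Product_Plus"
    "HOL-Algebra.Coset"
begin

text \<open>
  A smooth projective curve over a field \<open>K\<close> is given by its function field \<open>F\<close>: its closed points
  are the places of \<open>F/K\<close>, and the local ring at a closed point is the valuation ring of the place.
  \<open>K\<close> is the type \<open>'k\<close> and embeds into \<open>F\<close>, the type \<open>'f\<close>, by \<open>emb\<close>.  A place is
  identified with its normalized discrete valuation.
\<close>

record ('k, 'f) pcurve =
  emb :: "'k \<Rightarrow> 'f"
  pinf :: "'f \<Rightarrow> int"

type_synonym 'f divisor = "('f \<Rightarrow> int) \<Rightarrow> int"


section \<open>Linear algebra over the base field\<close>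

definition field_embedding :: "('k::field \<Rightarrow> 'f::field) \<Rightarrow> bool" where
  "field_embedding e \<longleftrightarrow>
     e 1 = 1 \<and> (\<forall>a b. e (a + b) = e a + e b) \<and> (\<forall>a b. e (a * b) = e a * e b)"

definition scl :: "('k::field, 'f::field) pcurve \<Rightarrow> 'k \<Rightarrow> 'f \<Rightarrow> 'f" where
  "scl C c x = emb C c * x"

definition scl2 :: "('k::field, 'f::field) pcurve \<Rightarrow> 'k \<Rightarrow> 'f \<times> 'f \<Rightarrow> 'f \<times> 'f" where
  "scl2 C c p = (emb C c * fst p, emb C c * snd p)"

definition kspan :: "('k::field, 'f::field) pcurve \<Rightarrow> 'f set \<Rightarrow> 'f set" where
  "kspan C = module.span (scl C)"

definition kindep :: "('k::field, 'f::field) pcurve \<Rightarrow> 'f set \<Rightarrow> bool" where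
  "kindep C S \<longleftrightarrow> \<not> module.dependent (scl C) S"

definition kdim :: "('k::field, 'f::field) pcurve \<Rightarrow> 'f set \<Rightarrow> nat" where
  "kdim C = vector_space.dim (scl C)"

text \<open>The dimension of \<open>V / U\<close>, read off from a finite basis of a complement of \<open>U\<close> in \<open>V\<close>.\<close>

definition quot_dim :: "('k::field, 'f::field) pcurve \<Rightarrow> 'f set \<Rightarrow> 'f set \<Rightarrow> nat" where
  "quot_dim C V U = (THE n. \<exists>B. finite B \<and> card B = n \<and> B \<subseteq> V \<and> kindep C B \<and>
     kspan C B \<inter> U = {0} \<and> (\<forall>v\<in>V. \<exists>u\<in>U. v - u \<in> kspan C B))"

text \<open>Linear independence modulo \<open>U\<close> of the (indexed) family \<open>xs\<close>.\<close>

definition indep_mod :: "('k::field, 'f::field) pcurve \<Rightarrow> 'f set \<Rightarrow> 'f list \<Rightarrow> bool" where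
  "indep_mod C U xs \<longleftrightarrow>
     (\<forall>c. (\<Sum>i<length xs. scl C (c i) (xs ! i)) \<in> U \<longrightarrow> (\<forall>i<length xs. c i = 0))"


section \<open>Places and smoothness\<close>

text \<open>
  The value of a valuation at \<open>0\<close> is conventionally \<open>0\<close>, so that a place determines the
  function; it is never used.
\<close>

definition is_place :: "('k::field, 'f::field) pcurve \<Rightarrow> ('f \<Rightarrow> int) \<Rightarrow> bool" where
  "is_place C v \<longleftrightarrow> v 0 = 0 \<and>
     (\<forall>x y. x \<noteq> 0 \<longrightarrow> y \<noteq> 0 \<longrightarrow> v (x * y) = v x + v y) \<and>
     (\<forall>x y. x \<noteq> 0 \<longrightarrow> y \<noteq> 0 \<longrightarrow> x + y \<noteq> 0 \<longrightarrow> min (v x) (v y) \<le> v (x + y)) \<and>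
     (\<forall>c. c \<noteq> 0 \<longrightarrow> v (emb C c) = 0) \<and>
     (\<exists>x. x \<noteq> 0 \<and> v x = 1)"

definition local_ring :: "('f::field \<Rightarrow> int) \<Rightarrow> 'f set" where
  "local_ring v = {x. x = 0 \<or> 0 \<le> v x}"

definition max_ideal :: "('f::field \<Rightarrow> int) \<Rightarrow> 'f set" where
  "max_ideal v = {x. x = 0 \<or> 0 < v x}"

definition place_deg :: "('k::field, 'f::field) pcurve \<Rightarrow> ('f \<Rightarrow> int) \<Rightarrow> int" where
  "place_deg C v = int (quot_dim C (local_ring v) (max_ideal v))"

definition rational_place :: "('k::field, 'f::field) pcurve \<Rightarrow> ('f \<Rightarrow> int) \<Rightarrow> bool" where
  "rational_place C v \<longleftrightarrow>
     is_place C v \<and> (\<forall>x\<in>local_ring v. \<exists>c. x - emb C c \<in> max_ideal v)"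

definition kalgebraic :: "('k::field, 'f::field) pcurve \<Rightarrow> 'f \<Rightarrow> bool" where
  "kalgebraic C x \<longleftrightarrow> (\<exists>p. p \<noteq> 0 \<and> poly (map_poly (emb C) p) x = 0)"

text \<open>Finitely generated of transcendence degree one.\<close>

definition function_field :: "('k::field, 'f::field) pcurve \<Rightarrow> bool" where
  "function_field C \<longleftrightarrow> field_embedding (emb C) \<and>
     (\<exists>x. \<not> kalgebraic C x \<and>
       (\<exists>B. finite B \<and> (\<forall>h. \<exists>c. h = (\<Sum>b\<in>B. c b * b) \<and>
         (\<forall>b\<in>B. \<exists>p q. c b = poly (map_poly (emb C) p) x / poly (map_poly (emb C) q) x))))"

type_synonym 'k mpoly = "(nat \<Rightarrow>\<^sub>0 nat) \<Rightarrow>\<^sub>0 'k"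

definition mp_in_vars :: "nat set \<Rightarrow> 'k::field mpoly \<Rightarrow> bool" where
  "mp_in_vars X p \<longleftrightarrow> (\<forall>m\<in>Poly_Mapping.keys p. Poly_Mapping.keys m \<subseteq> X)"

definition mp_eval :: "('k::field, 'f::field) pcurve \<Rightarrow> (nat \<Rightarrow> 'f) \<Rightarrow> 'k mpoly \<Rightarrow> 'f" where
  "mp_eval C x p = (\<Sum>m\<in>Poly_Mapping.keys p.
     emb C (Poly_Mapping.lookup p m) *
       (\<Prod>i\<in>Poly_Mapping.keys m. x i ^ Poly_Mapping.lookup m i))"

definition mp_partial :: "nat \<Rightarrow> 'k::field mpoly \<Rightarrow> 'k mpoly" where
  "mp_partial j p = (\<Sum>m\<in>Poly_Mapping.keys p.
     Poly_Mapping.single (m - Poly_Mapping.single j 1)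
       (of_nat (Poly_Mapping.lookup m j) * Poly_Mapping.lookup p m))"

text \<open>
  Jacobian criterion: the local ring at the point is a localization of \<open>K[x\<^sub>0, \<dots>, x\<^sub>n]\<close>, and among the
  relations of \<open>x\<^sub>0, \<dots>, x\<^sub>n\<close> there are \<open>n\<close> whose Jacobian matrix has rank \<open>n\<close> over
  the residue field.
\<close>

definition smooth_at :: "('k::field, 'f::field) pcurve \<Rightarrow> ('f \<Rightarrow> int) \<Rightarrow> bool" where
  "smooth_at C v \<longleftrightarrow> (\<exists>n x. \<exists>f :: nat \<Rightarrow> 'k mpoly.
     (\<forall>j\<le>n. x j \<in> local_ring v) \<and>
     (\<forall>h\<in>local_ring v. \<exists>a b. mp_in_vars {..n} a \<and> mp_in_vars {..n} b \<and>
        mp_eval C x b \<notin> max_ideal v \<and> h = mp_eval C x a / mp_eval C x b) \<and>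
     (\<forall>i<n. mp_in_vars {..n} (f i) \<and> mp_eval C x (f i) = 0) \<and>
     (\<forall>c. (\<forall>i<n. c i \<in> local_ring v) \<longrightarrow>
        (\<forall>j\<le>n. (\<Sum>i<n. c i * mp_eval C x (mp_partial j (f i))) \<in> max_ideal v) \<longrightarrow>
        (\<forall>i<n. c i \<in> max_ideal v)))"

text \<open>
  A smooth curve is geometrically irreducible iff the base field is algebraically closed in the
  function field.
\<close>

definition smooth_curve :: "('k::field, 'f::field) pcurve \<Rightarrow> bool" where
  "smooth_curve C \<longleftrightarrow> function_field C \<and>
     (\<forall>h. kalgebraic C h \<longrightarrow> h \<in> range (emb C)) \<and>
     (\<forall>v. is_place C v \<longrightarrow> smooth_at C v)"


section \<open>Divisors, genus, Picard group\<close>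

definition divisor :: "('k::field, 'f::field) pcurve \<Rightarrow> 'f divisor \<Rightarrow> bool" where
  "divisor C D \<longleftrightarrow> finite {v. D v \<noteq> 0} \<and> (\<forall>v. D v \<noteq> 0 \<longrightarrow> is_place C v)"

definition ddeg :: "('k::field, 'f::field) pcurve \<Rightarrow> 'f divisor \<Rightarrow> int" where
  "ddeg C D = (\<Sum>v | D v \<noteq> 0. D v * place_deg C v)"

definition principal_div :: "('k::field, 'f::field) pcurve \<Rightarrow> 'f \<Rightarrow> 'f divisor" where
  "principal_div C f = (\<lambda>v. if is_place C v then v f else 0)"

definition RR_space :: "('k::field, 'f::field) pcurve \<Rightarrow> 'f divisor \<Rightarrow> 'f set" where
  "RR_space C A = {f. f = 0 \<or> (\<forall>v. is_place C v \<longrightarrow> - A v \<le> v f)}"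

text \<open>The genus is the maximum of \<open>deg A - l(A) + 1\<close> over all divisors \<open>A\<close>.\<close>

definition has_genus :: "('k::field, 'f::field) pcurve \<Rightarrow> int \<Rightarrow> bool" where
  "has_genus C g \<longleftrightarrow>
     (\<exists>A. divisor C A \<and> ddeg C A - int (kdim C (RR_space C A)) + 1 = g) \<and>
     (\<forall>A. divisor C A \<longrightarrow> ddeg C A - int (kdim C (RR_space C A)) + 1 \<le> g)"

definition Div0 :: "('k::field, 'f::field) pcurve \<Rightarrow> 'f divisor monoid" where
  "Div0 C = \<lparr>carrier = {A. divisor C A \<and> ddeg C A = 0}, monoid.mult = (+), one = 0\<rparr>"

definition Prin :: "('k::field, 'f::field) pcurve \<Rightarrow> 'f divisor set" where
  "Prin C = principal_div C ` {f. f \<noteq> 0}"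

definition Pic0 :: "('k::field, 'f::field) pcurve \<Rightarrow> 'f divisor set monoid" where
  "Pic0 C = Div0 C Mod Prin C"

text \<open>The class of \<open>D - g P\<^sub>\<infinity>\<close>.\<close>

definition pic_class :: "('k::field, 'f::field) pcurve \<Rightarrow> int \<Rightarrow> 'f divisor \<Rightarrow> 'f divisor set" where
  "pic_class C g D = Prin C #>\<^bsub>Div0 C\<^esub> (D - (\<lambda>v. if v = pinf C then g else 0))"


section \<open>The affine ring\<close>

definition affR :: "('k::field, 'f::field) pcurve \<Rightarrow> 'f set" where
  "affR C = {f. f = 0 \<or> (\<forall>v. is_place C v \<and> v \<noteq> pinf C \<longrightarrow> 0 \<le> v f)}"

definition pdeg :: "('k::field, 'f::field) pcurve \<Rightarrow> 'f \<Rightarrow> int extended" where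
  "pdeg C f = (if f = 0 then Minf else Fin (- pinf C f))"

definition adiv :: "('k::field, 'f::field) pcurve \<Rightarrow> 'f \<Rightarrow> 'f divisor" where
  "adiv C f = (\<lambda>v. if is_place C v \<and> v \<noteq> pinf C then v f else 0)"

definition good :: "('k::field, 'f::field) pcurve \<Rightarrow> 'f divisor \<Rightarrow> bool" where
  "good C D \<longleftrightarrow> divisor C D \<and> 0 \<le> D \<and> D (pinf C) = 0"

definition W :: "('k::field, 'f::field) pcurve \<Rightarrow> int \<Rightarrow> 'f set" where
  "W C N = {f \<in> affR C. pdeg C f \<le> Fin N}"

definition I\<^sub>D :: "('k::field, 'f::field) pcurve \<Rightarrow> 'f divisor \<Rightarrow> 'f set" where
  "I\<^sub>D C D = {f \<in> affR C. f = 0 \<or> D \<le> adiv C f}"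

definition W\<^sub>D :: "('k::field, 'f::field) pcurve \<Rightarrow> 'f divisor \<Rightarrow> int \<Rightarrow> 'f set" where
  "W\<^sub>D C D N = W C N \<inter> I\<^sub>D C D"

definition typical :: "('k::field, 'f::field) pcurve \<Rightarrow> int \<Rightarrow> 'f divisor \<Rightarrow> bool" where
  "typical C g D \<longleftrightarrow> good C D \<and> g \<le> ddeg C D \<and>
     (\<exists>s\<in>W\<^sub>D C D (ddeg C D + g). \<exists>t\<in>W\<^sub>D C D (ddeg C D + g + 1).
        {s * a + t * b + c | a b c.
           a \<in> W C (2 * g) \<and> b \<in> W C (2 * g - 1) \<and> c \<in> W C (ddeg C D + g - 1)}
        = W C (ddeg C D + 3 * g))"

definition semi_typical :: "('k::field, 'f::field) pcurve \<Rightarrow> int \<Rightarrow> 'f divisor \<Rightarrow> bool" where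
  "semi_typical C g D \<longleftrightarrow>
     good C D \<and> g \<le> ddeg C D \<and> W\<^sub>D C D (ddeg C D + g - 1) = {0}"

definition disjoint_div :: "'f divisor \<Rightarrow> 'f divisor \<Rightarrow> bool" where
  "disjoint_div D D' \<longleftrightarrow> {v. D v \<noteq> 0} \<inter> {v. D' v \<noteq> 0} = {}"

definition echelon_basis :: "('k::field, 'f::field) pcurve \<Rightarrow> 'f set \<Rightarrow> 'f list \<Rightarrow> bool" where
  "echelon_basis C V bs \<longleftrightarrow> kindep C (set bs) \<and> kspan C (set bs) = V \<and>
     sorted_wrt (\<lambda>a b. pdeg C a < pdeg C b) bs"

text \<open>
  The triple represents the class of \<open>D - g P\<^sub>\<infinity>\<close>; \<open>Dt\<close> is the witnessing typical divisor, of which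
  \<open>D\<close> is the flip.
\<close>

definition valid_triple :: "('k::field, 'f::field) pcurve \<Rightarrow> int \<Rightarrow> 'f divisor \<Rightarrow> 'f divisor \<Rightarrow>
    'f list \<times> 'f \<times> 'f \<Rightarrow> bool" where
  "valid_triple C g Dt D = (\<lambda>(bs, st, tt).
     semi_typical C g D \<and> ddeg C D = g \<and> echelon_basis C (W\<^sub>D C D (3 * g + 1)) bs \<and>
     typical C g Dt \<and> ddeg C Dt \<in> {g, 2 * g} \<and>
     st \<in> W\<^sub>D C Dt (ddeg C Dt + g) \<and> pdeg C st = Fin (ddeg C Dt + g) \<and>
     tt \<in> W\<^sub>D C Dt (ddeg C Dt + g + 1) \<and> pdeg C tt = Fin (ddeg C Dt + g + 1) \<and>
     adiv C st = D + Dt)"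


section \<open>The procedures\<close>

text \<open>
  Echelon bases are not unique, so a procedure is modelled by the set of its possible results;
  \<open>None\<close> is failure.  \<open>succeeds_iff\<close> says that the procedure has a result and that every run
  succeeds or fails according to \<open>P\<close>, whatever bases are chosen.
\<close>

definition succeeds_iff :: "'a option set \<Rightarrow> bool \<Rightarrow> bool" where
  "succeeds_iff R P \<longleftrightarrow> R \<noteq> {} \<and> (\<forall>r\<in>R. r \<noteq> None \<longleftrightarrow> P)"

definition and_then :: "'a option set \<Rightarrow> ('a \<Rightarrow> 'b option set) \<Rightarrow> 'b option set" where
  "and_then R k = (\<Union>r\<in>R. case r of None \<Rightarrow> {None} | Some x \<Rightarrow> k x)"

text \<open>The inputs are bases of \<open>W\<^sup>N\<^sub>D\<close> and \<open>W\<^sup>N\<^sub>D\<^sub>'\<close> with \<open>N = 3g + 1\<close>.\<close>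

definition intersection_proc :: "('k::field, 'f::field) pcurve \<Rightarrow> int \<Rightarrow> 'f list \<Rightarrow> 'f list \<Rightarrow>
    'f list option set" where
  "intersection_proc C g bs bs' =
     (let V = kspan C (set bs); V' = kspan C (set bs') in
      if (V \<inter> W C (3 * g - 1)) \<inter> (V' \<inter> W C (3 * g - 1)) \<noteq> {0} then {None}
      else {Some cs | cs. echelon_basis C (V \<inter> V') cs})"

definition flip_space :: "('k::field, 'f::field) pcurve \<Rightarrow> int \<Rightarrow> int \<Rightarrow> int \<Rightarrow> 'f \<Rightarrow> 'f \<Rightarrow> 'f set" where
  "flip_space C g d N s t =
     {l \<in> W C N. \<exists>a\<in>W C (N + 1). \<exists>b\<in>W C (d + g - 1). l * t = s * a + b}"

definition flip_proc :: "('k::field, 'f::field) pcurve \<Rightarrow> int \<Rightarrow> int \<Rightarrow> int \<Rightarrow> 'f \<Rightarrow> 'f \<Rightarrow>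
    'f list option set" where
  "flip_proc C g d N s t =
     (let V = flip_space C g d N s t in
      if V \<inter> W C (2 * g - 1) \<noteq> {0} then {None} else {Some cs | cs. echelon_basis C V cs})"

definition pair_space :: "('k::field, 'f::field) pcurve \<Rightarrow> int \<Rightarrow> int \<Rightarrow> int \<Rightarrow> 'f \<Rightarrow> 'f \<Rightarrow>
    ('f \<times> 'f) set" where
  "pair_space C g d N st tt =
     {(l, l'). l \<in> W C (N + 1) \<and> l' \<in> W C (N + 2) \<and> tt * l + st * l' \<in> W C (d + g - 1)}"

text \<open>The entry \<open>L ! i\<close> is the pair of index \<open>j = i + 1\<close>.\<close>

definition pair_echelon_basis :: "('k::field, 'f::field) pcurve \<Rightarrow> int \<Rightarrow> int \<Rightarrow> ('f \<times> 'f) set \<Rightarrow>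
    ('f \<times> 'f) list \<Rightarrow> bool" where
  "pair_echelon_basis C g N V L \<longleftrightarrow>
     \<not> module.dependent (scl2 C) (set L) \<and> module.span (scl2 C) (set L) = V \<and>
     int (length L) = N - 2 * g + 2 \<and>
     (\<forall>i<length L. pdeg C (fst (L ! i)) = Fin (2 * g + int i) \<and>
                   pdeg C (snd (L ! i)) = Fin (2 * g + 1 + int i))"

text \<open>
  \<open>W\<^sup>N\<^sup>+\<^sup>1\<^sub>D\<close> enters the computation as the span of the first components of \<open>L\<close>; the last entry
  of \<open>L\<close> does not take part in the linear combinations.
\<close>

definition coeff_tuples :: "('k::field, 'f::field) pcurve \<Rightarrow> ('f \<times> 'f) list \<Rightarrow> (nat \<Rightarrow> 'k) set" where
  "coeff_tuples C L =
     {c. (\<Sum>i<length L - 1. scl C (c i) (snd (L ! i))) \<in> kspan C (fst ` set L)}"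

definition fst_combs :: "('k::field, 'f::field) pcurve \<Rightarrow> ('f \<times> 'f) list \<Rightarrow> 'f set" where
  "fst_combs C L =
     (\<lambda>c. \<Sum>i<length L - 1. scl C (c i) (fst (L ! i))) ` coeff_tuples C L"

definition snd_combs :: "('k::field, 'f::field) pcurve \<Rightarrow> ('f \<times> 'f) list \<Rightarrow> 'f set" where
  "snd_combs C L =
     (\<lambda>c. \<Sum>i<length L - 1. scl C (c i) (snd (L ! i))) ` coeff_tuples C L"

definition flip_double_proc :: "('k::field, 'f::field) pcurve \<Rightarrow> int \<Rightarrow> int \<Rightarrow> int \<Rightarrow> 'f \<Rightarrow> 'f \<Rightarrow>
    'f list option set" where
  "flip_double_proc C g d N st tt =
     (\<Union>ms \<in> {ms. echelon_basis C (W C (2 * g)) ms}.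
      \<Union>ms' \<in> {ms'. echelon_basis C (W C (2 * g - 1)) ms'}.
        if \<not> indep_mod C (W C (d + g - 1)) (map ((*) st) ms @ map ((*) tt) ms') then {None}
        else (\<Union>L \<in> {L. pair_echelon_basis C g N (pair_space C g d N st tt) L}.
          if snd_combs C L \<inter> W C (3 * g) \<noteq> {0} then {None}
          else {Some cs | cs. echelon_basis C (fst_combs C L) cs}))"

text \<open>The composite procedures use the first two elements of the basis at hand.\<close>

definition flip_first_two :: "('k::field, 'f::field) pcurve \<Rightarrow> int \<Rightarrow> int \<Rightarrow> 'f list \<Rightarrow>
    ('f list \<times> 'f \<times> 'f) option set" where
  "flip_first_two C g d xs =
     and_then (flip_proc C g d (3 * g + 1) (xs ! 0) (xs ! 1))
       (\<lambda>cs. {Some (cs, xs ! 0, xs ! 1)})"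

definition addflip :: "('k::field, 'f::field) pcurve \<Rightarrow> int \<Rightarrow> 'f list \<Rightarrow> 'f list \<Rightarrow>
    ('f list \<times> 'f \<times> 'f) option set" where
  "addflip C g bs bs' = and_then (intersection_proc C g bs bs') (flip_first_two C g (2 * g))"

definition doubleflip :: "('k::field, 'f::field) pcurve \<Rightarrow> int \<Rightarrow> int \<Rightarrow> 'f \<Rightarrow> 'f \<Rightarrow>
    ('f list \<times> 'f \<times> 'f) option set" where
  "doubleflip C g d st tt =
     and_then (flip_double_proc C g d (3 * g + 1) st tt) (flip_first_two C g (2 * g))"

definition negation :: "('k::field, 'f::field) pcurve \<Rightarrow> int \<Rightarrow> 'f list \<Rightarrow>
    ('f list \<times> 'f \<times> 'f) option set" where
  "negation C g bs = flip_first_two C g g bs"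

end

theory Submission
  imports Defs
begin

text \<open>
  The hypothesis \<open>has_genus\<close> supplies Riemann's inequality \<open>deg A + 1 - g \<le> l(A)\<close> for all divisors \<open>A\<close>,
  with equality for some \<open>A\<close>.  The rest of the divisor theory on the curve is derived from it in an
  elementary way, with the rational point \<open>P = P\<^sub>\<infinity>\<close> taking the place of Serre duality.

  Finiteness comes first.  Because the function field \<open>F\<close> is finitely generated of transcendence degree one, for every
  \<open>x \<noteq> 0\<close> sufficiently many elements of \<open>F\<close> satisfy a linear relation over \<open>K[x]\<close> whose constant terms do
  not all vanish (\<open>bounded_polynomial_relations\<close>).  Evaluated at places where \<open>x\<close> vanishes, such relations bound the degree of
  a place and, combined with weak approximation (\<open>separate_places\<close>), the number of zeros of \<open>x\<close>.
  Principal divisors have degree zero because \<open>l(- n div f)\<close> does not depend on \<open>n\<close> while Riemann's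
  inequality bounds it below by a linear function of \<open>n\<close> (\<open>ddeg_principal\<close>).  Finally a divisor of degree at least \<open>2g - 1\<close>
  is nonspecial (\<open>riemann_roch\<close>), by the argument which shows that the largest gap of a numerical semigroup
  with \<open>g\<close> gaps is at most \<open>2g - 1\<close>.

  The procedures then come down to counting dimensions.  The spaces \<open>W\<^sup>2\<^sup>g\<close>, \<open>W\<^sup>2\<^sup>g\<^sup>-\<^sup>1\<close> and
  \<open>W\<^sup>d\<^sup>+\<^sup>g\<^sup>-\<^sup>1\<close> together have the dimension of \<open>W\<^sup>d\<^sup>+\<^sup>3\<^sup>g\<close>, so that \<open>D\<close> is typical iff
  for some \<open>s\<close> and \<open>t\<close> the equation \<open>s a + t b + c = 0\<close> has only the trivial solution in these spaces (\<open>generated_eq_W_iff\<close>).  Up to a bound on degrees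
  this is the condition \<open>W' \<inter> W\<^sup>2\<^sup>g\<^sup>-\<^sup>1 = 0\<close> that a flip tests (\<open>flip_space_trivial_iff\<close>).  When it
  holds, the dimension of the flip space \<open>W'\<close> is at most Riemann's lower bound for its subspace \<open>W\<^sup>N\<^sub>A\<close>,
  and the two agree (\<open>flip_result\<close>).  An intersection of two spaces belongs to the least common multiple of the divisors,
  whose degree drops below \<open>2g\<close> if they have a common point, and then the intersection contains functions of small degree
  (\<open>intersection_trivial_iff\<close>).

  For doubling and negation, two divisors that occur as residual divisors of functions vanishing along the same divisor
  are linearly equivalent up to a multiple of \<open>P\<close>, and multiplication by a quotient of these functions carries one
  ideal to the other.  With \<open>y = - tt / st\<close> this identifies \<open>I\<^sub>D\<close> with \<open>I\<^sub>E\<close> and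
  \<open>I\<^sub>2\<^sub>D\<close> with \<open>I\<^sub>D\<^sub>+\<^sub>E\<close>; typicality of \<open>Dt\<close> makes \<open>D\<close> and \<open>E\<close> disjoint
  (\<open>disjoint_D_E\<close>), so that \<open>I\<^sub>D\<^sub>+\<^sub>E\<close> is \<open>I\<^sub>D \<inter> I\<^sub>E\<close>.  The same device
  transports typicality from \<open>Dt\<close> to the flip of its flip (\<open>typical_flip_back\<close>).
\<close>


section \<open>Finite-dimensional subspaces\<close>

text \<open>
  A function field has infinite dimension over its field of constants, and \<open>dim\<close> is \<open>0\<close> on subspaces without
  a finite basis; so finite dimensionality has to be tracked separately.
\<close>

locale linear_space = vector_space
begin

definition fin_dim :: "'b set \<Rightarrow> bool" where
  "fin_dim V \<longleftrightarrow> (\<exists>B. finite B \<and> V \<subseteq> span B)"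

lemma fin_dim_mono: "U \<subseteq> V \<Longrightarrow> fin_dim V \<Longrightarrow> fin_dim U"
  unfolding fin_dim_def by blast

lemma fin_dim_span: "finite B \<Longrightarrow> fin_dim (span B)"
  unfolding fin_dim_def by blast

lemma fin_dim_basis:
  assumes "fin_dim V"
  obtains B where "finite B" "B \<subseteq> V" "independent B" "V \<subseteq> span B" "card B = dim V"
proof -
  obtain T where "finite T" "V \<subseteq> span T" using assms unfolding fin_dim_def by blast
  moreover obtain B where "B \<subseteq> V" "independent B" "V \<subseteq> span B" "card B = dim V" by (rule basis_exists)
  ultimately show thesis using independent_span_bound[of T B] that by auto
qed

lemma dim_pos_imp_fin_dim: "0 < dim V \<Longrightarrow> fin_dim V"
  unfolding fin_dim_def
  by (rule basis_exists[of V]) (use card_ge_0_finite in metis)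

lemma independent_card_le:
  assumes "fin_dim V" "S \<subseteq> V" "independent S"
  shows "finite S \<and> card S \<le> dim V"
proof -
  obtain B where "finite B" "V \<subseteq> span B" "card B = dim V" using fin_dim_basis[OF assms(1)] .
  then show ?thesis using independent_span_bound[of B S] assms(2,3) by auto
qed

lemma dim_mono_fin: "fin_dim V \<Longrightarrow> U \<subseteq> V \<Longrightarrow> dim U \<le> dim V"
  by (rule basis_exists[of U]) (metis independent_card_le subset_trans)

lemma subspace_eq_of_dim_le:
  assumes "subspace U" "U \<subseteq> V" "fin_dim V" "dim V \<le> dim U"
  shows "U = V"
proof (rule ccontr)
  assume "U \<noteq> V"
  then obtain x where x: "x \<in> V" "x \<notin> U" using assms(2) by blast
  obtain B where B: "finite B" "B \<subseteq> U" "independent B" "U \<subseteq> span B" "card B = dim U"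
    using fin_dim_basis[OF fin_dim_mono[OF assms(2,3)]] .
  have "x \<notin> span B" using x B(2) assms(1) span_minimal by blast
  then have "independent (insert x B)" "x \<notin> B" using B(3) independent_insertI span_base by auto
  then show False using independent_card_le[OF assms(3), of "insert x B"] B x assms(2,4) by auto
qed

text \<open>
  Members of the family may coincide, and then their difference is a nontrivial relation.
\<close>

lemma finite_family_dependent:
  assumes T: "finite T" and I: "finite I" "card T < card I" and x: "\<And>i. i \<in> I \<Longrightarrow> x i \<in> span T"
  obtains c where "\<exists>i\<in>I. c i \<noteq> 0" "(\<Sum>i\<in>I. c i *s x i) = 0"
proof (cases "inj_on x I")
  case True
  have "dependent (x ` I)"
    using independent_span_bound[OF T, of "x ` I"] card_image[OF True] I x by (auto simp: image_subset_iff)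
  then obtain u where u: "\<exists>v\<in>x ` I. u v \<noteq> 0" "(\<Sum>v\<in>x ` I. u v *s v) = 0"
    using dependent_finite[of "x ` I"] I(1) by auto
  show thesis
  proof (rule that[of "u \<circ> x"])
    show "\<exists>i\<in>I. (u \<circ> x) i \<noteq> 0" using u(1) by auto
    show "(\<Sum>i\<in>I. (u \<circ> x) i *s x i) = 0" using u(2) by (simp add: sum.reindex[OF True])
  qed
next
  case False
  then obtain i j where ij: "i \<in> I" "j \<in> I" "i \<noteq> j" "x i = x j" by (auto simp: inj_on_def)
  let ?c = "\<lambda>k. if k = i then 1 else if k = j then - 1 else (0::'a)"
  have "(\<Sum>k\<in>I. ?c k *s x k) = (\<Sum>k\<in>{i,j}. ?c k *s x k)"
    using I ij by (intro sum.mono_neutral_right) auto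
  also have "\<dots> = 0" using ij by simp
  finally have "(\<Sum>k\<in>I. ?c k *s x k) = 0" .
  moreover have "\<exists>k\<in>I. ?c k \<noteq> 0" by (rule bexI[of _ i]) (use ij in simp_all)
  ultimately show thesis by (rule that[rotated])
qed

lemma independent_union_disjoint_spans:
  assumes "independent S" "independent T" "finite S" "finite T" "span S \<inter> span T = {0}"
  shows "independent (S \<union> T) \<and> S \<inter> T = {}"
proof
  have disj: "S \<inter> T = {}"
  proof (rule ccontr)
    assume "S \<inter> T \<noteq> {}"
    then obtain x where "x \<in> S" "x \<in> T" by blast
    then have "x = 0" using assms(5) span_base[of x S] span_base[of x T] by blast
    then show False using assms(1) dependent_zero[of S] \<open>x \<in> S\<close> by blast
  qed
  show "S \<inter> T = {}" by fact
  show "independent (S \<union> T)"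
  proof (rule independent_if_scalars_zero)
    fix f x assume s: "(\<Sum>x\<in>S \<union> T. f x *s x) = 0" and x: "x \<in> S \<union> T"
    let ?a = "\<Sum>x\<in>S. f x *s x" and ?b = "\<Sum>x\<in>T. f x *s x"
    have eq: "?a = - ?b"
      using s disj assms(3,4) by (simp add: sum.union_disjoint eq_neg_iff_add_eq_0)
    have "?a \<in> span S" by (intro span_sum span_scale span_base)
    moreover have "?a \<in> span T" unfolding eq by (intro span_neg span_sum span_scale span_base)
    ultimately have a0: "?a = 0" using assms(5) by blast
    then have b0: "?b = 0" using eq by simp
    show "f x = 0"
      using x independentD[OF assms(1,3) order_refl a0] independentD[OF assms(2,4) order_refl b0]
      by blast
  qed (use assms in simp)
qed

text \<open>A basis of \<open>A \<inter> B\<close> extends to bases of \<open>A\<close> and \<open>B\<close>, and these together form a basis of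
  \<open>A + B\<close>.\<close>

lemma dim_sum_inter:
  assumes "subspace A" "subspace B" "fin_dim A" "fin_dim B"
  shows "fin_dim {a + b | a b. a \<in> A \<and> b \<in> B}"
    and "dim {a + b | a b. a \<in> A \<and> b \<in> B} + dim (A \<inter> B) = dim A + dim B"
proof -
  obtain Z where Z: "finite Z" "Z \<subseteq> A \<inter> B" "independent Z" "A \<inter> B \<subseteq> span Z" "card Z = dim (A \<inter> B)"
    using fin_dim_basis[OF fin_dim_mono[OF Int_lower1 assms(3)]] .
  obtain X where X: "Z \<subseteq> X" "X \<subseteq> A" "independent X" "A \<subseteq> span X"
    using maximal_independent_subset_extend[OF order_trans[OF Z(2) Int_lower1] Z(3)] .
  obtain Y where Y: "Z \<subseteq> Y" "Y \<subseteq> B" "independent Y" "B \<subseteq> span Y"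
    using maximal_independent_subset_extend[OF order_trans[OF Z(2) Int_lower2] Z(3)] .
  have fX: "finite X" and fY: "finite Y"
    using independent_card_le[OF assms(3) X(2,3)] independent_card_le[OF assms(4) Y(2,3)] by simp_all
  have sX: "span X = A" and sY: "span Y = B"
    using span_subspace[OF X(2,4) assms(1)] span_subspace[OF Y(2,4) assms(2)] by simp_all
  have "span X \<inter> span (Y - Z) \<subseteq> {0}"
  proof
    fix v assume v: "v \<in> span X \<inter> span (Y - Z)"
    then have "v \<in> span Z" using sX sY Z(4) span_mono[of "Y - Z" Y] by blast
    then obtain p where p: "v = (\<Sum>z\<in>Z. p z *s z)" using span_finite[OF Z(1)] by auto
    from v obtain q where q: "v = (\<Sum>z\<in>Y - Z. q z *s z)" using span_finite[of "Y - Z"] fY by auto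
    let ?r = "\<lambda>y. if y \<in> Z then p y else - q y"
    have "(\<Sum>y\<in>Y. ?r y *s y) = (\<Sum>y\<in>Y - Z. ?r y *s y) + (\<Sum>y\<in>Z. ?r y *s y)"
      using fY Y(1) by (rule sum.subset_diff[rotated])
    also have "(\<Sum>y\<in>Z. ?r y *s y) = v" unfolding p by (rule sum.cong) simp_all
    also have "(\<Sum>y\<in>Y - Z. ?r y *s y) = - v"
      unfolding q sum_negf[symmetric] by (rule sum.cong) simp_all
    finally have "(\<Sum>y\<in>Y. ?r y *s y) = 0" by simp
    then have r0: "?r y = 0" if "y \<in> Z" for y
      by (rule independentD[OF Y(3) fY order_refl]) (use that Y(1) in blast)
    have "p y = 0" if "y \<in> Z" for y using r0[OF that] that by simp
    then show "v \<in> {0}" using p by simp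
  qed
  then have "span X \<inter> span (Y - Z) = {0}" using span_zero by blast
  then have U: "independent (X \<union> (Y - Z))" "X \<inter> (Y - Z) = {}"
    using independent_union_disjoint_spans[of X "Y - Z"] X(3) Y(3) fX fY independent_mono[of Y "Y - Z"]
    by auto
  have "X \<union> (Y - Z) = X \<union> Y" using X(1) by blast
  then have S: "span (X \<union> (Y - Z)) = {a + b | a b. a \<in> A \<and> b \<in> B}"
    by (simp add: span_Un sX sY)
  show "fin_dim {a + b | a b. a \<in> A \<and> b \<in> B}"
    using fX fY fin_dim_span[of "X \<union> (Y - Z)"] unfolding S by auto
  have "dim {a + b | a b. a \<in> A \<and> b \<in> B} = card X + card (Y - Z)"
    unfolding S[symmetric] using U fX fY by (simp add: dim_eq_card_independent card_Un_disjoint)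
  moreover have "card (Y - Z) + card Z = card Y"
    using Y(1) fY Z(1) by (simp add: card_Diff_subset card_mono)
  moreover have "card X = dim A" "card Y = dim B"
    using X Y by (auto intro: basis_card_eq_dim)
  ultimately show "dim {a + b | a b. a \<in> A \<and> b \<in> B} + dim (A \<inter> B) = dim A + dim B"
    using Z(5) by simp
qed

text \<open>
  Among more than \<open>card B\<close> vectors that extend a basis of \<open>U\<close> to one of \<open>V\<close>, the images of some nontrivial
  combination cancel modulo \<open>M\<close>; the combination then lies in \<open>U\<close>, contrary to independence.  The application is to
  \<open>L(A)\<close> inside \<open>L(A + v)\<close>, with the residue field of \<open>v\<close> spanned by \<open>B\<close>.
\<close>

lemma dim_le_add_card:
  assumes U: "subspace U" "U \<subseteq> V" "fin_dim U" and V: "subspace V"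
    and phi: "\<And>x y. \<phi> (x + y) = \<phi> x + \<phi> y" "\<And>c x. \<phi> (c *s x) = c *s \<phi> x"
    and B: "finite B" and M: "subspace M"
    and mod: "\<And>f. f \<in> V \<Longrightarrow> \<exists>m\<in>M. \<phi> f - m \<in> span B"
    and ker: "\<And>f. f \<in> V \<Longrightarrow> \<phi> f \<in> M \<Longrightarrow> f \<in> U"
  shows "fin_dim V \<and> dim V \<le> dim U + card B"
proof -
  obtain X where X: "finite X" "X \<subseteq> U" "independent X" "U \<subseteq> span X" "card X = dim U"
    using fin_dim_basis[OF U(3)] .
  obtain Y where Y: "X \<subseteq> Y" "Y \<subseteq> V" "independent Y" "V \<subseteq> span Y"
    using maximal_independent_subset_extend[OF order_trans[OF X(2) U(2)] X(3)] .
  have phi0: "\<phi> 0 = 0" using phi(1)[of 0 0] by simp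
  have phi_sum: "\<phi> (\<Sum>i\<in>I. c i *s i) = (\<Sum>i\<in>I. c i *s \<phi> i)" for I c
    by (induct I rule: infinite_finite_induct) (auto simp: phi0 phi)
  have key: "finite F \<Longrightarrow> F \<subseteq> Y - X \<Longrightarrow> card F \<le> card B" for F
  proof (rule ccontr)
    assume F: "finite F" "F \<subseteq> Y - X" "\<not> card F \<le> card B"
    have "\<forall>f\<in>F. \<exists>m\<in>M. \<phi> f - m \<in> span B" using mod F(2) Y(2) by blast
    then obtain m where m: "\<And>f. f \<in> F \<Longrightarrow> m f \<in> M" "\<And>f. f \<in> F \<Longrightarrow> \<phi> f - m f \<in> span B"
      by metis
    obtain c where c: "\<exists>i\<in>F. c i \<noteq> 0" "(\<Sum>i\<in>F. c i *s (\<phi> i - m i)) = 0"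
      by (rule finite_family_dependent[OF B F(1) _ m(2)]) (use F(3) in simp_all)
    let ?s = "\<Sum>i\<in>F. c i *s i"
    have "\<phi> ?s = (\<Sum>i\<in>F. c i *s m i)"
      using c(2) by (simp add: phi_sum scale_right_diff_distrib sum_subtractf)
    also have "\<dots> \<in> M" by (intro subspace_sum[OF M] subspace_scale[OF M] m(1))
    finally have "\<phi> ?s \<in> M" .
    moreover have "?s \<in> V"
      by (intro subspace_sum[OF V] subspace_scale[OF V]) (use F(2) Y(2) in blast)
    ultimately have "?s \<in> U" by (rule ker[rotated])
    then have "?s \<in> span X" using X(4) by blast
    then obtain p where p: "?s = (\<Sum>x\<in>X. p x *s x)" using span_finite[OF X(1)] by auto
    let ?r = "\<lambda>y. if y \<in> F then c y else - p y"
    have "(\<Sum>y\<in>F \<union> X. ?r y *s y) = (\<Sum>y\<in>F. ?r y *s y) + (\<Sum>y\<in>X. ?r y *s y)"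
      using F X(1) by (intro sum.union_disjoint) auto
    also have "(\<Sum>y\<in>X. ?r y *s y) = (\<Sum>y\<in>X. - (p y *s y))"
      using F(2) by (intro sum.cong) auto
    finally have "(\<Sum>y\<in>F \<union> X. ?r y *s y) = 0" using p by (simp add: sum_negf)
    then have "?r y = 0" if "y \<in> F" for y
      by (rule independentD[OF Y(3), rotated 2]) (use that F Y(1) X(1) in auto)
    then show False using c(1) by auto
  qed
  have fin: "finite (Y - X)"
  proof (rule ccontr)
    assume "infinite (Y - X)"
    then obtain F where "finite F" "F \<subseteq> Y - X" "card F = Suc (card B)"
      using infinite_arbitrarily_large[of "Y - X" "Suc (card B)"] by auto
    then show False using key[of F] by simp
  qed
  then have "finite Y" using X(1) by simp
  have "dim V = card Y" using Y(2-4) by (simp add: basis_card_eq_dim)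
  also have "\<dots> = card X + card (Y - X)"
    using Y(1) fin X(1) by (simp add: card_Diff_subset card_mono \<open>finite Y\<close>)
  finally show ?thesis using key[OF fin] X(5) \<open>finite Y\<close> Y(4) unfolding fin_dim_def by auto
qed

end

section \<open>Function fields in one variable and their places\<close>

locale fn_field =
  fixes C :: "('k::field, 'f::field) pcurve"
  assumes function_field: "function_field C"
begin

lemma field_emb: "field_embedding (emb C)"
  using function_field unfolding function_field_def by blast

lemma emb_1 [simp]: "emb C 1 = 1"
  and emb_add: "emb C (a + b) = emb C a + emb C b"
  and emb_mult: "emb C (a * b) = emb C a * emb C b"
  using field_emb unfolding field_embedding_def by blast+

lemma emb_0 [simp]: "emb C 0 = 0"
  using emb_add[of 0 0] by (metis add_cancel_right_right add.right_neutral)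

lemma emb_minus: "emb C (- a) = - emb C a"
  using emb_add[of a "- a"] by (simp add: eq_neg_iff_add_eq_0 add.commute)

lemma emb_eq_0_iff [simp]: "emb C a = 0 \<longleftrightarrow> a = 0"
  using emb_mult[of a "inverse a"] by (cases "a = 0") auto

lemma scl_mult: "y * scl C c x = scl C c (y * x)"
  by (simp add: scl_def algebra_simps)

lemma scl_sum: "y * (\<Sum>i\<in>I. scl C (c i) (x i)) = (\<Sum>i\<in>I. scl C (c i) (y * x i))"
  by (simp add: sum_distrib_left scl_mult)

end

sublocale fn_field \<subseteq> K: linear_space "scl C"
  by unfold_locales (simp_all add: scl_def emb_add emb_mult algebra_simps)

sublocale fn_field \<subseteq> K2: linear_space "scl2 C"
  by unfold_locales (simp_all add: scl2_def emb_add emb_mult algebra_simps prod_eq_iff)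

context fn_field
begin

lemma linear_iff': "Vector_Spaces.linear (scl C) (scl C) \<phi> \<longleftrightarrow>
    (\<forall>x y. \<phi> (x + y) = \<phi> x + \<phi> y) \<and> (\<forall>c x. \<phi> (scl C c x) = scl C c (\<phi> x))"
  using K.vector_space_axioms by (simp add: Vector_Spaces.linear_iff)

lemma linear_mult: "Vector_Spaces.linear (scl C) (scl C) ((*) y)"
  by (simp add: linear_iff' scl_mult distrib_left)

lemma dim_mult_image:
  assumes "y \<noteq> 0"
  shows "K.dim ((*) y ` V) = K.dim V"
proof -
  interpret pair: vector_space_pair "scl C" "scl C" ..
  obtain B where B: "B \<subseteq> V" "K.independent B" "V \<subseteq> K.span B" "card B = K.dim V"
    by (rule K.basis_exists)
  have inj: "inj ((*) y)" using assms by (auto simp: inj_on_def)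
  have "K.independent ((*) y ` B)"
    using pair.linear_independent_injective_image[OF linear_mult B(2)] inj inj_on_subset by blast
  moreover have "(*) y ` V \<subseteq> K.span ((*) y ` B)"
    using pair.linear_spans_image[OF linear_mult B(3)] .
  moreover have "card ((*) y ` B) = K.dim V"
    using B(4) card_image[OF inj_on_subset[OF inj]] by simp
  ultimately show ?thesis using B(1) by (intro K.dim_unique[of "(*) y ` B"]) auto
qed

lemma fin_dim_mult_image: "K.fin_dim V \<Longrightarrow> K.fin_dim ((*) y ` V)"
proof -
  interpret pair: vector_space_pair "scl C" "scl C" ..
  show "K.fin_dim V \<Longrightarrow> K.fin_dim ((*) y ` V)"
    unfolding K.fin_dim_def using pair.linear_spans_image[OF linear_mult] by (meson finite_imageI)
qed

lemma subspace_mult_image: "K.subspace V \<Longrightarrow> K.subspace ((*) y ` V)"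
proof -
  interpret pair: vector_space_pair "scl C" "scl C" ..
  show "K.subspace V \<Longrightarrow> K.subspace ((*) y ` V)"
    by (rule pair.linear_subspace_image[OF linear_mult])
qed


subsection \<open>Boundedness of algebraic relations\<close>

text \<open>
  If \<open>F\<close> is spanned over \<open>K(x\<^sub>0)\<close> by a finite set \<open>B\<close>, then the elements with polynomial coordinates
  of degree at most \<open>d\<close> form a space whose dimension grows like \<open>d * card B\<close>, and multiplication by
  any fixed \<open>x\<close> raises \<open>d\<close> by a constant that depends only on \<open>x\<close>, up to a denominator.  So more than a fixed number of
  elements of \<open>F\<close> always satisfy a nontrivial linear relation with coefficients in \<open>K[x]\<close>.
\<close>

definition pol :: "'f \<Rightarrow> 'k poly \<Rightarrow> 'f" where
  "pol x p = poly (map_poly (emb C) p) x"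

lemma pol_sum:
  assumes "degree p \<le> d"
  shows "pol x p = (\<Sum>i\<le>d. emb C (coeff p i) * x ^ i)"
proof -
  have "pol x p = (\<Sum>i\<le>degree p. emb C (coeff p i) * x ^ i)"
    by (simp add: pol_def poly_altdef coeff_map_poly degree_map_poly)
  also have "\<dots> = (\<Sum>i\<le>d. emb C (coeff p i) * x ^ i)"
    using assms by (intro sum.mono_neutral_left) (auto simp: coeff_eq_0)
  finally show ?thesis .
qed

lemma pol_0 [simp]: "pol x 0 = 0"
  by (simp add: pol_def)

lemma pol_1 [simp]: "pol x 1 = 1"
  by (simp add: pol_def)

lemma pol_pCons: "pol x (pCons a p) = emb C a + x * pol x p"
  by (cases "pCons a p = 0") (auto simp: pol_def map_poly_pCons)

lemma pol_add: "pol x (p + q) = pol x p + pol x q"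
proof -
  let ?d = "max (degree p) (degree q)"
  have "degree (p + q) \<le> ?d" by (rule degree_add_le_max)
  then show ?thesis
    by (simp add: pol_sum[of "p + q" ?d] pol_sum[of p ?d] pol_sum[of q ?d] emb_add
        sum.distrib[symmetric] algebra_simps)
qed

lemma pol_smult: "pol x (smult a p) = emb C a * pol x p"
  by (induct p) (auto simp: pol_pCons emb_mult algebra_simps)

lemma pol_mult: "pol x (p * q) = pol x p * pol x q"
  by (induct p) (auto simp: pol_pCons pol_add pol_smult algebra_simps)

lemma pol_prod: "pol x (\<Prod>i\<in>I. q i) = (\<Prod>i\<in>I. pol x (q i))"
  by (induct I rule: infinite_finite_induct) (auto simp: pol_mult)

definition pol_space :: "'f \<Rightarrow> 'f set \<Rightarrow> nat \<Rightarrow> 'f set" where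
  "pol_space x B d = K.span ((\<lambda>(i, b). x ^ i * b) ` ({..d} \<times> B))"

lemma pol_space_mono: "d \<le> e \<Longrightarrow> pol_space x B d \<subseteq> pol_space x B e"
  unfolding pol_space_def by (intro K.span_mono image_mono) auto

lemma pol_in_pol_space:
  assumes "b \<in> B" "degree p \<le> d"
  shows "pol x p * b \<in> pol_space x B d"
proof -
  have "pol x p * b = (\<Sum>i\<le>d. scl C (coeff p i) (x ^ i * b))"
    by (simp add: pol_sum[OF assms(2)] sum_distrib_right scl_def mult.assoc)
  also have "\<dots> \<in> pol_space x B d"
    unfolding pol_space_def using assms(1)
    by (intro K.span_sum K.span_scale K.span_base) (rule image_eqI[of _ _ "(_, b)"], auto)
  finally show ?thesis .
qed

text \<open>
  Multiplication by \<open>y\<close> commutes with the powers of \<open>x\<close>, so it is enough to control \<open>y b\<close> for the generators \<open>b\<close>.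
\<close>

lemma mult_pol_space:
  assumes "\<And>b. b \<in> B \<Longrightarrow> y * b \<in> pol_space x B e" "h \<in> pol_space x B d"
  shows "y * h \<in> pol_space x B (d + e)"
  using assms(2) unfolding pol_space_def[of x B d]
proof (induct rule: K.span_induct_alt)
  case base
  then show ?case by (simp add: pol_space_def K.span_zero)
next
  case (step c z h)
  from step(1) obtain i b where ib: "i \<le> d" "b \<in> B" "z = x ^ i * b" by auto
  have shift: "x ^ i * w \<in> pol_space x B (i + e)" if "w \<in> pol_space x B e" for w
    using that unfolding pol_space_def[of x B e]
  proof (induct rule: K.span_induct_alt)
    case base
    then show ?case by (simp add: pol_space_def K.span_zero)
  next
    case (step c' z' w)
    then obtain j b' where jb: "j \<le> e" "b' \<in> B" "z' = x ^ j * b'" by auto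
    have "x ^ i * z' = x ^ (i + j) * b'" by (simp only: jb(3) power_add mult.assoc)
    then have "x ^ i * z' \<in> pol_space x B (i + e)"
      unfolding pol_space_def using jb by (intro K.span_base image_eqI[of _ _ "(i + j, b')"]) auto
    then have "scl C c' (x ^ i * z') + x ^ i * w \<in> pol_space x B (i + e)"
      using step(2) unfolding pol_space_def by (intro K.span_add K.span_scale)
    then show ?case by (simp add: distrib_left scl_mult)
  qed
  have "x ^ i * (y * b) \<in> pol_space x B (d + e)"
    using shift[OF assms(1)[OF ib(2)]] pol_space_mono[of "i + e" "d + e"] ib(1) by auto
  then have "scl C c (x ^ i * (y * b)) + y * h \<in> pol_space x B (d + e)"
    using step(2) unfolding pol_space_def by (intro K.span_add K.span_scale)
  moreover have "y * z = x ^ i * (y * b)" by (simp add: ib(3) algebra_simps)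
  ultimately show ?case by (simp only: distrib_left scl_mult)
qed

lemma card_pol_space_generators:
  assumes "finite B"
  shows "card ((\<lambda>(i, b). x ^ i * b) ` ({..d} \<times> B)) \<le> Suc d * card B"
  using card_image_le[of "{..d} \<times> B" "\<lambda>(i, b). x ^ i * b"] assms by (simp add: card_cartesian_product)

lemma bounded_polynomial_relations_aux:
  fixes x :: 'f
  shows "\<exists>m. \<forall>(J :: 'j set) z. finite J \<and> m < card J \<longrightarrow> (\<exists>M c. (\<exists>i\<le>M. \<exists>j\<in>J. c i j \<noteq> 0) \<and>
    (\<Sum>j\<in>J. (\<Sum>i\<le>M. emb C (c i j) * x ^ i) * z j) = 0)"
proof -
  obtain x0 B where B: "finite B" and
    gen: "\<And>h. \<exists>c. h = (\<Sum>b\<in>B. c b * b) \<and> (\<forall>b\<in>B. \<exists>p q. c b = pol x0 p / pol x0 q)"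
    using function_field unfolding function_field_def pol_def by blast
  let ?P = "pol_space x0 B"
  have denominator: "\<exists>q d. pol x0 q \<noteq> 0 \<and> pol x0 q * h \<in> ?P d" for h
  proof -
    obtain c where c: "h = (\<Sum>b\<in>B. c b * b)" "\<forall>b\<in>B. \<exists>p q. c b = pol x0 p / pol x0 q"
      using gen by blast
    have "\<forall>b\<in>B. \<exists>p q. c b = pol x0 p / pol x0 q \<and> pol x0 q \<noteq> 0"
    proof
      fix b assume "b \<in> B"
      then obtain p q where pq: "c b = pol x0 p / pol x0 q" using c(2) by blast
      \<comment> \<open>A fraction with vanishing denominator has the value 0, which \<open>0 / 1\<close> represents as well.\<close>
      show "\<exists>p q. c b = pol x0 p / pol x0 q \<and> pol x0 q \<noteq> 0"
      proof (cases "pol x0 q = 0")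
        case True
        then show ?thesis using pq by (intro exI[of _ 0] exI[of _ 1]) simp
      qed (use pq in blast)
    qed
    then obtain p q where pq: "\<And>b. b \<in> B \<Longrightarrow> c b = pol x0 (p b) / pol x0 (q b)"
      "\<And>b. b \<in> B \<Longrightarrow> pol x0 (q b) \<noteq> 0" by metis
    let ?q = "\<Prod>b\<in>B. q b" and ?r = "\<lambda>b. (\<Prod>b'\<in>B - {b}. q b') * p b"
    let ?d = "\<Sum>b\<in>B. degree (?r b)"
    have "pol x0 ?q * (c b * b) = pol x0 (?r b) * b" if "b \<in> B" for b
      using pq[OF that] B that by (simp add: pol_mult pol_prod prod.remove[of B b])
    then have "pol x0 ?q * h = (\<Sum>b\<in>B. pol x0 (?r b) * b)"
      unfolding c(1) sum_distrib_left by (rule sum.cong[OF refl])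
    also have "\<dots> \<in> ?P ?d"
    proof -
      have "pol x0 (?r b) * b \<in> ?P ?d" if "b \<in> B" for b
        using that B by (intro pol_in_pol_space member_le_sum) auto
      then show ?thesis unfolding pol_space_def by (rule K.span_sum)
    qed
    finally have "pol x0 ?q * h \<in> ?P ?d" .
    moreover have "pol x0 ?q \<noteq> 0" using B pq(2) by (simp add: pol_prod)
    ultimately show ?thesis by blast
  qed
  \<comment> \<open>A common denominator for finitely many elements.\<close>
  have common: "\<exists>q d. pol x0 q \<noteq> 0 \<and> (\<forall>i\<in>I. pol x0 q * h i \<in> ?P d)" if "finite I" for I :: "'i set" and h
    using that
  proof induct
    case empty
    then show ?case by (intro exI[of _ 1]) simp
  next
    case (insert i I)
    then obtain q d where q: "pol x0 q \<noteq> 0" "\<forall>i\<in>I. pol x0 q * h i \<in> ?P d" by blast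
    obtain q' d' where q': "pol x0 q' \<noteq> 0" "pol x0 q' * h i \<in> ?P d'" using denominator by blast
    have up: "pol x0 r * y \<in> ?P (e + degree r)" if "y \<in> ?P e" for r y e
      using mult_pol_space[OF _ that] pol_in_pol_space by blast
    let ?e = "(d + degree q') + (d' + degree q)"
    have "pol x0 (q * q') * h k \<in> ?P ?e" if "k \<in> insert i I" for k
    proof (cases "k = i")
      case True
      have e: "pol x0 (q * q') * h k = pol x0 q * (pol x0 q' * h i)" by (simp add: True pol_mult)
      show ?thesis
        unfolding e using up[OF q'(2), of q] pol_space_mono[of "d' + degree q" ?e x0 B] by auto
    next
      case False
      have e: "pol x0 (q * q') * h k = pol x0 q' * (pol x0 q * h k)" by (simp add: pol_mult)
      have "pol x0 q * h k \<in> ?P d" using q(2) that False by blast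
      from up[OF this, of q'] show ?thesis
        unfolding e using pol_space_mono[of "d + degree q'" ?e x0 B] by auto
    qed
    then show ?case using q(1) q'(1) by (intro exI[of _ "q * q'"] exI[of _ ?e]) (auto simp: pol_mult)
  qed
  obtain Q D0 where Q: "pol x0 Q \<noteq> 0" "\<And>b. b \<in> B \<Longrightarrow> pol x0 Q * (x * b) \<in> ?P D0"
    using common[OF B, of "\<lambda>b. x * b"] by blast
  define D where "D = D0 + degree Q"
  define n where "n = card B"
  have mx: "(pol x0 Q * x) * h \<in> ?P (d + D)" and mr: "pol x0 Q * h \<in> ?P (d + D)"
    if "h \<in> ?P d" for h d
  proof -
    have "(pol x0 Q * x) * b \<in> ?P D" if "b \<in> B" for b
      using Q(2)[OF that] pol_space_mono[of D0 D x0 B] by (auto simp: D_def mult.assoc)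
    then show "(pol x0 Q * x) * h \<in> ?P (d + D)" by (rule mult_pol_space[OF _ that])
    have "pol x0 Q * b \<in> ?P D" if "b \<in> B" for b
      using pol_in_pol_space[OF that] by (simp add: D_def)
    then show "pol x0 Q * h \<in> ?P (d + D)" by (rule mult_pol_space[OF _ that])
  qed
  show ?thesis
  proof (rule exI[of _ "n * D"], intro allI impI, elim conjE)
    fix J :: "'j set" and z assume J: "finite J" "n * D < card J"
    obtain q d where q: "pol x0 q \<noteq> 0" "\<And>j. j \<in> J \<Longrightarrow> pol x0 q * z j \<in> ?P d"
      using common[OF J(1), of z] by auto
    \<comment> \<open>This many powers suffice for \<open>(M + 1) (n D + 1) > n (d + M D + 1)\<close>.\<close>
    define M where "M = n * d + n"
    \<comment> \<open>The extra factors bring all powers of \<open>x\<close> to the common denominator \<open>Q\<^sup>M\<close>.\<close>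
    have powers: "pol x0 Q ^ (i + k) * x ^ i * (pol x0 q * z j) \<in> ?P (d + (i + k) * D)"
      if "j \<in> J" for i k j
    proof (induct i)
      case 0
      show ?case
      proof (induct k)
        case 0
        then show ?case using q(2)[OF that] by simp
      next
        case (Suc k)
        have e: "pol x0 Q ^ (0 + Suc k) * x ^ 0 * (pol x0 q * z j) =
            pol x0 Q * (pol x0 Q ^ (0 + k) * x ^ 0 * (pol x0 q * z j))"
          "d + (0 + Suc k) * D = (d + (0 + k) * D) + D" by simp_all
        show ?case unfolding e by (rule mr[OF Suc])
      qed
    next
      case (Suc i)
      have e: "pol x0 Q ^ (Suc i + k) * x ^ Suc i * (pol x0 q * z j) =
          pol x0 Q * x * (pol x0 Q ^ (i + k) * x ^ i * (pol x0 q * z j))"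
        "d + (Suc i + k) * D = (d + (i + k) * D) + D" by simp_all
      show ?case unfolding e by (rule mx[OF Suc])
    qed
    let ?I = "{..M} \<times> J" and ?G = "(\<lambda>(i, b). x0 ^ i * b) ` ({..d + M * D} \<times> B)"
    let ?w = "\<lambda>(i, j). (pol x0 Q ^ M * pol x0 q) * (x ^ i * z j)"
    have w: "?w ij \<in> K.span ?G" if "ij \<in> ?I" for ij
    proof -
      obtain i j where ij: "ij = (i, j)" "i \<le> M" "j \<in> J" using \<open>ij \<in> ?I\<close> by (cases ij) auto
      have e: "?w ij = pol x0 Q ^ (i + (M - i)) * x ^ i * (pol x0 q * z j)"
        "d + M * D = d + (i + (M - i)) * D" using ij(1,2) by (simp_all add: ac_simps)
      show ?thesis
        using powers[OF ij(3), of i "M - i"] unfolding e(1) unfolding e(2) pol_space_def .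
    qed
    have "card ?G \<le> Suc (d + M * D) * n"
      unfolding n_def by (rule card_pol_space_generators[OF B])
    also have "\<dots> < Suc M * Suc (n * D)" by (simp add: M_def algebra_simps)
    also have "\<dots> \<le> Suc M * card J" using J(2) by (intro mult_left_mono) simp_all
    finally have lt: "card ?G < card ?I" by (simp add: card_cartesian_product)
    obtain c where c: "\<exists>ij\<in>?I. c ij \<noteq> 0" "(\<Sum>ij\<in>?I. scl C (c ij) (?w ij)) = 0"
      by (rule K.finite_family_dependent[OF _ _ lt w]) (use B J(1) in simp_all)
    have "(\<Sum>ij\<in>?I. scl C (c ij) (?w ij)) =
        (pol x0 Q ^ M * pol x0 q) * (\<Sum>(i, j)\<in>?I. emb C (c (i, j)) * (x ^ i * z j))"
      unfolding sum_distrib_left by (rule sum.cong) (auto simp: scl_def mult.left_commute)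
    then have "(pol x0 Q ^ M * pol x0 q) * (\<Sum>(i, j)\<in>?I. emb C (c (i, j)) * (x ^ i * z j)) = 0"
      using c(2) by simp
    then have "0 = (\<Sum>(i, j)\<in>?I. emb C (c (i, j)) * (x ^ i * z j))" using Q(1) q(1) by simp
    also have "\<dots> = (\<Sum>i\<le>M. \<Sum>j\<in>J. emb C (c (i, j)) * (x ^ i * z j))"
      by (simp only: sum.cartesian_product)
    also have "\<dots> = (\<Sum>j\<in>J. (\<Sum>i\<le>M. emb C (c (i, j)) * x ^ i) * z j)"
      by (subst sum.swap) (simp only: sum_distrib_right mult.assoc)
    finally have "(\<Sum>j\<in>J. (\<Sum>i\<le>M. emb C (c (i, j)) * x ^ i) * z j) = 0" by simp
    moreover have "\<exists>i\<le>M. \<exists>j\<in>J. c (i, j) \<noteq> 0" using c(1) by fastforce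
    ultimately show "\<exists>M c. (\<exists>i\<le>M. \<exists>j\<in>J. c i j \<noteq> 0) \<and>
        (\<Sum>j\<in>J. (\<Sum>i\<le>M. emb C (c i j) * x ^ i) * z j) = 0"
      by - (rule exI[of _ M], rule exI[of _ "\<lambda>i j. c (i, j)"], rule conjI)
  qed
qed

text \<open>Cancel the largest power of \<open>x\<close> that divides all coefficients.\<close>

lemma bounded_polynomial_relations:
  fixes x :: 'f
  assumes "x \<noteq> 0"
  shows "\<exists>m. \<forall>(J :: 'j set) z. finite J \<and> m < card J \<longrightarrow> (\<exists>M c. (\<exists>j\<in>J. c 0 j \<noteq> 0) \<and>
    (\<Sum>j\<in>J. (\<Sum>i\<le>M. emb C (c i j) * x ^ i) * z j) = 0)"
proof -
  obtain m where m: "\<forall>(J :: 'j set) z. finite J \<and> m < card J \<longrightarrow> (\<exists>M c. (\<exists>i\<le>M. \<exists>j\<in>J. c i j \<noteq> 0) \<and>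
    (\<Sum>j\<in>J. (\<Sum>i\<le>M. emb C (c i j) * x ^ i) * z j) = 0)"
    using bounded_polynomial_relations_aux[of x] ..
  show ?thesis
  proof (rule exI[of _ m], intro allI impI)
    fix J :: "'j set" and z assume J: "finite J \<and> m < card J"
    from m[rule_format, OF J] obtain M c where c: "\<exists>i\<le>M. \<exists>j\<in>J. c i j \<noteq> 0"
      "(\<Sum>j\<in>J. (\<Sum>i\<le>M. emb C (c i j) * x ^ i) * z j) = 0"
      by blast
    define k where "k = (LEAST i. \<exists>j\<in>J. c i j \<noteq> 0)"
    have k: "\<exists>j\<in>J. c k j \<noteq> 0" "k \<le> M"
      using c(1) LeastI[of "\<lambda>i. \<exists>j\<in>J. c i j \<noteq> 0"] Least_le[of "\<lambda>i. \<exists>j\<in>J. c i j \<noteq> 0"]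
      unfolding k_def by (blast, meson order_trans)
    have low: "c i j = 0" if "i < k" "j \<in> J" for i j
      using not_less_Least[of i "\<lambda>i. \<exists>j\<in>J. c i j \<noteq> 0"] that unfolding k_def by blast
    have "(\<Sum>i\<le>M. emb C (c i j) * x ^ i) = x ^ k * (\<Sum>i\<le>M - k. emb C (c (i + k) j) * x ^ i)"
      if "j \<in> J" for j
    proof -
      have "(\<Sum>i\<le>M. emb C (c i j) * x ^ i) = (\<Sum>i\<in>{k..M}. emb C (c i j) * x ^ i)"
        using low that by (intro sum.mono_neutral_right) (auto simp: not_le)
      also have "\<dots> = (\<Sum>i\<le>M - k. emb C (c (i + k) j) * x ^ (i + k))"
        by (rule sum.reindex_bij_witness[of _ "\<lambda>i. i + k" "\<lambda>i. i - k"]) (use k(2) in auto)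
      finally show ?thesis by (simp add: sum_distrib_left power_add algebra_simps)
    qed
    then have "(\<Sum>j\<in>J. (\<Sum>i\<le>M. emb C (c i j) * x ^ i) * z j) =
        x ^ k * (\<Sum>j\<in>J. (\<Sum>i\<le>M - k. emb C (c (i + k) j) * x ^ i) * z j)"
      by (subst sum_distrib_left) (rule sum.cong, simp_all add: mult.assoc)
    then have "x ^ k * (\<Sum>j\<in>J. (\<Sum>i\<le>M - k. emb C (c (i + k) j) * x ^ i) * z j) = 0"
      using c(2) by simp
    then have "(\<Sum>j\<in>J. (\<Sum>i\<le>M - k. emb C (c (i + k) j) * x ^ i) * z j) = 0" using assms by simp
    then show "\<exists>M c. (\<exists>j\<in>J. c 0 j \<noteq> 0) \<and> (\<Sum>j\<in>J. (\<Sum>i\<le>M. emb C (c i j) * x ^ i) * z j) = 0"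
      using k(1) by (intro exI[of _ "M - k"] exI[of _ "\<lambda>i j. c (i + k) j"]) simp
  qed
qed


subsection \<open>Valuations\<close>

lemma v_0: "is_place C v \<Longrightarrow> v 0 = 0"
  and v_mult: "is_place C v \<Longrightarrow> x \<noteq> 0 \<Longrightarrow> y \<noteq> 0 \<Longrightarrow> v (x * y) = v x + v y"
  and v_add: "is_place C v \<Longrightarrow> x \<noteq> 0 \<Longrightarrow> y \<noteq> 0 \<Longrightarrow> x + y \<noteq> 0 \<Longrightarrow> min (v x) (v y) \<le> v (x + y)"
  and v_emb: "is_place C v \<Longrightarrow> c \<noteq> 0 \<Longrightarrow> v (emb C c) = 0"
  unfolding is_place_def by blast+

lemma v_uniformizer: "is_place C v \<Longrightarrow> \<exists>x. x \<noteq> 0 \<and> v x = 1"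
  unfolding is_place_def by blast

lemma v_1: "is_place C v \<Longrightarrow> v 1 = 0"
  using v_emb[of v 1] by simp

lemma v_scl: "is_place C v \<Longrightarrow> c \<noteq> 0 \<Longrightarrow> x \<noteq> 0 \<Longrightarrow> v (scl C c x) = v x"
  by (simp add: scl_def v_mult v_emb)

lemma v_minus: "is_place C v \<Longrightarrow> v (- x) = v x"
  using v_mult[of v "emb C (- 1)" x] v_emb[of v "- 1"]
  by (cases "x = 0") (auto simp: emb_minus)

lemma v_inverse: "is_place C v \<Longrightarrow> x \<noteq> 0 \<Longrightarrow> v (inverse x) = - v x"
  using v_mult[of v x "inverse x"] v_1[of v] by simp

lemma v_divide: "is_place C v \<Longrightarrow> x \<noteq> 0 \<Longrightarrow> y \<noteq> 0 \<Longrightarrow> v (x / y) = v x - v y"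
  by (simp add: divide_inverse v_mult v_inverse)

lemma v_power: "is_place C v \<Longrightarrow> x \<noteq> 0 \<Longrightarrow> v (x ^ n) = int n * v x"
  by (induct n) (auto simp: v_1 v_mult algebra_simps)

lemma v_power_int: "is_place C v \<Longrightarrow> x \<noteq> 0 \<Longrightarrow> v (x powi n) = n * v x"
  by (cases "0 \<le> n") (auto simp: power_int_def v_power v_inverse)

lemma v_add_less:
  assumes "is_place C v" "x \<noteq> 0" "y = 0 \<or> v x < v y"
  shows "x + y \<noteq> 0" "v (x + y) = v x"
proof -
  have "x + y \<noteq> 0 \<and> v (x + y) = v x"
  proof (cases "y = 0")
    case False
    then have lt: "v x < v y" using assms(3) by simp
    have nz: "x + y \<noteq> 0"
    proof
      assume "x + y = 0"
      then have "y = - x" by (simp add: eq_neg_iff_add_eq_0 add.commute)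
      then show False using lt v_minus[OF assms(1)] by simp
    qed
    have "min (v (x + y)) (v (- y)) \<le> v ((x + y) + - y)"
      using nz False assms(2) by (intro v_add[OF assms(1)]) auto
    then have "v (x + y) \<le> v x" using lt v_minus[OF assms(1), of y] by simp
    moreover have "v x \<le> v (x + y)" using v_add[OF assms(1,2) False nz] lt by simp
    ultimately show ?thesis using nz by simp
  qed (use assms(2) in simp)
  then show "x + y \<noteq> 0" "v (x + y) = v x" by auto
qed

lemma subspace_valuation_ge:
  assumes "is_place C v"
  shows "K.subspace {x. x = 0 \<or> n \<le> v x}"
proof (rule K.subspaceI)
  fix x y assume xy: "x \<in> {x. x = 0 \<or> n \<le> v x}" "y \<in> {x. x = 0 \<or> n \<le> v x}"
  show "x + y \<in> {x. x = 0 \<or> n \<le> v x}"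
    using xy v_add[OF assms, of x y] by (cases "x = 0"; cases "y = 0"; cases "x + y = 0") auto
next
  fix c x assume "x \<in> {x. x = 0 \<or> n \<le> v x}"
  then show "scl C c x \<in> {x. x = 0 \<or> n \<le> v x}"
    using v_scl[OF assms, of c x] by (cases "c = 0"; cases "x = 0") auto
qed simp

lemma max_ideal_eq: "max_ideal v = {x. x = 0 \<or> 1 \<le> v x}"
  unfolding max_ideal_def by auto

lemma subspace_local_ring: "is_place C v \<Longrightarrow> K.subspace (local_ring v)"
  unfolding local_ring_def by (rule subspace_valuation_ge)

lemma subspace_max_ideal: "is_place C v \<Longrightarrow> K.subspace (max_ideal v)"
  unfolding max_ideal_eq by (rule subspace_valuation_ge)

lemma local_ring_mult: "is_place C v \<Longrightarrow> x \<in> local_ring v \<Longrightarrow> y \<in> local_ring v \<Longrightarrow> x * y \<in> local_ring v"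
  unfolding local_ring_def using v_mult[of v x y] by (cases "x = 0 \<or> y = 0") auto

lemma max_ideal_mult: "is_place C v \<Longrightarrow> x \<in> local_ring v \<Longrightarrow> y \<in> max_ideal v \<Longrightarrow> x * y \<in> max_ideal v"
  unfolding local_ring_def max_ideal_def using v_mult[of v x y] by (cases "x = 0 \<or> y = 0") auto

lemma emb_local_ring: "is_place C v \<Longrightarrow> emb C c \<in> local_ring v"
  unfolding local_ring_def using v_emb[of v c] by (cases "c = 0") auto

text \<open>All terms but the constant one are divisible by \<open>x\<close>.\<close>

lemma polynomial_value:
  assumes v: "is_place C v" and x: "x \<in> max_ideal v"
  shows "(\<Sum>i\<le>M. emb C (c i) * x ^ i) - emb C (c 0) \<in> max_ideal v"
proof -
  have "(\<Sum>i\<le>M. emb C (c i) * x ^ i) - emb C (c 0) = (\<Sum>i<M. emb C (c (Suc i)) * x ^ Suc i)"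
    by (simp add: sum.atMost_shift)
  also have "\<dots> = (\<Sum>i<M. (emb C (c (Suc i)) * x ^ i) * x)" by (simp add: algebra_simps)
  also have "\<dots> \<in> max_ideal v"
  proof (intro K.subspace_sum[OF subspace_max_ideal[OF v]] max_ideal_mult[OF v _ x] local_ring_mult[OF v]
      emb_local_ring[OF v])
    fix i
    have "x \<in> local_ring v" using x unfolding max_ideal_def local_ring_def by auto
    then have "x ^ Suc i \<in> local_ring v" if "x ^ i \<in> local_ring v" for i
      unfolding power_Suc using that by (rule local_ring_mult[OF v])
    moreover have "x ^ 0 \<in> local_ring v" using v_1[OF v] by (simp add: local_ring_def)
    ultimately show "x ^ i \<in> local_ring v" by (induct i) blast+
  qed
  finally show ?thesis .
qed


text \<open>The reductions of the relations found above, at all zeros of \<open>x\<close> simultaneously.\<close>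

lemma relations_at_zeros:
  fixes x :: 'f
  assumes "x \<noteq> 0"
  shows "\<exists>m. \<forall>(J :: 'j set) z. finite J \<and> m < card J \<longrightarrow> (\<exists>y c. (\<exists>j\<in>J. c j \<noteq> 0) \<and> (\<Sum>j\<in>J. y j * z j) = 0 \<and>
    (\<forall>v j. is_place C v \<and> 0 < v x \<longrightarrow> y j - emb C (c j) \<in> max_ideal v))"
proof -
  obtain m where m: "\<forall>(J :: 'j set) z. finite J \<and> m < card J \<longrightarrow> (\<exists>M c. (\<exists>j\<in>J. c 0 j \<noteq> 0) \<and>
    (\<Sum>j\<in>J. (\<Sum>i\<le>M. emb C (c i j) * x ^ i) * z j) = 0)"
    using bounded_polynomial_relations[OF assms] ..
  show ?thesis
  proof (rule exI[of _ m], intro allI impI)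
    fix J :: "'j set" and z assume J: "finite J \<and> m < card J"
    from m[rule_format, OF J] obtain M c where c: "\<exists>j\<in>J. c 0 j \<noteq> 0"
      "(\<Sum>j\<in>J. (\<Sum>i\<le>M. emb C (c i j) * x ^ i) * z j) = 0"
      by blast
    have "(\<Sum>i\<le>M. emb C (c i j) * x ^ i) - emb C (c 0 j) \<in> max_ideal v" if "is_place C v" "0 < v x" for v j
      using polynomial_value[OF that(1), of x "\<lambda>i. c i j" M] that(2) by (simp add: max_ideal_def)
    then show "\<exists>y c. (\<exists>j\<in>J. c j \<noteq> 0) \<and> (\<Sum>j\<in>J. y j * z j) = 0 \<and>
        (\<forall>v j. is_place C v \<and> 0 < v x \<longrightarrow> y j - emb C (c j) \<in> max_ideal v)"
      using c by (intro exI[of _ "\<lambda>j. \<Sum>i\<le>M. emb C (c i j) * x ^ i"] exI[of _ "c 0"]) blast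
  qed
qed


subsection \<open>Approximation, and finiteness of the set of zeros\<close>

text \<open>
  Units at \<open>v\<close> are units at \<open>w\<close>, which makes \<open>w\<close> a nonnegative multiple of \<open>v\<close>; the factor is \<open>1\<close> because both
  valuations take the value \<open>1\<close>.
\<close>

lemma place_eqI:
  assumes v: "is_place C v" and w: "is_place C w" and sub: "local_ring v \<subseteq> local_ring w"
  shows "v = w"
proof -
  have unit: "w a = 0" if "a \<noteq> 0" "v a = 0" for a
  proof -
    have "a \<in> local_ring v" "inverse a \<in> local_ring v"
      using that v_inverse[OF v] by (auto simp: local_ring_def)
    then have "a \<in> local_ring w" "inverse a \<in> local_ring w" using sub by auto
    then show ?thesis using that v_inverse[OF w that(1)] by (auto simp: local_ring_def)
  qed
  obtain p where p: "p \<noteq> 0" "v p = 1" using v_uniformizer[OF v] by blast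
  have eq: "w a = v a * w p" if "a \<noteq> 0" for a
  proof -
    have nz: "p powi (v a) \<noteq> 0" using p(1) by simp
    have "v (a / p powi (v a)) = 0" using p that nz by (simp add: v_divide[OF v] v_power_int[OF v])
    then have "w (a / p powi (v a)) = 0" using that nz by (intro unit) auto
    then show ?thesis using p that nz by (simp add: v_divide[OF w] v_power_int[OF w])
  qed
  have "p \<in> local_ring v" using p by (simp add: local_ring_def)
  then have "0 \<le> w p" using sub p(1) by (auto simp: local_ring_def)
  moreover obtain q where "q \<noteq> 0" "w q = 1" using v_uniformizer[OF w] by blast
  then have "v q * w p = 1" using eq by metis
  ultimately have "w p = 1" using zmult_eq_1_iff[of "v q" "w p"] by auto
  then have "w a = v a" for a using eq[of a] v_0[OF v] v_0[OF w] by (cases "a = 0") auto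
  then show ?thesis by auto
qed

lemma separate_two_places:
  assumes v: "is_place C v" and w: "is_place C w" and "v \<noteq> w"
  shows "\<exists>u. u \<noteq> 0 \<and> v u < 0 \<and> 0 < w u"
proof -
  obtain a where a: "a \<in> local_ring v" "a \<notin> local_ring w" using place_eqI[OF v w] assms(3) by blast
  obtain b where b: "b \<in> local_ring w" "b \<notin> local_ring v" using place_eqI[OF w v] assms(3) by blast
  have "a \<noteq> 0" "b \<noteq> 0" "0 \<le> v a" "w a < 0" "0 \<le> w b" "v b < 0"
    using a b by (auto simp: local_ring_def)
  then show ?thesis
    by (intro exI[of _ "b / a"]) (simp add: v_divide[OF v] v_divide[OF w])
qed

text \<open>
  The induction step of the approximation theorem: if \<open>u\<close> has a pole at the new place \<open>w\<close>, then
  \<open>u ^ k / (1 + u ^ k)\<close> is a unit at \<open>v\<close> and \<open>w\<close> and still vanishes at the old places.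
\<close>

lemma separate_places:
  assumes "finite S" "\<And>w. w \<in> S \<Longrightarrow> is_place C w" and v: "is_place C v" "v \<notin> S"
  shows "\<exists>u. u \<noteq> 0 \<and> v u < 0 \<and> (\<forall>w\<in>S. 0 < w u)"
  using assms(1,2,4)
proof induct
  case empty
  obtain p where "p \<noteq> 0" "v p = 1" using v_uniformizer[OF v(1)] by blast
  then show ?case by (intro exI[of _ "inverse p"]) (simp add: v_inverse[OF v(1)])
next
  case (insert w S)
  have w: "is_place C w" and S: "\<And>w'. w' \<in> S \<Longrightarrow> is_place C w'" using insert(4) by auto
  obtain u where u: "u \<noteq> 0" "v u < 0" "\<And>w'. w' \<in> S \<Longrightarrow> 0 < w' u"
    using insert(3)[OF S] insert(5) by auto
  obtain y where y: "y \<noteq> 0" "v y < 0" "0 < w y"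
    using separate_two_places[OF v(1) w] insert(5) by auto
  define k where "k = Suc (nat (\<Sum>w'\<in>S. \<bar>w' y\<bar>))"
  have k: "0 < w' y + int k * w' u" if "w' \<in> S" for w'
  proof -
    have "\<bar>w' y\<bar> \<le> (\<Sum>w'\<in>S. \<bar>w' y\<bar>)" using insert(1) that by (intro member_le_sum) auto
    then have "\<bar>w' y\<bar> < int k" by (simp add: k_def)
    moreover have "int k * 1 \<le> int k * w' u" using u(3)[OF that] by (intro mult_left_mono) auto
    ultimately show ?thesis by linarith
  qed
  have "0 < k" by (simp add: k_def)
  have uk: "u ^ k \<noteq> 0" "v (u ^ k) < 0" "\<And>w'. w' \<in> S \<Longrightarrow> w' (u ^ k) = int k * w' u" "w (u ^ k) = int k * w u"
    using u \<open>0 < k\<close> S by (auto simp: v_power v(1) w mult_less_0_iff)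
  consider "0 < w u" | "w u = 0" | "w u < 0" by linarith
  then show ?case
  proof cases
    case 1
    then show ?thesis using u by (intro exI[of _ u]) auto
  next
    case 2
    have "v (y * u ^ k) < 0" using y uk by (simp add: v_mult[OF v(1)])
    moreover have "0 < w (y * u ^ k)" using y uk 2 by (simp add: v_mult[OF w])
    moreover have "0 < w' (y * u ^ k)" if "w' \<in> S" for w'
      using k[OF that] y uk(1) uk(3)[OF that] by (simp add: v_mult[OF S[OF that]])
    ultimately show ?thesis using y uk(1) by (intro exI[of _ "y * u ^ k"]) auto
  next
    case 3
    let ?z = "u ^ k / (1 + u ^ k)"
    have "int k * w u < 0" using 3 \<open>0 < k\<close> by (simp add: mult_less_0_iff)
    then have wk: "w (u ^ k) < 0" by (simp add: uk(4))
    have nz: "1 + u ^ k \<noteq> 0" and vz: "v (1 + u ^ k) = v (u ^ k)" and wz: "w (1 + u ^ k) = w (u ^ k)"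
      using v_add_less[OF v(1) uk(1), of 1] v_add_less[OF w uk(1), of 1] uk(2) wk v_1[OF v(1)] v_1[OF w]
      by (simp_all add: add.commute)
    have Sz: "w' (1 + u ^ k) = 0" if "w' \<in> S" for w'
    proof -
      have "0 < w' (u ^ k)" using uk(3)[OF that] u(3)[OF that] \<open>0 < k\<close> by simp
      then show ?thesis using v_add_less[OF S[OF that], of 1 "u ^ k"] v_1[OF S[OF that]] by simp
    qed
    have "v (y * ?z) < 0" using y uk nz vz by (simp add: v_mult[OF v(1)] v_divide[OF v(1)])
    moreover have "0 < w (y * ?z)" using y uk nz wz by (simp add: v_mult[OF w] v_divide[OF w])
    moreover have "0 < w' (y * ?z)" if "w' \<in> S" for w'
    proof -
      have "w' (y * ?z) = w' y + (w' (u ^ k) - w' (1 + u ^ k))"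
        using y uk(1) nz by (simp add: v_mult[OF S[OF that]] v_divide[OF S[OF that]])
      then show ?thesis using k[OF that] uk(3)[OF that] Sz[OF that] by simp
    qed
    moreover have "y * ?z \<noteq> 0" using y uk(1) nz by simp
    ultimately show ?thesis by (intro exI[of _ "y * ?z"]) auto
  qed
qed

text \<open>
  Functions separating the zeros of \<open>x\<close> cannot satisfy a relation over \<open>K[x]\<close> whose constant terms
  do not all vanish: look at a place where the constant term is nonzero.
\<close>

lemma finite_zeros:
  assumes "x \<noteq> 0"
  shows "finite {v. is_place C v \<and> 0 < v x}"
proof (rule ccontr)
  assume inf: "infinite {v. is_place C v \<and> 0 < v x}"
  obtain m where m: "\<forall>(J :: ('f \<Rightarrow> int) set) z. finite J \<and> m < card J \<longrightarrow> (\<exists>y c. (\<exists>j\<in>J. c j \<noteq> 0) \<and>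
    (\<Sum>j\<in>J. y j * z j) = 0 \<and> (\<forall>v j. is_place C v \<and> 0 < v x \<longrightarrow> y j - emb C (c j) \<in> max_ideal v))"
    using relations_at_zeros[OF assms] ..
  obtain S where S: "finite S" "card S = Suc m" "S \<subseteq> {v. is_place C v \<and> 0 < v x}"
    using infinite_arbitrarily_large[OF inf, of "Suc m"] by auto
  have "\<forall>v\<in>S. \<exists>u. u \<noteq> 0 \<and> v u < 0 \<and> (\<forall>w\<in>S - {v}. 0 < w u)"
    using S(1,3) by (intro ballI separate_places) auto
  then obtain z where z: "\<And>v. v \<in> S \<Longrightarrow> z v \<noteq> 0" "\<And>v. v \<in> S \<Longrightarrow> v (z v) < 0"
    "\<And>v w. v \<in> S \<Longrightarrow> w \<in> S - {v} \<Longrightarrow> 0 < w (z v)"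
    by metis
  have "finite S \<and> m < card S" using S by simp
  from m[rule_format, OF this] obtain y c where c: "\<exists>v\<in>S. c v \<noteq> 0" "(\<Sum>w\<in>S. y w * z w) = 0"
    "\<forall>v w. is_place C v \<and> 0 < v x \<longrightarrow> y w - emb C (c w) \<in> max_ideal v"
    by blast
  obtain v where v0: "v \<in> S" "c v \<noteq> 0" using c(1) by blast
  have v: "is_place C v" "0 < v x" using v0(1) S(3) by auto
  have val: "y w - emb C (c w) \<in> max_ideal v" for w using c(3) v by blast
  have loc: "y w \<in> local_ring v" for w
  proof -
    have "y w - emb C (c w) \<in> local_ring v"
      using val[of w] by (auto simp: local_ring_def max_ideal_def)
    then have "(y w - emb C (c w)) + emb C (c w) \<in> local_ring v"
      using emb_local_ring[OF v(1)] K.subspace_add[OF subspace_local_ring[OF v(1)]] by blast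
    then show ?thesis by simp
  qed
  have yv: "y v \<noteq> 0" "v (y v) = 0"
    using v_add_less[OF v(1), of "emb C (c v)" "y v - emb C (c v)"] val[of v] v0(2) v_emb[OF v(1) v0(2)]
    by (auto simp: max_ideal_def)
  have "y w * z w \<in> max_ideal v" if w: "w \<in> S - {v}" for w
  proof -
    have "0 < v (z w)" using w v0(1) by (intro z(3)) auto
    then have "z w \<in> max_ideal v" by (simp add: max_ideal_def)
    then show ?thesis by (rule max_ideal_mult[OF v(1) loc])
  qed
  then have "(\<Sum>w\<in>S - {v}. y w * z w) \<in> max_ideal v"
    by (rule K.subspace_sum[OF subspace_max_ideal[OF v(1)]])
  then have "- (\<Sum>w\<in>S - {v}. y w * z w) \<in> max_ideal v"
    by (rule K.subspace_neg[OF subspace_max_ideal[OF v(1)]])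
  moreover have "y v * z v + (\<Sum>w\<in>S - {v}. y w * z w) = 0"
    using c(2) sum.remove[OF S(1) v0(1), of "\<lambda>w. y w * z w"] by simp
  ultimately have "y v * z v \<in> max_ideal v" by (simp add: eq_neg_iff_add_eq_0[symmetric])
  then show False using yv z(1,2)[OF v0(1)] v_mult[OF v(1) yv(1) z(1)[OF v0(1)]] by (simp add: max_ideal_def)
qed

lemma finite_support:
  assumes "x \<noteq> 0"
  shows "finite {v. is_place C v \<and> v x \<noteq> 0}"
proof (rule finite_subset)
  show "{v. is_place C v \<and> v x \<noteq> 0} \<subseteq> {v. is_place C v \<and> 0 < v x} \<union> {v. is_place C v \<and> 0 < v (inverse x)}"
    using assms by (auto simp: v_inverse)
  show "finite ({v. is_place C v \<and> 0 < v x} \<union> {v. is_place C v \<and> 0 < v (inverse x)})"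
    using finite_zeros assms by simp
qed


subsection \<open>The degree of a place\<close>

text \<open>
  This says that the elements of \<open>B\<close> have residue classes that are distinct and linearly independent over \<open>K\<close>.
\<close>

definition residue_indep :: "('f \<Rightarrow> int) \<Rightarrow> 'f set \<Rightarrow> bool" where
  "residue_indep v B \<longleftrightarrow> finite B \<and> B \<subseteq> local_ring v \<and> K.independent B \<and> K.span B \<inter> max_ideal v = {0}"

text \<open>
  For a uniformizer \<open>x\<close> a relation over \<open>K[x]\<close> reduces modulo the maximal ideal to the relation over \<open>K\<close>
  formed by the constant terms.
\<close>

lemma residue_indep_bounded:
  assumes v: "is_place C v"
  shows "\<exists>m. \<forall>B. residue_indep v B \<longrightarrow> card B \<le> m"
proof -
  obtain x where x: "x \<noteq> 0" "v x = 1" using v_uniformizer[OF v] by blast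
  obtain m where m: "\<forall>(J :: 'f set) z. finite J \<and> m < card J \<longrightarrow> (\<exists>y c. (\<exists>j\<in>J. c j \<noteq> 0) \<and>
    (\<Sum>j\<in>J. y j * z j) = 0 \<and> (\<forall>v j. is_place C v \<and> 0 < v x \<longrightarrow> y j - emb C (c j) \<in> max_ideal v))"
    using relations_at_zeros[OF x(1)] ..
  have "card B \<le> m" if B: "residue_indep v B" for B
  proof (rule ccontr)
    have fB: "finite B" and iB: "K.independent B" using B by (simp_all add: residue_indep_def)
    assume "\<not> card B \<le> m"
    then have "finite B \<and> m < card B" using fB by simp
    from m[rule_format, OF this, of "\<lambda>b. b"] obtain y c where c: "\<exists>b\<in>B. c b \<noteq> 0" "(\<Sum>b\<in>B. y b * b) = 0"
      "\<forall>v b. is_place C v \<and> 0 < v x \<longrightarrow> y b - emb C (c b) \<in> max_ideal v"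
      by blast
    have red: "y b - emb C (c b) \<in> max_ideal v" for b using c(3) v x(2) by simp
    have "(\<Sum>b\<in>B. b * (y b - emb C (c b))) \<in> max_ideal v"
      using B red by (intro K.subspace_sum[OF subspace_max_ideal[OF v]] max_ideal_mult[OF v])
        (auto simp: residue_indep_def)
    also have "(\<Sum>b\<in>B. b * (y b - emb C (c b))) = (\<Sum>b\<in>B. y b * b) - (\<Sum>b\<in>B. scl C (c b) b)"
      unfolding sum_subtractf[symmetric] scl_def by (rule sum.cong) (simp_all add: algebra_simps)
    finally have "- (\<Sum>b\<in>B. scl C (c b) b) \<in> max_ideal v" using c(2) by simp
    from K.subspace_neg[OF subspace_max_ideal[OF v] this] have "(\<Sum>b\<in>B. scl C (c b) b) \<in> max_ideal v" by simp
    moreover have "(\<Sum>b\<in>B. scl C (c b) b) \<in> K.span B" by (intro K.span_sum K.span_scale K.span_base)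
    ultimately have "(\<Sum>b\<in>B. scl C (c b) b) = 0" using B unfolding residue_indep_def by blast
    then show False using c(1) K.independentD[OF iB fB order_refl] by blast
  qed
  then show ?thesis by blast
qed

definition residue_basis :: "('f \<Rightarrow> int) \<Rightarrow> 'f set \<Rightarrow> bool" where
  "residue_basis v B \<longleftrightarrow> residue_indep v B \<and> (\<forall>x\<in>local_ring v. \<exists>u\<in>max_ideal v. x - u \<in> K.span B)"

lemma residue_basis_exists:
  assumes v: "is_place C v"
  shows "\<exists>B. residue_basis v B"
proof -
  obtain m where m: "\<And>B. residue_indep v B \<Longrightarrow> card B \<le> m" using residue_indep_bounded[OF v] by blast
  have "residue_indep v {}"
    by (simp add: residue_indep_def K.independent_empty max_ideal_def)
  then obtain B where B: "residue_indep v B" "\<And>A. residue_indep v A \<Longrightarrow> card A \<le> card B"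
    using ex_has_greatest_nat[of "residue_indep v" "{}" card "Suc m"] m by (auto simp: less_Suc_eq_le)
  have "\<exists>u\<in>max_ideal v. x - u \<in> K.span B" if x: "x \<in> local_ring v" for x
  proof (rule ccontr)
    assume no: "\<not> ?thesis"
    then have xB: "x \<notin> K.span B" using K.subspace_0[OF subspace_max_ideal[OF v]] by force
    have "K.span (insert x B) \<inter> max_ideal v \<subseteq> {0}"
    proof
      fix y assume y: "y \<in> K.span (insert x B) \<inter> max_ideal v"
      then obtain k where k: "y - scl C k x \<in> K.span B" using K.span_breakdown_eq by blast
      show "y \<in> {0}"
      proof (cases "k = 0")
        case True
        then show ?thesis using k y B(1) unfolding residue_indep_def by auto
      next
        case False
        have "scl C (inverse k) y \<in> max_ideal v"
          using y K.subspace_scale[OF subspace_max_ideal[OF v]] by blast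
        moreover have "x - scl C (inverse k) y = scl C (- inverse k) (y - scl C k x)"
          using False by (simp add: K.scale_right_diff_distrib)
        then have "x - scl C (inverse k) y \<in> K.span B" using k K.span_scale by metis
        ultimately show ?thesis using no by blast
      qed
    qed
    then have "K.span (insert x B) \<inter> max_ideal v = {0}"
      using K.span_zero K.subspace_0[OF subspace_max_ideal[OF v]] by blast
    then have "residue_indep v (insert x B)"
      using B(1) x xB K.independent_insertI unfolding residue_indep_def by auto
    moreover have "x \<notin> B" using xB K.span_base by blast
    ultimately show False using B(2)[of "insert x B"] B(1) unfolding residue_indep_def by simp
  qed
  then show ?thesis using B(1) unfolding residue_basis_def by blast
qed

lemma residue_basis_card_le:
  assumes v: "is_place C v" and A: "residue_indep v A" and B: "residue_basis v B"
  shows "card A \<le> card B"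
proof (rule ccontr)
  assume lt: "\<not> card A \<le> card B"
  have fA: "finite A" and fB: "finite B" and iA: "K.independent A"
    using A B unfolding residue_basis_def residue_indep_def by auto
  have "\<forall>a\<in>A. \<exists>u\<in>max_ideal v. a - u \<in> K.span B"
    using A B unfolding residue_basis_def residue_indep_def by blast
  then obtain u where u: "\<And>a. a \<in> A \<Longrightarrow> u a \<in> max_ideal v" "\<And>a. a \<in> A \<Longrightarrow> a - u a \<in> K.span B" by metis
  obtain c where c: "\<exists>a\<in>A. c a \<noteq> 0" "(\<Sum>a\<in>A. scl C (c a) (a - u a)) = 0"
    by (rule K.finite_family_dependent[OF fB fA _ u(2)]) (use lt in auto)
  have "(\<Sum>a\<in>A. scl C (c a) a) = (\<Sum>a\<in>A. scl C (c a) (u a))"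
    using c(2) by (simp add: K.scale_right_diff_distrib sum_subtractf)
  also have "\<dots> \<in> max_ideal v"
    using u(1) by (intro K.subspace_sum[OF subspace_max_ideal[OF v]] K.subspace_scale[OF subspace_max_ideal[OF v]])
  finally have "(\<Sum>a\<in>A. scl C (c a) a) \<in> max_ideal v" .
  moreover have "(\<Sum>a\<in>A. scl C (c a) a) \<in> K.span A" by (intro K.span_sum K.span_scale K.span_base)
  ultimately have "(\<Sum>a\<in>A. scl C (c a) a) = 0" using A unfolding residue_indep_def by blast
  then show False using c(1) K.independentD[OF iA fA order_refl] by blast
qed

text \<open>
  The cardinality of a residue basis is unique, so the definite description in \<open>quot_dim\<close> denotes it.
\<close>

lemma place_deg_card:
  assumes v: "is_place C v" and B: "residue_basis v B"
  shows "place_deg C v = int (card B)"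
proof -
  have "quot_dim C (local_ring v) (max_ideal v) = (THE n. \<exists>B. card B = n \<and> residue_basis v B)"
    unfolding quot_dim_def residue_basis_def residue_indep_def kindep_def kspan_def
    by (rule arg_cong[of _ _ The]) blast
  also have "\<dots> = card B"
  proof (rule the_equality)
    fix n assume "\<exists>B. card B = n \<and> residue_basis v B"
    then show "n = card B"
      using residue_basis_card_le[OF v] B unfolding residue_basis_def by (meson order_antisym)
  qed (use B in blast)
  finally show ?thesis by (simp add: place_deg_def)
qed

lemma place_deg_pos: "is_place C v \<Longrightarrow> 1 \<le> place_deg C v"
proof -
  assume v: "is_place C v"
  obtain B where B: "residue_basis v B" using residue_basis_exists[OF v] by blast
  have "B \<noteq> {}"
  proof
    assume "B = {}"
    moreover have "1 \<in> local_ring v" using v_1[OF v] by (simp add: local_ring_def)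
    ultimately obtain u where "u \<in> max_ideal v" "1 - u \<in> {0}"
      using B unfolding residue_basis_def by auto
    then show False using v_1[OF v] by (simp add: max_ideal_def)
  qed
  moreover have "finite B" using B unfolding residue_basis_def residue_indep_def by blast
  ultimately show ?thesis using place_deg_card[OF v B] by (simp add: card_gt_0_iff Suc_le_eq)
qed

lemma place_deg_rational:
  assumes "rational_place C v"
  shows "place_deg C v = 1"
proof -
  have v: "is_place C v" using assms by (simp add: rational_place_def)
  have span1: "K.span {1} = range (emb C)" by (simp add: K.span_singleton scl_def)
  have "residue_basis v {1}"
    unfolding residue_basis_def residue_indep_def span1
  proof (intro conjI ballI)
    show "range (emb C) \<inter> max_ideal v = {0}"
    proof (intro equalityI subsetI)
      fix x assume "x \<in> range (emb C) \<inter> max_ideal v"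
      then obtain c where "x = emb C c" "emb C c \<in> max_ideal v" by blast
      then show "x \<in> {0}" using v_emb[OF v, of c] by (cases "c = 0") (auto simp: max_ideal_def)
    next
      fix x :: 'f assume "x \<in> {0}"
      then show "x \<in> range (emb C) \<inter> max_ideal v" by (auto simp: max_ideal_def intro!: image_eqI[of _ _ 0])
    qed
  next
    fix x assume "x \<in> local_ring v"
    then obtain c where "x - emb C c \<in> max_ideal v" using assms unfolding rational_place_def by blast
    then show "\<exists>u\<in>max_ideal v. x - u \<in> range (emb C)" by (intro bexI[of _ "x - emb C c"]) auto
  qed (use v_1[OF v] in \<open>auto simp: local_ring_def\<close>)
  then show ?thesis using place_deg_card[OF v] by simp
qed

end

section \<open>Divisors and the Riemann-Roch formula for large degrees\<close>

locale pointed_curve = fn_field C for C :: "('k::field, 'f::field) pcurve" +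
  fixes g :: int
  assumes rational: "rational_place C (pinf C)"
    and genus: "has_genus C g"
    and g_pos: "1 \<le> g"
begin

abbreviation P where "P \<equiv> pinf C"

lemma place_P: "is_place C P"
  using rational by (simp add: rational_place_def)

definition infty_div :: "int \<Rightarrow> 'f divisor" where
  "infty_div n = (\<lambda>v. if v = P then n else 0)"

definition point_div :: "('f \<Rightarrow> int) \<Rightarrow> 'f divisor" where
  "point_div v = (\<lambda>w. if w = v then 1 else 0)"

abbreviation rr :: "'f divisor \<Rightarrow> nat" where "rr A \<equiv> K.dim (RR_space C A)"


subsection \<open>Divisors and degrees\<close>

lemma divisor_0: "divisor C 0"
  by (simp add: divisor_def)

lemma divisor_add: "divisor C A \<Longrightarrow> divisor C B \<Longrightarrow> divisor C (A + B)"
  unfolding divisor_def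
proof (elim conjE, intro conjI allI impI)
  assume "finite {v. A v \<noteq> 0}" "finite {v. B v \<noteq> 0}"
  then show "finite {v. (A + B) v \<noteq> 0}"
    by (intro finite_subset[of "{v. (A + B) v \<noteq> 0}" "{v. A v \<noteq> 0} \<union> {v. B v \<noteq> 0}"]) auto
next
  fix v assume "\<forall>v. A v \<noteq> 0 \<longrightarrow> is_place C v" "\<forall>v. B v \<noteq> 0 \<longrightarrow> is_place C v" "(A + B) v \<noteq> 0"
  then show "is_place C v" by (cases "A v = 0") auto
qed

lemma divisor_uminus: "divisor C A \<Longrightarrow> divisor C (- A)"
  unfolding divisor_def by simp

lemma divisor_diff: "divisor C A \<Longrightarrow> divisor C B \<Longrightarrow> divisor C (A - B)"
  using divisor_add[of A "- B"] divisor_uminus[of B] by simp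

lemma divisor_infty: "divisor C (infty_div n)"
  unfolding divisor_def infty_div_def using place_P by auto

lemma divisor_point: "is_place C v \<Longrightarrow> divisor C (point_div v)"
  unfolding divisor_def point_div_def by auto

lemma divisor_principal: "f \<noteq> 0 \<Longrightarrow> divisor C (principal_div C f)"
  unfolding divisor_def principal_div_def
  using finite_support[of f] by (auto elim: finite_subset[rotated])

lemma ddeg_superset:
  assumes "finite S" "{v. A v \<noteq> 0} \<subseteq> S"
  shows "ddeg C A = (\<Sum>v\<in>S. A v * place_deg C v)"
  unfolding ddeg_def using assms by (intro sum.mono_neutral_left) auto

lemma ddeg_add:
  assumes "divisor C A" "divisor C B"
  shows "ddeg C (A + B) = ddeg C A + ddeg C B"
proof -
  let ?S = "{v. A v \<noteq> 0} \<union> {v. B v \<noteq> 0}"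
  have "finite ?S" using assms by (simp add: divisor_def)
  then have "ddeg C (A + B) = (\<Sum>v\<in>?S. (A + B) v * place_deg C v)"
    "ddeg C A = (\<Sum>v\<in>?S. A v * place_deg C v)" "ddeg C B = (\<Sum>v\<in>?S. B v * place_deg C v)"
    by (intro ddeg_superset; auto)+
  then show ?thesis by (simp add: sum.distrib distrib_right)
qed

lemma ddeg_uminus: "ddeg C (- A) = - ddeg C A"
  unfolding ddeg_def by (simp add: sum_negf)

lemma ddeg_diff: "divisor C A \<Longrightarrow> divisor C B \<Longrightarrow> ddeg C (A - B) = ddeg C A - ddeg C B"
  using ddeg_add[of A "- B"] divisor_uminus[of B] by (simp add: ddeg_uminus)

lemma ddeg_point: "ddeg C (point_div v) = place_deg C v"
  by (subst ddeg_superset[of "{v}"]) (auto simp: point_div_def)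

lemma ddeg_infty: "ddeg C (infty_div n) = n"
  by (subst ddeg_superset[of "{P}"]) (auto simp: infty_div_def place_deg_rational[OF rational])

lemma ddeg_nonneg:
  assumes "divisor C A" "0 \<le> A"
  shows "0 \<le> ddeg C A"
  unfolding ddeg_def
proof (rule sum_nonneg)
  fix v assume "v \<in> {v. A v \<noteq> 0}"
  then have "is_place C v" using assms(1) by (auto simp: divisor_def)
  then show "0 \<le> A v * place_deg C v"
    using place_deg_pos[of v] assms(2) by (auto simp: le_fun_def)
qed

lemma ddeg_ge_point:
  assumes "divisor C A" "0 \<le> A" "1 \<le> A v" "is_place C v"
  shows "place_deg C v \<le> ddeg C A"
proof -
  have "0 \<le> ddeg C (A - point_div v)"
    using assms by (intro ddeg_nonneg divisor_diff divisor_point) (auto simp: le_fun_def point_div_def)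
  then show ?thesis using assms by (simp add: ddeg_diff divisor_point ddeg_point)
qed

lemma effective_ddeg_0:
  assumes "divisor C A" "0 \<le> A" "ddeg C A = 0"
  shows "A = 0"
proof
  fix v show "A v = 0 v"
  proof (rule ccontr)
    assume "A v \<noteq> 0 v"
    then have "1 \<le> A v" "is_place C v" using assms by (auto simp: le_fun_def divisor_def int_one_le_iff_zero_less order_less_le)
    then show False using ddeg_ge_point[OF assms(1,2)] place_deg_pos assms(3) by fastforce
  qed
qed


subsection \<open>Principal divisors have degree zero\<close>

lemma subspace_RR: "K.subspace (RR_space C A)"
proof -
  have "RR_space C A = (\<Inter>v\<in>{v. is_place C v}. {x. x = 0 \<or> - A v \<le> v x})"
    unfolding RR_space_def by auto
  also have "K.subspace \<dots>" by (intro K.subspace_Int subspace_valuation_ge) simp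
  finally show ?thesis .
qed

lemma RR_mono: "A \<le> B \<Longrightarrow> RR_space C A \<subseteq> RR_space C B"
proof
  fix f assume le: "A \<le> B" and f: "f \<in> RR_space C A"
  have "- B v \<le> v f" if "- A v \<le> v f" for v using that le_funD[OF le, of v] by linarith
  then show "f \<in> RR_space C B" using f unfolding RR_space_def by blast
qed

lemma RR_shift_iff:
  assumes "f \<noteq> 0"
  shows "f * x \<in> RR_space C (A - principal_div C f) \<longleftrightarrow> x \<in> RR_space C A"
  using assms by (cases "x = 0") (auto simp: RR_space_def principal_div_def v_mult)

lemma RR_shift:
  assumes "f \<noteq> 0"
  shows "RR_space C (A - principal_div C f) = (*) f ` RR_space C A"
proof (intro equalityI subsetI)
  fix y assume "y \<in> RR_space C (A - principal_div C f)"
  then show "y \<in> (*) f ` RR_space C A"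
    using RR_shift_iff[OF assms, of "y / f"] assms by (intro image_eqI[of _ _ "y / f"]) auto
qed (auto simp: RR_shift_iff[OF assms])

lemma rr_shift: "f \<noteq> 0 \<Longrightarrow> rr (A - principal_div C f) = rr A"
  by (simp add: RR_shift dim_mult_image)

lemma riemann: "divisor C A \<Longrightarrow> ddeg C A - int (rr A) + 1 \<le> g"
  using genus unfolding has_genus_def kdim_def by blast

lemma principal_mult:
  "f \<noteq> 0 \<Longrightarrow> h \<noteq> 0 \<Longrightarrow> principal_div C (f * h) = principal_div C f + principal_div C h"
  by (auto simp: principal_div_def v_mult)

lemma principal_inverse: "f \<noteq> 0 \<Longrightarrow> principal_div C (inverse f) = - principal_div C f"
  by (auto simp: principal_div_def v_inverse)

lemma principal_1: "principal_div C 1 = 0"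
  by (auto simp: principal_div_def v_1)

text \<open>
  The dimension of \<open>L(- n div f)\<close> does not depend on \<open>n\<close>, and it bounds the degree \<open>- n deg (div f)\<close>
  by Riemann's inequality.  So \<open>deg (div f)\<close> is neither negative nor positive.
\<close>

lemma ddeg_principal:
  assumes "f \<noteq> 0"
  shows "ddeg C (principal_div C f) = 0"
proof -
  have nonneg: "0 \<le> ddeg C (principal_div C h)" if h: "h \<noteq> 0" for h
  proof (rule ccontr)
    let ?d = "ddeg C (principal_div C h)"
    assume "\<not> 0 \<le> ?d"
    have deg: "ddeg C (principal_div C (h ^ n)) = int n * ?d" for n
    proof (induct n)
      case 0
      then show ?case by (simp add: principal_1 ddeg_def)
    next
      case (Suc n)
      have "ddeg C (principal_div C (h ^ Suc n)) = ?d + ddeg C (principal_div C (h ^ n))"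
        using h by (simp add: principal_mult ddeg_add divisor_principal)
      then show ?case using Suc by (simp add: distrib_right)
    qed
    have bound: "- (int n * ?d) - int (rr 0) + 1 \<le> g" for n
    proof -
      have hn: "h ^ n \<noteq> 0" using h by simp
      have "ddeg C (0 - principal_div C (h ^ n)) = - (int n * ?d)"
        using deg ddeg_uminus[of "principal_div C (h ^ n)"] by simp
      then show ?thesis
        using riemann[OF divisor_diff[OF divisor_0 divisor_principal[OF hn]]] rr_shift[OF hn, of 0] by simp
    qed
    let ?n = "nat (g + int (rr 0))"
    have "int ?n * 1 \<le> int ?n * - ?d" using \<open>\<not> 0 \<le> ?d\<close> by (intro mult_left_mono) auto
    then show False using bound[of ?n] g_pos by simp
  qed
  show ?thesis
    using nonneg[OF assms] nonneg[of "inverse f"] assms by (simp add: principal_inverse ddeg_uminus)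
qed

lemma RR_effective:
  assumes "divisor C A" "f \<in> RR_space C A" "f \<noteq> 0"
  shows "0 \<le> A + principal_div C f" "divisor C (A + principal_div C f)"
    "ddeg C (A + principal_div C f) = ddeg C A"
proof -
  show "0 \<le> A + principal_div C f"
  proof (rule le_funI)
    fix v show "0 v \<le> (A + principal_div C f) v"
    proof (cases "is_place C v")
      case True
      then have "- A v \<le> v f" using assms(2,3) by (auto simp: RR_space_def)
      then show ?thesis using True by (simp add: principal_div_def)
    next
      case False
      then have "A v = 0" using assms(1) by (auto simp: divisor_def)
      then show ?thesis using False by (simp add: principal_div_def)
    qed
  qed
  show "divisor C (A + principal_div C f)" "ddeg C (A + principal_div C f) = ddeg C A"
    using assms by (simp_all add: divisor_add divisor_principal ddeg_add ddeg_principal)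
qed

text \<open>
  A space of infinite dimension would have \<open>dim\<close> equal to \<open>0\<close>, which Riemann's inequality excludes in degree at least
  \<open>g\<close>.  In general \<open>L(A)\<close> is contained in some \<open>L(A + n P)\<close> of such a degree.
\<close>

lemma fin_dim_RR:
  assumes "divisor C A"
  shows "K.fin_dim (RR_space C A)"
proof -
  let ?n = "\<bar>ddeg C A\<bar> + g" let ?B = "A + infty_div ?n"
  have B: "divisor C ?B" using assms by (intro divisor_add divisor_infty)
  have "ddeg C ?B = ddeg C A + ?n" using assms by (simp add: ddeg_add divisor_infty ddeg_infty)
  then have "0 < rr ?B" using riemann[OF B] by linarith
  then have "K.fin_dim (RR_space C ?B)" by (rule K.dim_pos_imp_fin_dim)
  moreover have "RR_space C A \<subseteq> RR_space C ?B"
    using g_pos by (intro RR_mono) (auto simp: le_fun_def infty_div_def)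
  ultimately show ?thesis using K.fin_dim_mono by blast
qed


subsection \<open>The index of speciality\<close>

definition spec_index :: "'f divisor \<Rightarrow> int" where
  "spec_index A = int (rr A) - ddeg C A - 1 + g"

lemma spec_index_nonneg: "divisor C A \<Longrightarrow> 0 \<le> spec_index A"
  using riemann[of A] by (simp add: spec_index_def)

text \<open>
  Multiplication by an element of value \<open>A(v) + 1\<close> at \<open>v\<close> takes \<open>L(A + v)\<close> into the local ring of \<open>v\<close>, and \<open>L(A)\<close> is
  what lands in the maximal ideal.
\<close>

lemma rr_add_point:
  assumes A: "divisor C A" and v: "is_place C v"
  shows "int (rr (A + point_div v)) \<le> int (rr A) + place_deg C v"
proof -
  obtain p where p: "p \<noteq> 0" "v p = 1" using v_uniformizer[OF v] by blast
  define y where "y = p powi (A v + 1)"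
  have y: "y \<noteq> 0" "v y = A v + 1" using p by (simp_all add: y_def v_power_int[OF v])
  obtain B where B: "residue_basis v B" using residue_basis_exists[OF v] by blast
  have fB: "finite B" using B by (simp add: residue_basis_def residue_indep_def)
  have "K.fin_dim (RR_space C (A + point_div v)) \<and> rr (A + point_div v) \<le> rr A + card B"
  proof (rule K.dim_le_add_card[where \<phi> = "(*) y" and M = "max_ideal v"])
    show "RR_space C A \<subseteq> RR_space C (A + point_div v)"
      by (rule RR_mono) (auto simp: le_fun_def point_div_def)
    fix f assume f: "f \<in> RR_space C (A + point_div v)"
    then have vf: "f = 0 \<or> - A v - 1 \<le> v f" using v by (auto simp: RR_space_def point_div_def)
    then have "y * f \<in> local_ring v" using y by (cases "f = 0") (auto simp: local_ring_def v_mult[OF v])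
    then show "\<exists>m\<in>max_ideal v. y * f - m \<in> K.span B" using B by (simp add: residue_basis_def)
    assume "y * f \<in> max_ideal v"
    then have "f = 0 \<or> - A v \<le> v f" using y by (cases "f = 0") (auto simp: max_ideal_def v_mult[OF v])
    moreover have "f = 0 \<or> - A w \<le> w f" if "is_place C w" "w \<noteq> v" for w
      using f that by (auto simp: RR_space_def point_div_def)
    ultimately show "f \<in> RR_space C A" unfolding RR_space_def by auto
  qed (use fin_dim_RR[OF A] subspace_RR fB subspace_max_ideal[OF v] in \<open>auto simp: distrib_left scl_mult\<close>)
  then show ?thesis using place_deg_card[OF v B] by simp
qed

lemma spec_index_antimono:
  assumes "divisor C A" "divisor C B" "A \<le> B"
  shows "spec_index B \<le> spec_index A"
  using assms(2,3)
proof (induct "nat (ddeg C (B - A))" arbitrary: B rule: less_induct)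
  case less
  show ?case
  proof (cases "B = A")
    case False
    then obtain v where "B v \<noteq> A v" by auto
    then have lt: "A v < B v" using less(3) by (simp add: le_fun_def order_less_le)
    then have v: "is_place C v" using assms(1) less(2) by (force simp: divisor_def)
    let ?B = "B - point_div v"
    have B': "divisor C ?B" using less(2) v by (intro divisor_diff divisor_point)
    have le: "A \<le> ?B" using less(3) lt by (auto simp: le_fun_def point_div_def)
    have deg: "ddeg C ?B = ddeg C B - place_deg C v"
      using less(2) v by (simp add: ddeg_diff divisor_point ddeg_point)
    have "0 \<le> ddeg C (?B - A)"
      by (rule ddeg_nonneg[OF divisor_diff[OF B' assms(1)]]) (use le in \<open>simp add: le_fun_def\<close>)
    then have "nat (ddeg C (?B - A)) < nat (ddeg C (B - A))"
      using deg place_deg_pos[OF v] assms(1) less(2) B' by (simp add: ddeg_diff)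
    then have "spec_index ?B \<le> spec_index A" using less(1) B' le by blast
    moreover have "?B + point_div v = B" by simp
    then have "int (rr B) \<le> int (rr ?B) + place_deg C v" using rr_add_point[OF B' v] by metis
    ultimately show ?thesis using deg by (simp add: spec_index_def)
  qed simp
qed

lemma spec_index_shift: "divisor C A \<Longrightarrow> f \<noteq> 0 \<Longrightarrow> spec_index (A - principal_div C f) = spec_index A"
  by (simp add: spec_index_def rr_shift ddeg_diff divisor_principal ddeg_principal)

text \<open>
  The genus is attained at some divisor \<open>Z\<close> of index \<open>0\<close>.  For large \<open>n\<close> the divisor \<open>A + n P\<close> dominates a divisor
  linearly equivalent to \<open>Z\<close>, and the index decreases along \<open>\<le>\<close>.
\<close>

lemma spec_index_eventually_0:
  assumes A: "divisor C A"
  shows "\<exists>n::nat. spec_index (A + infty_div (int n)) = 0"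
proof -
  obtain Z where Z: "divisor C Z" "ddeg C Z - int (rr Z) + 1 = g"
    using genus unfolding has_genus_def kdim_def by blast
  let ?n = "nat (g + \<bar>ddeg C Z\<bar> + \<bar>ddeg C A\<bar>)"
  let ?B = "A + infty_div (int ?n)"
  have B: "divisor C ?B" using A by (intro divisor_add divisor_infty)
  have BZ: "divisor C (?B - Z)" using B Z(1) by (rule divisor_diff)
  have "g \<le> ddeg C (?B - Z)"
    using A Z(1) B g_pos by (simp add: ddeg_diff ddeg_add divisor_infty ddeg_infty)
  then have "rr (?B - Z) \<noteq> 0" using riemann[OF BZ] by linarith
  then have "RR_space C (?B - Z) \<noteq> {0}"
    using K.dim_le_card[of "{0}" "{}"] by auto
  then obtain f where f: "f \<in> RR_space C (?B - Z)" "f \<noteq> 0"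
    using K.subspace_0[OF subspace_RR[of "?B - Z"]] by blast
  have "Z - principal_div C f \<le> ?B"
    using RR_effective(1)[OF BZ f] by (auto simp: le_fun_def algebra_simps)
  then have "spec_index ?B \<le> spec_index (Z - principal_div C f)"
    using B Z(1) f(2) by (intro spec_index_antimono divisor_diff divisor_principal)
  also have "\<dots> = 0" using spec_index_shift[OF Z(1) f(2)] Z(2) by (simp add: spec_index_def)
  finally show ?thesis using spec_index_nonneg[OF B] by (intro exI[of _ ?n]) simp
qed


subsection \<open>Pole orders at the rational point\<close>

definition pole_orders :: "'f set \<Rightarrow> int set" where
  "pole_orders V = {- P f | f. f \<in> V \<and> f \<noteq> 0}"

text \<open>The quotient \<open>f / h\<close> is a unit at \<open>P\<close>, and the residue field of \<open>P\<close> is \<open>K\<close>.\<close>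

lemma cancel_leading_term:
  assumes "f \<noteq> 0" "h \<noteq> 0" "P f = P h"
  obtains c where "f - scl C c h = 0 \<or> P f < P (f - scl C c h)"
proof -
  have "f / h \<in> local_ring P" using assms by (simp add: local_ring_def v_divide[OF place_P])
  then obtain c where c: "f / h - emb C c \<in> max_ideal P" using rational unfolding rational_place_def by blast
  have eq: "f - scl C c h = (f / h - emb C c) * h" using assms(2) by (simp add: scl_def algebra_simps)
  show thesis
  proof (rule that[of c], cases "f / h - emb C c = 0")
    case False
    then have "0 < P (f / h - emb C c)" using c by (simp add: max_ideal_def)
    then show "f - scl C c h = 0 \<or> P f < P (f - scl C c h)"
      unfolding eq using False assms by (simp add: v_mult[OF place_P])
  qed (simp add: eq)
qed

text \<open>
  In a linear combination the term with the highest pole order at \<open>P\<close> cannot be cancelled by the others.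
\<close>

lemma independent_distinct_pole_orders:
  assumes "finite S" "0 \<notin> S" "inj_on P S"
  shows "K.independent S"
proof (rule K.independent_if_scalars_zero[OF assms(1)])
  fix c x assume s: "(\<Sum>x\<in>S. scl C (c x) x) = 0" and x: "x \<in> S"
  show "c x = 0"
  proof (rule ccontr)
    assume "c x \<noteq> 0"
    let ?T = "{y \<in> S. c y \<noteq> 0}"
    have T: "finite ?T" "?T \<noteq> {}" using assms(1) x \<open>c x \<noteq> 0\<close> by auto
    define y where "y = arg_min_on P ?T"
    have y: "y \<in> ?T" "\<And>z. z \<in> ?T \<Longrightarrow> P y \<le> P z"
      using arg_min_if_finite[OF T, of P] unfolding y_def by (auto simp: not_less)
    have ynz: "y \<noteq> 0" "c y \<noteq> 0" using y(1) assms(2) by auto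
    have rest: "(\<Sum>z\<in>S - {y}. scl C (c z) z) \<in> {w. w = 0 \<or> P y + 1 \<le> P w}"
    proof (rule K.subspace_sum[OF subspace_valuation_ge[OF place_P]])
      fix z assume z: "z \<in> S - {y}"
      show "scl C (c z) z \<in> {w. w = 0 \<or> P y + 1 \<le> P w}"
      proof (cases "c z = 0")
        case False
        then have "P y \<le> P z" using y(2) z by auto
        moreover have "P y \<noteq> P z" using assms(3) z y(1) by (auto simp: inj_on_def)
        moreover have "z \<noteq> 0" using assms(2) z by auto
        ultimately show ?thesis using False by (simp add: v_scl[OF place_P])
      qed simp
    qed
    have "scl C (c y) y + (\<Sum>z\<in>S - {y}. scl C (c z) z) \<noteq> 0"
      by (rule v_add_less[OF place_P]) (use rest ynz in \<open>auto simp: v_scl[OF place_P]\<close>)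
    then show False using s y(1) sum.remove[OF assms(1), of y "\<lambda>z. scl C (c z) z"] by simp
  qed
qed

definition degree_list :: "'f set \<Rightarrow> int list" where
  "degree_list V = sorted_list_of_set (pole_orders V)"

lemma pole_order_representatives:
  assumes "\<And>n. n \<in> T \<Longrightarrow> r n \<noteq> 0 \<and> - P (r n) = n" "finite T"
  shows "K.independent (r ` T)" "inj_on r T"
proof -
  show inj: "inj_on r T" using assms(1) by (metis inj_onI)
  have "inj_on P (r ` T)"
  proof (rule inj_onI)
    fix x y assume "x \<in> r ` T" "y \<in> r ` T" and eq: "P x = P y"
    then obtain m n where mn: "m \<in> T" "x = r m" "n \<in> T" "y = r n" by blast
    have "- P (r m) = m" "- P (r n) = n" using assms(1)[OF mn(1)] assms(1)[OF mn(3)] by blast+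
    then have "m = n" using eq unfolding mn(2,4) by metis
    then show "x = y" using mn by simp
  qed
  moreover have "r n \<noteq> 0" if "n \<in> T" for n using assms(1)[OF that] by (rule conjunct1)
  then have "0 \<notin> r ` T" by (metis imageE)
  ultimately show "K.independent (r ` T)" using assms(2) by (intro independent_distinct_pole_orders) auto
qed

lemma finite_pole_orders:
  assumes "K.fin_dim V"
  shows "finite (pole_orders V)"
proof (rule ccontr)
  assume "infinite (pole_orders V)"
  then obtain T where T: "finite T" "card T = Suc (K.dim V)" "T \<subseteq> pole_orders V"
    using infinite_arbitrarily_large by blast
  have "\<forall>n\<in>T. \<exists>f\<in>V. f \<noteq> 0 \<and> - P f = n" using T(3) unfolding pole_orders_def by blast
  then obtain r where r: "\<And>n. n \<in> T \<Longrightarrow> r n \<in> V" "\<And>n. n \<in> T \<Longrightarrow> r n \<noteq> 0 \<and> - P (r n) = n" by metis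
  have "card (r ` T) \<le> K.dim V"
    using K.independent_card_le[OF assms, of "r ` T"] r(1) pole_order_representatives(1)[OF r(2) T(1)] by blast
  then show False using T(2) card_image[OF pole_order_representatives(2)[OF r(2) T(1)]] by simp
qed

lemma card_below_strict_mono:
  fixes T :: "int set"
  assumes "finite T" "a \<in> T" "a < b"
  shows "card {n \<in> T. n < a} < card {n \<in> T. n < b}"
  using assms by (intro psubset_card_mono) auto

text \<open>
  Successive subtraction of leading terms lowers the pole order, and there are only finitely many orders below the first
  one.
\<close>

lemma span_pole_order_representatives:
  assumes V: "K.subspace V" "finite (pole_orders V)"
    and r: "\<And>n. n \<in> pole_orders V \<Longrightarrow> r n \<in> V \<and> r n \<noteq> 0 \<and> - P (r n) = n"
  shows "K.span (r ` pole_orders V) = V"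
proof (rule K.span_subspace[OF _ _ V(1)])
  show "r ` pole_orders V \<subseteq> V" using r by blast
  show "V \<subseteq> K.span (r ` pole_orders V)"
  proof
    fix f assume "f \<in> V"
    then show "f \<in> K.span (r ` pole_orders V)"
    proof (induct "card {n \<in> pole_orders V. n < - P f}" arbitrary: f rule: less_induct)
      case less
      show ?case
      proof (cases "f = 0")
        case False
        let ?n = "- P f"
        have n: "?n \<in> pole_orders V" unfolding pole_orders_def using less(2) False by blast
        obtain c where c: "f - scl C c (r ?n) = 0 \<or> P f < P (f - scl C c (r ?n))"
          using cancel_leading_term[OF False, of "r ?n"] r[OF n] by auto
        let ?h = "f - scl C c (r ?n)"
        have hV: "?h \<in> V" using less(2) r[OF n] V(1) by (intro K.subspace_diff K.subspace_scale) auto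
        have "?h \<in> K.span (r ` pole_orders V)"
        proof (cases "?h = 0")
          case True
          then show ?thesis by (simp add: K.span_zero)
        next
          case nz: False
          then have lt: "- P ?h < ?n" using c by simp
          have "- P ?h \<in> pole_orders V" unfolding pole_orders_def using hV nz by blast
          then have "card {n \<in> pole_orders V. n < - P ?h} < card {n \<in> pole_orders V. n < ?n}"
            using lt by (rule card_below_strict_mono[OF V(2)])
          then show ?thesis using hV by (rule less(1))
        qed
        moreover have "scl C c (r ?n) \<in> K.span (r ` pole_orders V)"
          using n by (intro K.span_scale K.span_base) auto
        ultimately have "?h + scl C c (r ?n) \<in> K.span (r ` pole_orders V)" by (rule K.span_add)
        then show ?thesis by simp
      qed (simp add: K.span_zero)
    qed
  qed
qed

lemma echelon_basis_exists:
  assumes V: "K.subspace V" "K.fin_dim V"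
  shows "\<exists>bs. echelon_basis C V bs \<and> length bs = card (pole_orders V)"
proof -
  have fin: "finite (pole_orders V)" by (rule finite_pole_orders[OF V(2)])
  have "\<forall>n\<in>pole_orders V. \<exists>f\<in>V. f \<noteq> 0 \<and> - P f = n" by (auto simp: pole_orders_def)
  then obtain r where r: "\<And>n. n \<in> pole_orders V \<Longrightarrow> r n \<in> V \<and> r n \<noteq> 0 \<and> - P (r n) = n" by metis
  let ?bs = "map r (degree_list V)"
  have set: "set ?bs = r ` pole_orders V" using fin by (simp add: degree_list_def)
  have "sorted_wrt (<) (degree_list V)"
    unfolding degree_list_def by simp
  then have "sorted_wrt (\<lambda>m n. pdeg C (r m) < pdeg C (r n)) (degree_list V)"
    by (rule sorted_wrt_mono_rel[rotated])
      (use r fin in \<open>auto simp: degree_list_def pdeg_def\<close>)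
  then have "sorted_wrt (\<lambda>a b. pdeg C a < pdeg C b) ?bs" by (simp add: sorted_wrt_map)
  moreover have "K.independent (set ?bs)"
    unfolding set using r fin by (intro pole_order_representatives) auto
  moreover have "K.span (set ?bs) = V"
    unfolding set using V(1) fin r by (rule span_pole_order_representatives)
  ultimately have "echelon_basis C V ?bs"
    unfolding echelon_basis_def kindep_def kspan_def by blast
  moreover have "length ?bs = card (pole_orders V)" by (simp add: degree_list_def)
  ultimately show ?thesis by blast
qed

lemma echelon_basis_distinct: "echelon_basis C V bs \<Longrightarrow> distinct bs"
  unfolding echelon_basis_def
  by (metis (mono_tags, lifting) distinct_conv_nth order_less_irrefl sorted_wrt_iff_nth_less nat_neq_iff)

lemma card_pole_orders:
  assumes "K.subspace V" "K.fin_dim V"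
  shows "card (pole_orders V) = K.dim V"
proof -
  obtain bs where bs: "echelon_basis C V bs" "length bs = card (pole_orders V)"
    using echelon_basis_exists[OF assms] by blast
  have "card (set bs) = card (pole_orders V)"
    using bs(2) distinct_card[OF echelon_basis_distinct[OF bs(1)]] by simp
  moreover have "K.dim V = card (set bs)"
    using bs(1) unfolding echelon_basis_def kindep_def kspan_def
    by (metis K.dim_span_eq_card_independent)
  ultimately show ?thesis by simp
qed

text \<open>
  The degrees of an echelon basis increase strictly, and there are as many of them as pole orders; so all echelon
  bases of a space have the same degrees.
\<close>

lemma echelon_basis_degrees:
  assumes V: "K.fin_dim V" and bs: "echelon_basis C V bs"
  shows "length bs = card (pole_orders V)"
    "\<And>i. i < length bs \<Longrightarrow> bs ! i \<in> V \<and> bs ! i \<noteq> 0 \<and> pdeg C (bs ! i) = Fin (degree_list V ! i)"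
proof -
  have sorted: "sorted_wrt (\<lambda>a b. pdeg C a < pdeg C b) bs" and ind: "K.independent (set bs)"
    and span: "K.span (set bs) = V"
    using bs by (simp_all add: echelon_basis_def kindep_def kspan_def)
  have subV: "K.subspace V" using span K.subspace_span by blast
  have fin: "finite (pole_orders V)" by (rule finite_pole_orders[OF V])
  have nz: "0 \<notin> set bs" using ind K.dependent_zero by blast
  have sV: "set bs \<subseteq> V" using span K.span_superset by blast
  let ?d = "map (\<lambda>b. - P b) bs"
  have "sorted_wrt (\<lambda>a b. - P a < - P b) bs"
    by (rule sorted_wrt_mono_rel[OF _ sorted]) (use nz in \<open>auto simp: pdeg_def split: if_splits\<close>)
  then have sd: "sorted_wrt (<) ?d" by (simp add: sorted_wrt_map)
  then have dist: "distinct ?d" by (simp add: strict_sorted_iff)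
  have sub: "set ?d \<subseteq> pole_orders V" unfolding pole_orders_def using nz sV by auto
  have "length bs = card (set bs)" using dist by (simp add: distinct_card distinct_map)
  also have "\<dots> = K.dim V" using ind span K.dim_span_eq_card_independent by metis
  finally show len: "length bs = card (pole_orders V)" using card_pole_orders[OF subV V] by simp
  have "card (set ?d) = card (pole_orders V)" using dist len distinct_card by fastforce
  then have "set ?d = pole_orders V" using sub fin by (simp add: card_subset_eq)
  then have "?d = degree_list V"
    unfolding degree_list_def using sd by (metis strict_sorted_equal sorted_list_of_set.strict_sorted_key_list_of_set fin set_sorted_list_of_set)
  then show "bs ! i \<in> V \<and> bs ! i \<noteq> 0 \<and> pdeg C (bs ! i) = Fin (degree_list V ! i)" if "i < length bs" for i
  proof -
    have "bs ! i \<in> set bs" using that by simp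
    then have "bs ! i \<in> V" "bs ! i \<noteq> 0" using sV nz by auto
    moreover have "degree_list V ! i = - P (bs ! i)" using that \<open>?d = degree_list V\<close> by (metis nth_map)
    ultimately show ?thesis by (simp add: pdeg_def)
  qed
qed


subsection \<open>Divisors of degree at least \<open>2g - 1\<close> are nonspecial\<close>

text \<open>
  A function that is regular away from \<open>P\<close> and has a zero at \<open>P\<close> would have a divisor of positive degree.
\<close>

lemma affine_pole_order_nonneg:
  assumes "f \<noteq> 0" "f \<in> RR_space C (infty_div n)"
  shows "0 \<le> - P f"
proof -
  have "0 \<le> infty_div (- P f) + principal_div C f"
  proof (rule le_funI)
    fix v show "0 v \<le> (infty_div (- P f) + principal_div C f) v"
      using assms place_P by (auto simp: RR_space_def infty_div_def principal_div_def)
  qed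
  then have "0 \<le> ddeg C (infty_div (- P f) + principal_div C f)"
    using assms by (intro ddeg_nonneg divisor_add divisor_infty divisor_principal)
  then show ?thesis
    using assms by (simp add: ddeg_add divisor_infty divisor_principal ddeg_infty ddeg_principal)
qed

text \<open>Riemann's inequality for \<open>M P\<close> provides at least \<open>M + 1 - g\<close> pole orders.\<close>

lemma card_gaps:
  assumes "0 \<le> M"
  shows "int (card ({0..M} - pole_orders (RR_space C (infty_div M)))) \<le> g"
proof -
  let ?H = "pole_orders (RR_space C (infty_div M))"
  have sub: "?H \<subseteq> {0..M}"
  proof
    fix n assume "n \<in> ?H"
    then obtain f where f: "f \<in> RR_space C (infty_div M)" "f \<noteq> 0" "n = - P f"
      unfolding pole_orders_def by blast
    then have "- M \<le> P f" using place_P by (auto simp: RR_space_def infty_div_def)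
    then show "n \<in> {0..M}" using f affine_pole_order_nonneg by auto
  qed
  have "card ?H = rr (infty_div M)"
    by (intro card_pole_orders subspace_RR fin_dim_RR divisor_infty)
  then have "M + 1 - g \<le> int (card ?H)" using riemann[OF divisor_infty, of M] by (simp add: ddeg_infty)
  moreover have "int (card ({0..M} - ?H)) = int (card {0..M}) - int (card ?H)"
    using card_Diff_subset[OF finite_subset[OF sub] sub] card_mono[OF _ sub] by (simp only: of_nat_diff finite_atLeastAtMost_int)
  ultimately show ?thesis using assms by simp
qed

text \<open>
  If \<open>A\<close> is special, then some \<open>A' = A + n P\<close> is special while \<open>A' + P\<close> is not, so that
  \<open>L(A' + P) = L(A')\<close>: the pole order \<open>m = A'(P) + 1\<close> does not occur in \<open>L(A' + P)\<close>.  For every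
  pole order \<open>j\<close> of \<open>L(A')\<close> the difference \<open>m - j\<close> is then a gap of the affine ring, because
  multiplication would produce the missing order \<open>m\<close>.  As there are at most \<open>g\<close> gaps, \<open>L(A')\<close>
  has dimension at most \<open>g\<close>, which forces \<open>deg A' \<le> 2g - 2\<close>.
\<close>

lemma spec_index_eq_0:
  assumes A: "divisor C A" and deg: "2 * g - 1 \<le> ddeg C A"
  shows "spec_index A = 0"
proof (rule ccontr)
  assume "spec_index A \<noteq> 0"
  let ?n = "LEAST n::nat. spec_index (A + infty_div (int n)) = 0"
  have n: "spec_index (A + infty_div (int ?n)) = 0"
    using spec_index_eventually_0[OF A] by (rule LeastI_ex)
  have "infty_div 0 = 0" by (auto simp: infty_div_def)
  then have "?n \<noteq> 0" using n \<open>spec_index A \<noteq> 0\<close> by (metis add.right_neutral of_nat_0)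
  then obtain k where k: "?n = Suc k" using not0_implies_Suc by blast
  define A' where "A' = A + infty_div (int k)"
  define m where "m = A' P + 1"
  have A': "divisor C A'" unfolding A'_def using A by (intro divisor_add divisor_infty)
  have degA': "2 * g - 1 \<le> ddeg C A'"
    using deg A by (simp add: A'_def ddeg_add divisor_infty ddeg_infty)
  have "spec_index A' \<noteq> 0"
    using not_less_Least[of k "\<lambda>n. spec_index (A + infty_div (int n)) = 0"] k unfolding A'_def by simp
  then have s1: "1 \<le> spec_index A'" using spec_index_nonneg[OF A'] by simp
  have eq: "A + infty_div (int ?n) = A' + infty_div 1"
    unfolding k A'_def by (auto simp: infty_div_def)
  have s0: "spec_index (A' + infty_div 1) = 0" using n unfolding eq .
  have A'': "divisor C (A' + infty_div 1)" using A' by (intro divisor_add divisor_infty)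
  have "ddeg C (A' + infty_div 1) = ddeg C A' + 1" using A' by (simp add: ddeg_add divisor_infty ddeg_infty)
  then have "rr (A' + infty_div 1) \<le> rr A'" using s0 s1 by (simp add: spec_index_def)
  then have same: "RR_space C A' = RR_space C (A' + infty_div 1)"
    by (intro K.subspace_eq_of_dim_le subspace_RR RR_mono fin_dim_RR[OF A''])
      (auto simp: le_fun_def infty_div_def)
  let ?T = "pole_orders (RR_space C A')"
  have cT: "card ?T = rr A'" and fT: "finite ?T"
    using A' by (auto intro!: card_pole_orders finite_pole_orders subspace_RR fin_dim_RR)
  define M where "M = Max (insert 0 ((\<lambda>j. m - j) ` ?T))"
  have M: "0 \<le> M" "\<And>j. j \<in> ?T \<Longrightarrow> m - j \<le> M" unfolding M_def using fT by auto
  have gap: "m - j \<in> {0..M} - pole_orders (RR_space C (infty_div M))" if j: "j \<in> ?T" for j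
  proof -
    obtain f where f: "f \<in> RR_space C A'" "f \<noteq> 0" "j = - P f" using j unfolding pole_orders_def by blast
    have "- A' P \<le> P f" using f place_P by (auto simp: RR_space_def)
    then have "j \<le> m - 1" using f(3) by (simp add: m_def)
    moreover have "m - j \<notin> pole_orders (RR_space C (infty_div M))"
    proof
      assume "m - j \<in> pole_orders (RR_space C (infty_div M))"
      then obtain h where h: "h \<in> RR_space C (infty_div M)" "h \<noteq> 0" "m - j = - P h"
        unfolding pole_orders_def by blast
      have fh: "f * h \<noteq> 0" "P (f * h) = - m" using f h by (simp_all add: v_mult[OF place_P])
      have "- (A' + infty_div 1) v \<le> v (f * h)" if v: "is_place C v" for v
      proof (cases "v = P")
        case True
        then show ?thesis using fh(2) by (simp add: m_def infty_div_def)
      next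
        case False
        then have "- A' v \<le> v f" "0 \<le> v h" using f h v by (auto simp: RR_space_def infty_div_def)
        then show ?thesis using False f(2) h(2) by (simp add: v_mult[OF v] infty_div_def)
      qed
      then have "f * h \<in> RR_space C (A' + infty_div 1)" unfolding RR_space_def by blast
      then have "- A' P \<le> P (f * h)" using fh(1) place_P unfolding same[symmetric] by (auto simp: RR_space_def)
      then show False using fh(2) by (simp add: m_def)
    qed
    ultimately show ?thesis using M(2)[OF j] by simp
  qed
  have "card ((\<lambda>j. m - j) ` ?T) \<le> card ({0..M} - pole_orders (RR_space C (infty_div M)))"
    using gap by (intro card_mono) auto
  moreover have "card ((\<lambda>j. m - j) ` ?T) = card ?T" by (intro card_image inj_onI) simp
  ultimately have "int (rr A') \<le> g" using card_gaps[OF M(1)] cT by linarith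
  then show False using s1 degA' by (simp add: spec_index_def)
qed

lemma riemann_roch:
  assumes "divisor C A" "2 * g - 1 \<le> ddeg C A"
  shows "int (rr A) = ddeg C A + 1 - g"
  using spec_index_eq_0[OF assms] by (simp add: spec_index_def)

end

section \<open>Typical divisors and flips\<close>

context pointed_curve
begin

subsection \<open>The spaces \<open>W\<^sup>N\<close> and \<open>W\<^sup>N\<^sub>D\<close>\<close>

lemma principal_adiv: "principal_div C f = adiv C f + infty_div (P f)"
  using place_P by (auto simp: principal_div_def adiv_def infty_div_def)

lemma W_iff:
  assumes "f \<noteq> 0"
  shows "f \<in> W C N \<longleftrightarrow> (\<forall>v. is_place C v \<and> v \<noteq> P \<longrightarrow> 0 \<le> v f) \<and> - P f \<le> N"
  using assms by (simp add: W_def affR_def pdeg_def)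

lemma W_0: "0 \<in> W C N"
  by (simp add: W_def affR_def pdeg_def)

lemma WD_0: "0 \<in> W\<^sub>D C D N"
  using W_0[of N] by (simp add: W\<^sub>D_def I\<^sub>D_def W_def)

lemma WD_iff:
  assumes "good C D" "f \<noteq> 0"
  shows "f \<in> W\<^sub>D C D N \<longleftrightarrow> (\<forall>v. is_place C v \<and> v \<noteq> P \<longrightarrow> D v \<le> v f) \<and> - P f \<le> N"
proof
  assume f: "f \<in> W\<^sub>D C D N"
  then have "f \<in> W C N" "D \<le> adiv C f" using assms(2) by (auto simp: W\<^sub>D_def I\<^sub>D_def)
  moreover have "D v \<le> v f" if "is_place C v \<and> v \<noteq> P" for v
    using le_funD[OF \<open>D \<le> adiv C f\<close>, of v] that by (simp add: adiv_def)
  ultimately show "(\<forall>v. is_place C v \<and> v \<noteq> P \<longrightarrow> D v \<le> v f) \<and> - P f \<le> N"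
    using W_iff[OF assms(2)] by blast
next
  assume f: "(\<forall>v. is_place C v \<and> v \<noteq> P \<longrightarrow> D v \<le> v f) \<and> - P f \<le> N"
  have D0: "0 \<le> D v" for v using assms(1) by (simp add: good_def le_fun_def)
  have "f \<in> W C N" unfolding W_iff[OF assms(2)] using f D0 order_trans by blast
  moreover have "D \<le> adiv C f"
  proof (rule le_funI)
    fix v show "D v \<le> adiv C f v"
    proof (cases "is_place C v \<and> v \<noteq> P")
      case True
      then show ?thesis using f by (simp add: adiv_def)
    next
      case False
      then have "D v = 0" using assms(1) unfolding good_def divisor_def by blast
      then show ?thesis using False by (auto simp: adiv_def)
    qed
  qed
  ultimately show "f \<in> W\<^sub>D C D N" by (simp add: W\<^sub>D_def I\<^sub>D_def W_def)
qed

lemma good_0: "good C 0"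
  by (simp add: good_def divisor_0)

lemma good_add: "good C D \<Longrightarrow> good C D' \<Longrightarrow> good C (D + D')"
  by (auto simp: good_def divisor_add le_fun_def)

lemma good_divisor: "good C D \<Longrightarrow> divisor C D"
  by (simp add: good_def)

lemma W_eq_WD_0: "W C N = W\<^sub>D C 0 N"
proof (rule Set.set_eqI)
  fix f show "f \<in> W C N \<longleftrightarrow> f \<in> W\<^sub>D C 0 N"
    by (cases "f = 0") (simp_all add: W_0 WD_0 W_iff WD_iff[OF good_0])
qed

lemma WD_eq_RR:
  assumes "good C D"
  shows "W\<^sub>D C D N = RR_space C (infty_div N - D)"
proof (rule Set.set_eqI)
  fix f
  have "D P = 0" using assms by (simp add: good_def)
  then have "(\<forall>v. is_place C v \<and> v \<noteq> P \<longrightarrow> D v \<le> v f) \<and> - P f \<le> N \<longleftrightarrow>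
      (\<forall>v. is_place C v \<longrightarrow> - (infty_div N - D) v \<le> v f)"
    using place_P by (auto simp: infty_div_def)
  then show "f \<in> W\<^sub>D C D N \<longleftrightarrow> f \<in> RR_space C (infty_div N - D)"
    by (cases "f = 0") (simp_all add: WD_0 WD_iff[OF assms] RR_space_def)
qed

lemma divisor_infty_diff: "good C D \<Longrightarrow> divisor C (infty_div N - D)"
  by (intro divisor_diff divisor_infty good_divisor)

lemma subspace_WD: "good C D \<Longrightarrow> K.subspace (W\<^sub>D C D N)"
  by (simp add: WD_eq_RR subspace_RR)

lemma fin_dim_WD: "good C D \<Longrightarrow> K.fin_dim (W\<^sub>D C D N)"
  by (simp add: WD_eq_RR fin_dim_RR divisor_infty_diff)

lemma subspace_W: "K.subspace (W C N)"
  by (simp add: W_eq_WD_0 subspace_WD good_0)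

lemma fin_dim_W: "K.fin_dim (W C N)"
  by (simp add: W_eq_WD_0 fin_dim_WD good_0)

lemma WD_subset_W: "W\<^sub>D C D N \<subseteq> W C N"
  by (simp add: W\<^sub>D_def)

lemma W_mono: "M \<le> N \<Longrightarrow> W C M \<subseteq> W C N"
  unfolding W_def by (auto intro: order_trans)

lemma WD_mono: "M \<le> N \<Longrightarrow> W\<^sub>D C D M \<subseteq> W\<^sub>D C D N"
  using W_mono[of M N] unfolding W\<^sub>D_def by blast

lemma ddeg_infty_diff: "good C D \<Longrightarrow> ddeg C (infty_div N - D) = N - ddeg C D"
  by (simp add: ddeg_diff divisor_infty good_divisor ddeg_infty)

lemma dim_WD_ge: "good C D \<Longrightarrow> N - ddeg C D + 1 - g \<le> int (K.dim (W\<^sub>D C D N))"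
  using riemann[OF divisor_infty_diff, of D N] by (simp add: WD_eq_RR ddeg_infty_diff)

lemma dim_WD: "good C D \<Longrightarrow> 2 * g - 1 \<le> N - ddeg C D \<Longrightarrow> int (K.dim (W\<^sub>D C D N)) = N - ddeg C D + 1 - g"
  using riemann_roch[OF divisor_infty_diff, of D N] by (simp add: WD_eq_RR ddeg_infty_diff)

lemma dim_W: "2 * g - 1 \<le> N \<Longrightarrow> int (K.dim (W C N)) = N + 1 - g"
  using dim_WD[OF good_0, of N] by (simp add: W_eq_WD_0 ddeg_def)

lemma WD_mult:
  assumes D: "good C D" "good C D'" and a: "a \<in> W\<^sub>D C D M" and b: "b \<in> W\<^sub>D C D' N"
  shows "a * b \<in> W\<^sub>D C (D + D') (M + N)"
proof (cases "a = 0 \<or> b = 0")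
  case False
  then have nz: "a \<noteq> 0" "b \<noteq> 0" by auto
  have "(D + D') v \<le> v (a * b)" if "is_place C v \<and> v \<noteq> P" for v
    using a b that nz unfolding WD_iff[OF D(1) nz(1)] WD_iff[OF D(2) nz(2)] by (auto simp: v_mult intro: add_mono)
  moreover have "- P (a * b) \<le> M + N"
    using a b nz unfolding WD_iff[OF D(1) nz(1)] WD_iff[OF D(2) nz(2)] by (simp add: v_mult[OF place_P])
  moreover have "a * b \<noteq> 0" using nz by simp
  ultimately show ?thesis using WD_iff[OF good_add[OF D]] by blast
qed (auto simp: WD_0)

lemma WD_mult_W: "good C D \<Longrightarrow> a \<in> W\<^sub>D C D M \<Longrightarrow> b \<in> W C N \<Longrightarrow> a * b \<in> W\<^sub>D C D (M + N)"
  using WD_mult[OF _ good_0, of D a M b N] by (simp add: W_eq_WD_0)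

lemma W_mult: "a \<in> W C M \<Longrightarrow> b \<in> W C N \<Longrightarrow> a * b \<in> W C (M + N)"
  using WD_mult_W[OF good_0, of a M b N] by (simp add: W_eq_WD_0)

lemma const_W: "0 \<le> N \<Longrightarrow> emb C c \<in> W C N"
  using place_P by (cases "c = 0") (auto simp: W_iff W_0 v_emb)

lemma one_W: "0 \<le> N \<Longrightarrow> 1 \<in> W C N"
  using const_W[of N 1] by simp

text \<open>This is \<open>L(A - div y) = y L(A)\<close>, with the part of \<open>div y\<close> at \<open>P\<close> turned into a shift of degrees.\<close>

lemma WD_shift_iff:
  assumes "good C D" "good C D'" "y \<noteq> 0" "adiv C y = D' - D" "N' = N - P y"
  shows "y * f \<in> W\<^sub>D C D' N' \<longleftrightarrow> f \<in> W\<^sub>D C D N"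
proof -
  have "infty_div N - D - principal_div C y = infty_div N' - D'"
    unfolding principal_adiv assms(4,5) by (auto simp: infty_div_def)
  then show ?thesis using RR_shift_iff[OF assms(3), of f "infty_div N - D"] assms(1,2) by (simp add: WD_eq_RR)
qed

lemma adiv_divide: "f \<noteq> 0 \<Longrightarrow> h \<noteq> 0 \<Longrightarrow> adiv C (f / h) = adiv C f - adiv C h"
  by (auto simp: adiv_def v_divide)

lemma adiv_minus: "adiv C (- f) = adiv C f"
  by (auto simp: adiv_def v_minus)

lemma adiv_good:
  assumes "f \<in> W C N" "f \<noteq> 0"
  shows "good C (adiv C f)" "ddeg C (adiv C f) = - P f"
proof -
  have eq: "adiv C f = principal_div C f - infty_div (P f)" by (simp add: principal_adiv)
  have "divisor C (adiv C f)" unfolding eq using assms(2) by (intro divisor_diff divisor_principal divisor_infty)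
  then show "good C (adiv C f)"
    using assms unfolding good_def W_iff[OF assms(2)] by (auto simp: adiv_def le_fun_def)
  show "ddeg C (adiv C f) = - P f"
    unfolding eq using assms(2) by (simp add: ddeg_diff divisor_principal divisor_infty ddeg_principal ddeg_infty)
qed

lemma W_negative:
  assumes "a \<in> W C N" "N < 0"
  shows "a = 0"
proof (rule ccontr)
  assume a: "a \<noteq> 0"
  then have "0 \<le> ddeg C (adiv C a)"
    using adiv_good(1)[OF assms(1) a] by (intro ddeg_nonneg) (auto simp: good_def)
  then show False using adiv_good(2)[OF assms(1) a] assms a by (simp add: W_iff)
qed

lemma complementary_divisor:
  assumes "good C D" "s \<in> W\<^sub>D C D N" "s \<noteq> 0"
  obtains A where "good C A" "adiv C s = D + A" "ddeg C A = - P s - ddeg C D"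
proof -
  have sW: "s \<in> W C N" using assms(2) WD_subset_W by blast
  have le: "D \<le> adiv C s" using assms(2,3) by (auto simp: W\<^sub>D_def I\<^sub>D_def)
  let ?A = "adiv C s - D"
  have "good C ?A"
    using adiv_good(1)[OF sW assms(3)] assms(1) le unfolding good_def
    by (simp add: divisor_diff le_fun_def)
  moreover have "adiv C s = D + ?A" by simp
  moreover have "ddeg C ?A = - P s - ddeg C D"
    using adiv_good[OF sW assms(3)] assms(1) by (simp add: ddeg_diff good_divisor)
  ultimately show thesis by (rule that)
qed

lemma pdeg_Fin: "pdeg C f = Fin n \<longleftrightarrow> f \<noteq> 0 \<and> - P f = n"
  by (simp add: pdeg_def)


subsection \<open>Semi-typical divisors\<close>

lemma semi_typical_order:
  assumes "semi_typical C g D" "f \<in> W\<^sub>D C D N" "f \<noteq> 0"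
  shows "ddeg C D + g \<le> - P f"
proof (rule ccontr)
  assume "\<not> ?thesis"
  then have "f \<in> W\<^sub>D C D (ddeg C D + g - 1)"
    using assms WD_iff[of D f] unfolding semi_typical_def by auto
  then show False using assms(1,3) unfolding semi_typical_def by blast
qed

text \<open>
  Riemann's inequality gives as many pole orders as there are numbers in the interval.
\<close>

lemma semi_typical_pole_orders:
  assumes D: "semi_typical C g D" and N: "ddeg C D + g - 1 \<le> N"
  shows "pole_orders (W\<^sub>D C D N) = {ddeg C D + g..N}"
proof (rule card_seteq)
  have good: "good C D" using D by (simp add: semi_typical_def)
  show "pole_orders (W\<^sub>D C D N) \<subseteq> {ddeg C D + g..N}"
  proof
    fix n assume "n \<in> pole_orders (W\<^sub>D C D N)"
    then obtain f where f: "f \<in> W\<^sub>D C D N" "f \<noteq> 0" "n = - P f" unfolding pole_orders_def by blast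
    then show "n \<in> {ddeg C D + g..N}" using semi_typical_order[OF D f(1,2)] WD_iff[OF good f(2)] by simp
  qed
  have "card (pole_orders (W\<^sub>D C D N)) = K.dim (W\<^sub>D C D N)"
    by (rule card_pole_orders[OF subspace_WD[OF good] fin_dim_WD[OF good]])
  then show "card {ddeg C D + g..N} \<le> card (pole_orders (W\<^sub>D C D N))"
    using dim_WD_ge[OF good, of N] N by simp
qed simp

lemma degree_list_interval:
  assumes "pole_orders V = {a..b}" "int i \<le> b - a"
  shows "degree_list V ! i = a + int i"
  using assms nth_upto[of a i b] unfolding degree_list_def by simp

lemma semi_typical_echelon_basis:
  assumes D: "semi_typical C g D" and N: "ddeg C D + g - 1 \<le> N" and bs: "echelon_basis C (W\<^sub>D C D N) bs"
  shows "int (length bs) = N - ddeg C D - g + 1"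
    "i < length bs \<Longrightarrow> bs ! i \<in> W\<^sub>D C D N \<and> pdeg C (bs ! i) = Fin (ddeg C D + g + int i)"
proof -
  have good: "good C D" using D by (simp add: semi_typical_def)
  show len: "int (length bs) = N - ddeg C D - g + 1"
    using echelon_basis_degrees(1)[OF fin_dim_WD[OF good] bs] semi_typical_pole_orders[OF D N] N by simp
  show "bs ! i \<in> W\<^sub>D C D N \<and> pdeg C (bs ! i) = Fin (ddeg C D + g + int i)" if "i < length bs"
  proof -
    have "int i \<le> N - (ddeg C D + g)" using that len by linarith
    then show ?thesis
      using echelon_basis_degrees(2)[OF fin_dim_WD[OF good] bs that]
        degree_list_interval[OF semi_typical_pole_orders[OF D N]] by simp
  qed
qed

lemma WD_exact: "good C D \<Longrightarrow> f \<in> W\<^sub>D C D N \<Longrightarrow> pdeg C f = Fin n \<Longrightarrow> f \<in> W\<^sub>D C D n"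
  by (simp add: pdeg_Fin WD_iff)

text \<open>
  Two functions of the minimal degree \<open>d + g\<close> differ, after scaling, by one of smaller degree, which vanishes.
\<close>

lemma semi_typical_line:
  assumes D: "semi_typical C g D" and s: "s \<in> W\<^sub>D C D (ddeg C D + g)" "pdeg C s = Fin (ddeg C D + g)"
    and r: "r \<in> W\<^sub>D C D (ddeg C D + g)"
  obtains c where "r = scl C c s"
proof (cases "r = 0")
  case True
  then show thesis using that[of 0] by (simp add: scl_def)
next
  case False
  have good: "good C D" using D by (simp add: semi_typical_def)
  have s0: "s \<noteq> 0" "- P s = ddeg C D + g" using s(2) by (simp_all add: pdeg_Fin)
  have "- P r \<le> ddeg C D + g" using r False WD_iff[OF good] by blast
  then have "P r = P s" using semi_typical_order[OF D r False] s0 by simp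
  then obtain c where c: "r - scl C c s = 0 \<or> P r < P (r - scl C c s)"
    using cancel_leading_term[OF False s0(1)] by blast
  have "r - scl C c s \<in> W\<^sub>D C D (ddeg C D + g)"
    by (rule K.subspace_diff[OF subspace_WD[OF good] r K.subspace_scale[OF subspace_WD[OF good] s(1)]])
  then have "r - scl C c s = 0" using semi_typical_order[OF D] c \<open>P r = P s\<close> s0(2) by fastforce
  then show thesis using that[of c] by simp
qed


subsection \<open>Typicality as linear independence\<close>

definition multiples :: "'f \<Rightarrow> 'f \<Rightarrow> 'f set" where
  "multiples s t = {s * a + t * b | a b. a \<in> W C (2 * g) \<and> b \<in> W C (2 * g - 1)}"

definition generated :: "int \<Rightarrow> 'f \<Rightarrow> 'f \<Rightarrow> 'f set" where
  "generated d s t = {s * a + t * b + c | a b c.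
     a \<in> W C (2 * g) \<and> b \<in> W C (2 * g - 1) \<and> c \<in> W C (d + g - 1)}"

text \<open>
  Injectivity of \<open>(a, b, c) \<mapsto> s a + t b + c\<close>; the third component is determined by the other two.
\<close>

definition no_relation :: "int \<Rightarrow> 'f \<Rightarrow> 'f \<Rightarrow> bool" where
  "no_relation d s t \<longleftrightarrow> (\<forall>a\<in>W C (2 * g). \<forall>b\<in>W C (2 * g - 1). \<forall>c\<in>W C (d + g - 1).
     s * a + t * b + c = 0 \<longrightarrow> a = 0 \<and> b = 0)"

lemma no_relationD:
  "no_relation d s t \<Longrightarrow> a \<in> W C (2 * g) \<Longrightarrow> b \<in> W C (2 * g - 1) \<Longrightarrow> c \<in> W C (d + g - 1) \<Longrightarrow>
     s * a + t * b + c = 0 \<Longrightarrow> a = 0 \<and> b = 0"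
  unfolding no_relation_def by blast

lemma multiples_sum: "multiples s t = {x + y | x y. x \<in> (*) s ` W C (2 * g) \<and> y \<in> (*) t ` W C (2 * g - 1)}"
  unfolding multiples_def by blast

lemma multiples_subset_WD:
  assumes D: "good C D" and s: "s \<in> W\<^sub>D C D (d + g)" and t: "t \<in> W\<^sub>D C D (d + g + 1)"
  shows "multiples s t \<subseteq> W\<^sub>D C D (d + 3 * g)"
proof
  fix x assume "x \<in> multiples s t"
  then obtain a b where x: "x = s * a + t * b" "a \<in> W C (2 * g)" "b \<in> W C (2 * g - 1)"
    unfolding multiples_def by blast
  have "s * a \<in> W\<^sub>D C D (d + 3 * g)" using WD_mult_W[OF D s x(2)] by (simp add: algebra_simps)
  moreover have "t * b \<in> W\<^sub>D C D (d + 3 * g)" using WD_mult_W[OF D t x(3)] by (simp add: algebra_simps)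
  ultimately show "x \<in> W\<^sub>D C D (d + 3 * g)" unfolding x(1) by (rule K.subspace_add[OF subspace_WD[OF D]])
qed

lemma generated_eq: "generated d s t = {x + c | x c. x \<in> multiples s t \<and> c \<in> W C (d + g - 1)}"
  unfolding generated_def multiples_def by blast

lemma generated_subset_W:
  assumes "s \<in> W C (d + g)" "t \<in> W C (d + g + 1)"
  shows "generated d s t \<subseteq> W C (d + 3 * g)"
proof -
  have "multiples s t \<subseteq> W C (d + 3 * g)"
    using multiples_subset_WD[OF good_0] assms unfolding W_eq_WD_0 by blast
  moreover have "W C (d + g - 1) \<subseteq> W C (d + 3 * g)" using g_pos by (intro W_mono) simp
  ultimately show ?thesis unfolding generated_eq using K.subspace_add[OF subspace_W] by blast
qed

lemma subspace_multiples: "K.subspace (multiples s t)"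
  unfolding multiples_sum by (intro K.subspace_sums subspace_mult_image subspace_W)

lemma dim_multiples:
  "K.fin_dim (multiples s t)"
  "K.dim (multiples s t) + K.dim ((*) s ` W C (2 * g) \<inter> (*) t ` W C (2 * g - 1)) =
     K.dim ((*) s ` W C (2 * g)) + K.dim ((*) t ` W C (2 * g - 1))"
  unfolding multiples_sum
  by (rule K.dim_sum_inter; intro subspace_mult_image fin_dim_mult_image subspace_W fin_dim_W)+

lemma no_relation_nonzero:
  assumes "no_relation d s t"
  shows "s \<noteq> 0" "t \<noteq> 0"
proof -
  show "s \<noteq> 0"
    using no_relationD[OF assms one_W W_0 W_0] g_pos by fastforce
  show "t \<noteq> 0"
    using no_relationD[OF assms W_0 one_W W_0] g_pos by fastforce
qed

lemma no_relation_dim_multiples: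
  assumes rel: "no_relation d s t"
  shows "int (K.dim (multiples s t)) = 2 * g + 1"
proof -
  note nz = no_relation_nonzero[OF rel]
  have "(*) s ` W C (2 * g) \<inter> (*) t ` W C (2 * g - 1) \<subseteq> {0}"
  proof
    fix x assume "x \<in> (*) s ` W C (2 * g) \<inter> (*) t ` W C (2 * g - 1)"
    then obtain a b where ab: "a \<in> W C (2 * g)" "b \<in> W C (2 * g - 1)" "x = s * a" "x = t * b" by blast
    have "s * a + t * (- b) + 0 = 0" using ab by simp
    then have "a = 0" using no_relationD[OF rel ab(1) K.subspace_neg[OF subspace_W ab(2)] W_0] by blast
    then show "x \<in> {0}" using ab by simp
  qed
  then have "K.dim ((*) s ` W C (2 * g) \<inter> (*) t ` W C (2 * g - 1)) = 0"
    using K.dim_le_card[of _ "{}"] by simp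
  then have "K.dim (multiples s t) = K.dim (W C (2 * g)) + K.dim (W C (2 * g - 1))"
    using dim_multiples(2)[of s t] nz by (simp add: dim_mult_image)
  then show ?thesis using dim_W[of "2 * g"] dim_W[of "2 * g - 1"] by simp
qed

text \<open>
  The dimensions \<open>g + 1\<close>, \<open>g\<close> and \<open>d\<close> of \<open>W\<^sup>2\<^sup>g\<close>, \<open>W\<^sup>2\<^sup>g\<^sup>-\<^sup>1\<close> and \<open>W\<^sup>d\<^sup>+\<^sup>g\<^sup>-\<^sup>1\<close> add up
  to the dimension of \<open>W\<^sup>d\<^sup>+\<^sup>3\<^sup>g\<close>, so that \<open>(a, b, c) \<mapsto> s a + t b + c\<close> is surjective onto that space iff
  it is injective.
\<close>

lemma generated_eq_W_iff:
  assumes d: "g \<le> d" and s: "s \<in> W C (d + g)" and t: "t \<in> W C (d + g + 1)"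
  shows "generated d s t = W C (d + 3 * g) \<longleftrightarrow> no_relation d s t"
proof -
  let ?S = "generated d s t" and ?Z = "W C (d + g - 1)" and ?V = "W C (d + 3 * g)"
  note dimS = K.dim_sum_inter(2)[OF subspace_multiples subspace_W dim_multiples(1) fin_dim_W,
      of s t "d + g - 1", folded generated_eq]
  have subS: "K.subspace ?S" unfolding generated_eq by (intro K.subspace_sums subspace_multiples subspace_W)
  note SV = generated_subset_W[OF s t]
  have dims: "int (K.dim (W C (2 * g))) = g + 1" "int (K.dim (W C (2 * g - 1))) = g"
    "int (K.dim ?Z) = d" "int (K.dim ?V) = d + 2 * g + 1"
    using dim_W[of "2 * g"] dim_W[of "2 * g - 1"] dim_W[of "d + g - 1"] dim_W[of "d + 3 * g"] d g_pos by simp_all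
  show ?thesis
  proof
    assume rel: "no_relation d s t"
    have "multiples s t \<inter> ?Z \<subseteq> {0}"
    proof
      fix x assume x: "x \<in> multiples s t \<inter> ?Z"
      then obtain a b where ab: "a \<in> W C (2 * g)" "b \<in> W C (2 * g - 1)" "x = s * a + t * b"
        unfolding multiples_def by blast
      have "- x \<in> ?Z" using x K.subspace_neg[OF subspace_W] by blast
      from no_relationD[OF rel ab(1,2) this] show "x \<in> {0}" using ab(3) by simp
    qed
    then have "K.dim (multiples s t \<inter> ?Z) = 0"
      using K.dim_le_card[of _ "{}"] by simp
    then have "int (K.dim ?V) \<le> int (K.dim ?S)"
      using dimS no_relation_dim_multiples[OF rel] dims by linarith
    then show "?S = ?V" using K.subspace_eq_of_dim_le[OF subS SV fin_dim_W] by simp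
  next
    assume eq: "?S = ?V"
    have le: "K.dim ((*) y ` V) \<le> K.dim V" for y V
    proof (cases "y = 0")
      case True
      then have "(*) y ` V \<subseteq> K.span {}" by auto
      then show ?thesis using K.dim_le_card[of _ "{}"] by simp
    qed (simp add: dim_mult_image)
    have "int (K.dim (multiples s t)) \<ge> 2 * g + 1" using dimS dims unfolding eq by linarith
    then have z: "K.dim ((*) s ` W C (2 * g) \<inter> (*) t ` W C (2 * g - 1)) = 0"
      and ds: "int (K.dim ((*) s ` W C (2 * g))) = g + 1" and dt: "int (K.dim ((*) t ` W C (2 * g - 1))) = g"
      and z': "K.dim (multiples s t \<inter> ?Z) = 0"
      using dim_multiples(2)[of s t] le[of s "W C (2 * g)"] le[of t "W C (2 * g - 1)"] dims dimS
      unfolding eq by linarith+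
    have trivial: "V = {0}" if "K.subspace V" "K.fin_dim V" "K.dim V = 0" for V
      using K.subspace_eq_of_dim_le[of "{0}" V] that K.subspace_0 by auto
    have i0: "(*) s ` W C (2 * g) \<inter> (*) t ` W C (2 * g - 1) = {0}"
      by (rule trivial[OF K.subspace_inter[OF subspace_mult_image[OF subspace_W] subspace_mult_image[OF subspace_W]]
        K.fin_dim_mono[OF Int_lower1 fin_dim_mult_image[OF fin_dim_W]] z])
    have i1: "multiples s t \<inter> ?Z = {0}"
      by (rule trivial[OF K.subspace_inter[OF subspace_multiples subspace_W]
        K.fin_dim_mono[OF Int_lower1 dim_multiples(1)] z'])
    have "s \<noteq> 0"
    proof
      assume "s = 0"
      then have "(*) s ` W C (2 * g) \<subseteq> K.span {}" by auto
      then have "K.dim ((*) s ` W C (2 * g)) = 0" using K.dim_le_card[of _ "{}"] by simp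
      then show False using ds g_pos by simp
    qed
    have "t \<noteq> 0"
    proof
      assume "t = 0"
      then have "(*) t ` W C (2 * g - 1) \<subseteq> K.span {}" by auto
      then have "K.dim ((*) t ` W C (2 * g - 1)) = 0" using K.dim_le_card[of _ "{}"] by simp
      then show False using dt g_pos by simp
    qed
    show "no_relation d s t"
      unfolding no_relation_def
    proof (intro ballI impI)
      fix a b c assume abc: "a \<in> W C (2 * g)" "b \<in> W C (2 * g - 1)" "c \<in> ?Z" "s * a + t * b + c = 0"
      have "s * a + t * b \<in> multiples s t" unfolding multiples_def using abc by blast
      moreover have "s * a + t * b = - c" using abc(4) by (simp add: eq_neg_iff_add_eq_0)
      then have "s * a + t * b \<in> ?Z" using K.subspace_neg[OF subspace_W abc(3)] by simp
      ultimately have "s * a + t * b = 0" using i1 by blast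
      then have e: "s * a = t * (- b)" by (simp add: eq_neg_iff_add_eq_0)
      have "s * a \<in> (*) s ` W C (2 * g)" using abc(1) by blast
      moreover have "s * a \<in> (*) t ` W C (2 * g - 1)"
        unfolding e using K.subspace_neg[OF subspace_W abc(2)] by blast
      ultimately have "s * a = 0" using i0 by blast
      then show "a = 0 \<and> b = 0" using e \<open>s \<noteq> 0\<close> \<open>t \<noteq> 0\<close> by simp
    qed
  qed
qed

lemma typical_iff:
  "typical C g D \<longleftrightarrow> good C D \<and> g \<le> ddeg C D \<and>
     (\<exists>s\<in>W\<^sub>D C D (ddeg C D + g). \<exists>t\<in>W\<^sub>D C D (ddeg C D + g + 1). no_relation (ddeg C D) s t)"
proof (cases "g \<le> ddeg C D")
  case True
  have "generated (ddeg C D) s t = W C (ddeg C D + 3 * g) \<longleftrightarrow> no_relation (ddeg C D) s t"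
    if "s \<in> W\<^sub>D C D (ddeg C D + g)" "t \<in> W\<^sub>D C D (ddeg C D + g + 1)" for s t
    using generated_eq_W_iff[OF True] that WD_subset_W by blast
  then show ?thesis unfolding typical_def generated_def[symmetric] by (simp cong: bex_cong)
qed (simp add: typical_def)

text \<open>
  If \<open>s\<close> had smaller degree, then \<open>s \<cdot> 1\<close> would lie in \<open>W\<^sup>d\<^sup>+\<^sup>g\<^sup>-\<^sup>1\<close>; if \<open>t\<close> had, then so would \<open>t\<close> minus a constant
  multiple of \<open>s\<close>.
\<close>

lemma no_relation_degrees:
  assumes rel: "no_relation d s t" and s: "s \<in> W C (d + g)" and t: "t \<in> W C (d + g + 1)"
  shows "pdeg C s = Fin (d + g)" "pdeg C t = Fin (d + g + 1)"
proof -
  note nz = no_relation_nonzero[OF rel]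
  have one: "1 \<in> W C (2 * g)" "1 \<in> W C (2 * g - 1)" using g_pos by (simp_all add: one_W)
  have "s \<notin> W C (d + g - 1)"
    using no_relationD[OF rel one(1) W_0, of "- s"] K.subspace_neg[OF subspace_W, of s] by auto
  then have s_deg: "- P s = d + g" using s W_iff[OF nz(1)] by fastforce
  then show "pdeg C s = Fin (d + g)" using nz by (simp add: pdeg_Fin)
  have "- P t \<noteq> d + g"
  proof
    assume "- P t = d + g"
    then have "P t = P s" using s_deg by simp
    then obtain c where c: "t - scl C c s = 0 \<or> P t < P (t - scl C c s)"
      using cancel_leading_term[OF nz(2,1)] by blast
    let ?r = "t - scl C c s"
    have "?r \<in> W C (d + g + 1)"
      using s t W_mono[of "d + g" "d + g + 1"]
      by (intro K.subspace_diff[OF subspace_W] K.subspace_scale[OF subspace_W]) auto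
    then have "?r \<in> W C (d + g - 1)"
      using c \<open>- P t = d + g\<close> W_0 by (cases "?r = 0") (auto simp: W_iff)
    then have "- ?r \<in> W C (d + g - 1)" by (rule K.subspace_neg[OF subspace_W])
    moreover have "s * (- emb C c) + t * 1 + - ?r = 0" by (simp add: scl_def algebra_simps)
    moreover have "- emb C c \<in> W C (2 * g)"
      using g_pos by (intro K.subspace_neg[OF subspace_W] const_W) simp
    ultimately show False using no_relationD[OF rel _ one(2)] by fastforce
  qed
  moreover have "t \<notin> W C (d + g - 1)"
    using no_relationD[OF rel W_0 one(2), of "- t"] K.subspace_neg[OF subspace_W, of t] by auto
  ultimately have "- P t = d + g + 1" using t W_iff[OF nz(2)] by fastforce
  then show "pdeg C t = Fin (d + g + 1)" using nz by (simp add: pdeg_Fin)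
qed

text \<open>By Riemann-Roch \<open>W\<^sup>d\<^sup>+\<^sup>3\<^sup>g\<^sub>D\<close> has dimension \<open>2g + 1\<close>, so the multiples of \<open>s\<close> and \<open>t\<close> fill it.\<close>

lemma multiples_eq_WD:
  assumes D: "good C D" and s: "s \<in> W\<^sub>D C D (ddeg C D + g)" and t: "t \<in> W\<^sub>D C D (ddeg C D + g + 1)"
    and rel: "no_relation (ddeg C D) s t"
  shows "multiples s t = W\<^sub>D C D (ddeg C D + 3 * g)"
proof (rule K.subspace_eq_of_dim_le[OF subspace_multiples multiples_subset_WD[OF D s t] fin_dim_WD[OF D]])
  have "int (K.dim (W\<^sub>D C D (ddeg C D + 3 * g))) = 2 * g + 1" using dim_WD[OF D] g_pos by simp
  then show "K.dim (W\<^sub>D C D (ddeg C D + 3 * g)) \<le> K.dim (multiples s t)"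
    using no_relation_dim_multiples[OF rel] by simp
qed

text \<open>
  An element of \<open>W\<^sup>d\<^sup>+\<^sup>g\<^sup>-\<^sup>1\<^sub>D\<close> is a combination \<open>s a + t b\<close> like every element of \<open>W\<^sup>d\<^sup>+\<^sup>3\<^sup>g\<^sub>D\<close>, and its small
  degree makes this a relation.
\<close>

lemma typical_imp_semi_typical:
  assumes "typical C g D"
  shows "semi_typical C g D"
proof -
  have D: "good C D" "g \<le> ddeg C D" using assms by (simp_all add: typical_def)
  obtain s t where st: "s \<in> W\<^sub>D C D (ddeg C D + g)" "t \<in> W\<^sub>D C D (ddeg C D + g + 1)"
    and rel: "no_relation (ddeg C D) s t"
    using assms unfolding typical_iff by blast
  have "u = 0" if u: "u \<in> W\<^sub>D C D (ddeg C D + g - 1)" for u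
  proof -
    have "u \<in> multiples s t"
      unfolding multiples_eq_WD[OF D(1) st rel] using u WD_mono[of "ddeg C D + g - 1" "ddeg C D + 3 * g"] g_pos by auto
    then obtain a b where ab: "u = s * a + t * b" "a \<in> W C (2 * g)" "b \<in> W C (2 * g - 1)"
      unfolding multiples_def by blast
    have "- u \<in> W C (ddeg C D + g - 1)" using u WD_subset_W K.subspace_neg[OF subspace_W] by blast
    from no_relationD[OF rel ab(2,3) this] show "u = 0" using ab(1) by simp
  qed
  then show ?thesis using D WD_0 unfolding semi_typical_def by blast
qed

text \<open>For a semi-typical divisor \<open>s\<close> is unique up to a constant and \<open>t\<close> up to a constant and a multiple of \<open>s\<close>, so
  typicality can be tested on any choice.\<close>

lemma typical_iff_no_relation:
  assumes D: "semi_typical C g D"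
    and s: "s \<in> W\<^sub>D C D (ddeg C D + g)" "pdeg C s = Fin (ddeg C D + g)"
    and t: "t \<in> W\<^sub>D C D (ddeg C D + g + 1)" "pdeg C t = Fin (ddeg C D + g + 1)"
  shows "typical C g D \<longleftrightarrow> no_relation (ddeg C D) s t"
proof
  assume "no_relation (ddeg C D) s t"
  then show "typical C g D" using D s(1) t(1) unfolding typical_iff semi_typical_def by blast
next
  assume tD: "typical C g D"
  let ?d = "ddeg C D"
  have good: "good C D" and d: "g \<le> ?d" using D by (simp_all add: semi_typical_def)
  obtain s' t' where st': "s' \<in> W\<^sub>D C D (?d + g)" "t' \<in> W\<^sub>D C D (?d + g + 1)"
    and rel: "no_relation ?d s' t'"
    using tD unfolding typical_iff by blast
  have deg': "pdeg C t' = Fin (?d + g + 1)"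
    using no_relation_degrees(2)[OF rel] st' WD_subset_W by blast
  obtain c where c: "s' = scl C c s" using semi_typical_line[OF D s st'(1)] .
  have "t' \<noteq> 0" "t \<noteq> 0" "P t' = P t" using deg' t(2) by (simp_all add: pdeg_Fin)
  then obtain e where e: "t' - scl C e t = 0 \<or> P t' < P (t' - scl C e t)"
    using cancel_leading_term by blast
  let ?r = "t' - scl C e t"
  have "?r \<in> W\<^sub>D C D (?d + g + 1)"
    by (rule K.subspace_diff[OF subspace_WD[OF good] st'(2) K.subspace_scale[OF subspace_WD[OF good] t(1)]])
  then have "?r \<in> W\<^sub>D C D (?d + g)"
    using e deg' WD_0 by (cases "?r = 0") (auto simp: WD_iff[OF good] pdeg_Fin)
  then obtain h where h: "?r = scl C h s" using semi_typical_line[OF D s] by blast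
  have sW: "s \<in> W C (?d + g)" "t \<in> W C (?d + g + 1)" "s' \<in> W C (?d + g)" "t' \<in> W C (?d + g + 1)"
    using s t st' WD_subset_W by blast+
  have "generated ?d s' t' \<subseteq> generated ?d s t"
  proof
    fix x assume "x \<in> generated ?d s' t'"
    then obtain a b u where x: "x = s' * a + t' * b + u"
      "a \<in> W C (2 * g)" "b \<in> W C (2 * g - 1)" "u \<in> W C (?d + g - 1)" unfolding generated_def by blast
    have "t' = scl C e t + scl C h s" using h by (simp add: algebra_simps)
    then have "x = s * (scl C c a + scl C h b) + t * scl C e b + u"
      unfolding x(1) c by (simp add: scl_def algebra_simps)
    moreover have "b \<in> W C (2 * g)" using x(3) W_mono[of "2 * g - 1" "2 * g"] by auto
    then have "scl C c a + scl C h b \<in> W C (2 * g)"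
      using x(2) by (intro K.subspace_add[OF subspace_W] K.subspace_scale[OF subspace_W])
    moreover have "scl C e b \<in> W C (2 * g - 1)" using x(3) by (rule K.subspace_scale[OF subspace_W])
    ultimately show "x \<in> generated ?d s t" unfolding generated_def using x(4) by blast
  qed
  then have "generated ?d s t = W C (?d + 3 * g)"
    using generated_subset_W[OF sW(1,2)] rel generated_eq_W_iff[OF d sW(3,4)] by blast
  then show "no_relation ?d s t" using generated_eq_W_iff[OF d sW(1,2)] by blast
qed


subsection \<open>Flipping\<close>

lemma subspace_flip_space: "K.subspace (flip_space C g d N s t)"
proof (rule K.subspaceI)
  show "0 \<in> flip_space C g d N s t" unfolding flip_space_def using W_0
    by (auto intro!: bexI[of _ 0])
next
  fix x y assume "x \<in> flip_space C g d N s t" "y \<in> flip_space C g d N s t"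
  then obtain a b a' b' where *: "x \<in> W C N" "a \<in> W C (N + 1)" "b \<in> W C (d + g - 1)" "x * t = s * a + b"
    "y \<in> W C N" "a' \<in> W C (N + 1)" "b' \<in> W C (d + g - 1)" "y * t = s * a' + b'"
    unfolding flip_space_def by blast
  have "(x + y) * t = s * (a + a') + (b + b')" using * by (simp add: algebra_simps)
  then show "x + y \<in> flip_space C g d N s t"
    unfolding flip_space_def using * K.subspace_add[OF subspace_W] by blast
next
  fix c x assume "x \<in> flip_space C g d N s t"
  then obtain a b where *: "x \<in> W C N" "a \<in> W C (N + 1)" "b \<in> W C (d + g - 1)" "x * t = s * a + b"
    unfolding flip_space_def by blast
  have "scl C c x * t = emb C c * (x * t)" by (simp add: scl_def mult.assoc)
  also have "\<dots> = s * scl C c a + scl C c b" unfolding *(4) by (simp add: scl_def algebra_simps)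
  finally show "scl C c x \<in> flip_space C g d N s t"
    unfolding flip_space_def using * K.subspace_scale[OF subspace_W] by blast
qed

lemma fin_dim_flip_space: "K.fin_dim (flip_space C g d N s t)"
  by (rule K.fin_dim_mono[OF _ fin_dim_W[of N]]) (auto simp: flip_space_def)

lemma degree_bound_quotient:
  assumes "s * a \<in> W C M" "a \<in> W C N" "s \<noteq> 0"
  shows "a \<in> W C (M + P s)"
proof (cases "a = 0")
  case False
  then have "- P (s * a) \<le> M" using assms by (auto simp: W_iff)
  then show ?thesis using assms False by (auto simp: W_iff v_mult[OF place_P])
qed (simp add: W_0)

text \<open>
  An element \<open>l\<close> of the flip space with \<open>deg l < 2g\<close> amounts to a relation: since \<open>deg s = d + g\<close> exactly, the cofactor
  \<open>a\<close> in \<open>l t = s a + b\<close> has degree at most \<open>2g\<close>, whatever bound \<open>N + 1\<close> was imposed on it.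
\<close>

lemma flip_space_trivial_iff:
  assumes s: "s \<in> W C (d + g)" "pdeg C s = Fin (d + g)" and t: "t \<in> W C (d + g + 1)"
    and N: "2 * g - 1 \<le> N"
  shows "flip_space C g d N s t \<inter> W C (2 * g - 1) = {0} \<longleftrightarrow> no_relation d s t"
proof
  assume rel: "no_relation d s t"
  have "l = 0" if l: "l \<in> flip_space C g d N s t" "l \<in> W C (2 * g - 1)" for l
  proof -
    obtain a b where ab: "a \<in> W C (N + 1)" "b \<in> W C (d + g - 1)" "l * t = s * a + b"
      using l(1) unfolding flip_space_def by blast
    have "t * l \<in> W C (d + 3 * g)" using W_mult[OF t l(2)] by (simp add: algebra_simps)
    moreover have "b \<in> W C (d + 3 * g)" using ab(2) W_mono[of "d + g - 1" "d + 3 * g"] g_pos by auto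
    ultimately have "t * l - b \<in> W C (d + 3 * g)" by (rule K.subspace_diff[OF subspace_W])
    then have "s * a \<in> W C (d + 3 * g)" using ab(3) by (simp add: algebra_simps)
    then have "a \<in> W C (d + 3 * g + P s)"
      using ab(1) s(2) by (intro degree_bound_quotient) (auto simp: pdeg_Fin)
    moreover have "d + 3 * g + P s = 2 * g" using s(2) by (auto simp: pdeg_Fin)
    ultimately have "a \<in> W C (2 * g)" by simp
    moreover have "- l \<in> W C (2 * g - 1)" using l(2) by (rule K.subspace_neg[OF subspace_W])
    moreover have "s * a + t * (- l) + b = 0" using ab(3) by (simp add: algebra_simps)
    ultimately show "l = 0" using no_relationD[OF rel _ _ ab(2)] by fastforce
  qed
  then show "flip_space C g d N s t \<inter> W C (2 * g - 1) = {0}"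
    using K.subspace_0[OF subspace_flip_space] W_0 by blast
next
  assume triv: "flip_space C g d N s t \<inter> W C (2 * g - 1) = {0}"
  show "no_relation d s t"
    unfolding no_relation_def
  proof (intro ballI impI)
    fix a b c assume abc: "a \<in> W C (2 * g)" "b \<in> W C (2 * g - 1)" "c \<in> W C (d + g - 1)" "s * a + t * b + c = 0"
    have e: "(- b) * t = s * a + c"
    proof -
      have "t * b = - (s * a + c)" using abc(4) by (simp add: eq_neg_iff_add_eq_0 algebra_simps)
      then show ?thesis by (simp add: mult.commute)
    qed
    have nb: "- b \<in> W C (2 * g - 1)" using abc(2) by (rule K.subspace_neg[OF subspace_W])
    have "- b \<in> W C N" using nb W_mono[OF N] by blast
    moreover have "a \<in> W C (N + 1)" using abc(1) W_mono[of "2 * g" "N + 1"] N by auto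
    ultimately have "- b \<in> flip_space C g d N s t" unfolding flip_space_def using e abc(3) by blast
    then have "- b \<in> {0}" unfolding triv[symmetric] using nb by (rule IntI)
    then have "b = 0" by simp
    then have "s * a = - c" using abc(4) by (simp add: eq_neg_iff_add_eq_0)
    then have "s * a \<in> W C (d + g - 1)" using K.subspace_neg[OF subspace_W abc(3)] by simp
    then have "a \<in> W C (d + g - 1 + P s)"
      using abc(1) s(2) by (intro degree_bound_quotient) (auto simp: pdeg_Fin)
    moreover have "d + g - 1 + P s = - 1" using s(2) by (auto simp: pdeg_Fin)
    ultimately have a: "a \<in> W C (- 1)" by simp
    have "a = 0" by (rule W_negative[OF a]) simp
    then show "a = 0 \<and> b = 0" using \<open>b = 0\<close> by simp
  qed
qed

text \<open>
  For \<open>l\<close> vanishing along \<open>A\<close> the function \<open>l t / s\<close> is regular away from \<open>P\<close>, so the flip space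
  contains \<open>W\<^sup>N\<^sub>A\<close>.  If the flip space has no element of degree less than \<open>2g\<close>, then its dimension
  does not exceed Riemann's lower bound for that of \<open>W\<^sup>N\<^sub>A\<close>.
\<close>

lemma flip_result:
  assumes D: "good C D" and s: "s \<in> W\<^sub>D C D (ddeg C D + g)" "pdeg C s = Fin (ddeg C D + g)"
    and t: "t \<in> W\<^sub>D C D (ddeg C D + g + 1)" and A: "good C A" "adiv C s = D + A" "ddeg C A = g"
    and N: "2 * g - 1 \<le> N"
    and triv: "flip_space C g (ddeg C D) N s t \<inter> W C (2 * g - 1) = {0}"
  shows "semi_typical C g A" "flip_space C g (ddeg C D) N s t = W\<^sub>D C A N"
proof -
  let ?d = "ddeg C D" and ?F = "flip_space C g (ddeg C D) N s t"
  have s0: "s \<noteq> 0" "P s = - (?d + g)" using s(2) by (auto simp: pdeg_Fin)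
  have sub: "W\<^sub>D C A N \<subseteq> ?F"
  proof
    fix l assume l: "l \<in> W\<^sub>D C A N"
    let ?a = "l * t / s"
    have "s * ?a \<in> W\<^sub>D C (D + A) (N + (?d + g + 1))"
      using WD_mult[OF A(1) D l t] s0(1) by (simp add: add.commute)
    moreover have "s * ?a \<in> W\<^sub>D C (D + A) (N + (?d + g + 1)) \<longleftrightarrow> ?a \<in> W\<^sub>D C 0 (N + 1)"
      using s0 A(2) by (intro WD_shift_iff good_0 good_add D A(1)) auto
    ultimately have "?a \<in> W C (N + 1)" unfolding W_eq_WD_0 by blast
    moreover have "l * t = s * ?a + 0" using s0(1) by simp
    moreover have "l \<in> W C N" using l WD_subset_W by blast
    ultimately show "l \<in> ?F" unfolding flip_space_def using W_0 by blast
  qed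
  have "W\<^sub>D C A (2 * g - 1) \<subseteq> ?F \<inter> W C (2 * g - 1)"
    using sub WD_mono[OF N] WD_subset_W by blast
  then have "W\<^sub>D C A (2 * g - 1) = {0}" unfolding triv using WD_0 by blast
  moreover have "g + g - 1 = 2 * g - 1" by simp
  ultimately show "semi_typical C g A" using A by (simp add: semi_typical_def)
  have "pole_orders ?F \<subseteq> {2 * g..N}"
  proof
    fix n assume "n \<in> pole_orders ?F"
    then obtain f where f: "f \<in> ?F" "f \<noteq> 0" "n = - P f" unfolding pole_orders_def by blast
    then have "f \<notin> W C (2 * g - 1)" using triv by blast
    moreover have "f \<in> W C N" using f(1) by (simp add: flip_space_def)
    ultimately show "n \<in> {2 * g..N}" using f(2,3) by (auto simp: W_iff)
  qed
  then have "card (pole_orders ?F) \<le> card {2 * g..N}" by (intro card_mono) simp_all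
  then have "int (K.dim ?F) \<le> N - 2 * g + 1"
    using N by (simp add: card_pole_orders[OF subspace_flip_space fin_dim_flip_space])
  then have "K.dim ?F \<le> K.dim (W\<^sub>D C A N)" using dim_WD_ge[OF A(1), of N] A(3) by simp
  then show "?F = W\<^sub>D C A N"
    using K.subspace_eq_of_dim_le[OF subspace_WD[OF A(1)] sub fin_dim_flip_space] by simp
qed

end

section \<open>The procedures\<close>

lemma succeeds_iff_and_then:
  assumes R: "succeeds_iff R Q" and k: "\<And>x. Some x \<in> R \<Longrightarrow> succeeds_iff (k x) T" and TQ: "T \<Longrightarrow> Q"
  shows "succeeds_iff (and_then R k) T"
  unfolding succeeds_iff_def
proof
  have ne: "R \<noteq> {}" and R': "\<And>r. r \<in> R \<Longrightarrow> r \<noteq> None \<longleftrightarrow> Q" using R by (auto simp: succeeds_iff_def)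
  then obtain r where r: "r \<in> R" by blast
  show "and_then R k \<noteq> {}"
  proof (cases r)
    case None
    then have "None \<in> and_then R k" using r by (force simp: and_then_def)
    then show ?thesis by blast
  next
    case (Some x)
    then obtain z where "z \<in> k x" using k r unfolding succeeds_iff_def by blast
    then have "z \<in> and_then R k" using r Some by (force simp: and_then_def)
    then show ?thesis by blast
  qed
  show "\<forall>z\<in>and_then R k. (z \<noteq> None) = T"
  proof
    fix z assume "z \<in> and_then R k"
    then obtain r where r: "r \<in> R" "z \<in> (case r of None \<Rightarrow> {None} | Some x \<Rightarrow> k x)"
      by (auto simp: and_then_def)
    show "(z \<noteq> None) = T"
    proof (cases r)
      case None
      then show ?thesis using r R'[OF r(1)] TQ by auto
    next
      case (Some x)
      then show ?thesis using r k[of x] by (auto simp: succeeds_iff_def)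
    qed
  qed
qed

lemma Some_and_then: "Some z \<in> and_then R k \<longleftrightarrow> (\<exists>x. Some x \<in> R \<and> Some z \<in> k x)"
  by (auto simp: and_then_def split: option.splits)

lemma Some_flip_first_two:
  "Some r \<in> flip_first_two C g d xs \<longleftrightarrow>
     (\<exists>cs. r = (cs, xs ! 0, xs ! 1) \<and> Some cs \<in> flip_proc C g d (3 * g + 1) (xs ! 0) (xs ! 1))"
  by (auto simp: flip_first_two_def Some_and_then)

lemma flip_first_two_succeeds:
  "succeeds_iff (flip_proc C g d (3 * g + 1) (xs ! 0) (xs ! 1)) T \<Longrightarrow> succeeds_iff (flip_first_two C g d xs) T"
  unfolding flip_first_two_def
proof (rule succeeds_iff_and_then)
  fix x assume "succeeds_iff (flip_proc C g d (3 * g + 1) (xs ! 0) (xs ! 1)) T"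
    "Some x \<in> flip_proc C g d (3 * g + 1) (xs ! 0) (xs ! 1)"
  then have T unfolding succeeds_iff_def by blast
  then show "succeeds_iff {Some (x, xs ! 0, xs ! 1)} T" by (simp add: succeeds_iff_def)
qed

context pointed_curve
begin

lemma echelon_basis_span: "echelon_basis C V bs \<Longrightarrow> kspan C (set bs) = V"
  by (simp add: echelon_basis_def)

lemma WD_inter_W: "good C D \<Longrightarrow> M \<le> N \<Longrightarrow> W\<^sub>D C D N \<inter> W C M = W\<^sub>D C D M"
  using W_mono[of M N] unfolding W\<^sub>D_def by blast


subsection \<open>The flipping procedure\<close>

lemma Some_flip_proc:
  "Some cs \<in> flip_proc C g d N s t \<longleftrightarrow>
     flip_space C g d N s t \<inter> W C (2 * g - 1) = {0} \<and> echelon_basis C (flip_space C g d N s t) cs"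
  by (auto simp: flip_proc_def Let_def)

lemma flip_proc_succeeds:
  assumes "flip_space C g d N s t \<inter> W C (2 * g - 1) = {0} \<longleftrightarrow> T"
  shows "succeeds_iff (flip_proc C g d N s t) T"
proof -
  obtain cs where "echelon_basis C (flip_space C g d N s t) cs"
    using echelon_basis_exists[OF subspace_flip_space fin_dim_flip_space] by blast
  then show ?thesis using assms unfolding succeeds_iff_def flip_proc_def Let_def by auto
qed

text \<open>The flip tests the independence of the multiples of \<open>s\<close> and \<open>t\<close>, and for a semi-typical divisor this decides
  typicality.\<close>

lemma flip_step:
  assumes D: "semi_typical C g D"
    and s: "s \<in> W\<^sub>D C D (ddeg C D + g)" "pdeg C s = Fin (ddeg C D + g)"
    and t: "t \<in> W\<^sub>D C D (ddeg C D + g + 1)" "pdeg C t = Fin (ddeg C D + g + 1)"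
  obtains A where "good C A" "ddeg C A = g" "adiv C s = D + A"
    "succeeds_iff (flip_proc C g (ddeg C D) (3 * g + 1) s t) (typical C g D)"
    "\<forall>cs. Some cs \<in> flip_proc C g (ddeg C D) (3 * g + 1) s t \<longrightarrow>
       typical C g D \<and> semi_typical C g A \<and> echelon_basis C (W\<^sub>D C A (3 * g + 1)) cs"
proof -
  have good: "good C D" using D by (simp add: semi_typical_def)
  have s0: "s \<noteq> 0" "- P s = ddeg C D + g" using s(2) by (simp_all add: pdeg_Fin)
  obtain A where A: "good C A" "adiv C s = D + A" "ddeg C A = - P s - ddeg C D"
    using complementary_divisor[OF good s(1) s0(1)] .
  have dA: "ddeg C A = g" using A(3) s0(2) by simp
  have N: "2 * g - 1 \<le> 3 * g + 1" using g_pos by simp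
  have triv: "flip_space C g (ddeg C D) (3 * g + 1) s t \<inter> W C (2 * g - 1) = {0} \<longleftrightarrow> typical C g D"
    unfolding typical_iff_no_relation[OF D s t]
    using s t WD_subset_W by (intro flip_space_trivial_iff[OF _ s(2) _ N]) auto
  show thesis
  proof (rule that[OF A(1) dA A(2) flip_proc_succeeds[OF triv]], intro allI impI)
    fix cs assume cs: "Some cs \<in> flip_proc C g (ddeg C D) (3 * g + 1) s t"
    then have z: "flip_space C g (ddeg C D) (3 * g + 1) s t \<inter> W C (2 * g - 1) = {0}"
      unfolding Some_flip_proc by blast
    note F = flip_result[OF good s t(1) A(1,2) dA N z]
    have "echelon_basis C (W\<^sub>D C A (3 * g + 1)) cs" using cs unfolding Some_flip_proc F(2) by blast
    then show "typical C g D \<and> semi_typical C g A \<and> echelon_basis C (W\<^sub>D C A (3 * g + 1)) cs"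
      using F(1) z triv by blast
  qed
qed

lemma valid_triple_flip:
  assumes "typical C g D" "ddeg C D \<in> {g, 2 * g}" "semi_typical C g A" "ddeg C A = g"
    "echelon_basis C (W\<^sub>D C A (3 * g + 1)) cs"
    "s \<in> W\<^sub>D C D (ddeg C D + g)" "pdeg C s = Fin (ddeg C D + g)"
    "t \<in> W\<^sub>D C D (ddeg C D + g + 1)" "pdeg C t = Fin (ddeg C D + g + 1)" "adiv C s = D + A"
  shows "valid_triple C g D A (cs, s, t)"
  using assms by (simp add: valid_triple_def add.commute)

lemma first_two:
  assumes D: "semi_typical C g D" and N: "ddeg C D + g + 1 \<le> N" and xs: "echelon_basis C (W\<^sub>D C D N) xs"
  shows "2 \<le> length xs" "xs ! 0 \<in> W\<^sub>D C D (ddeg C D + g)" "pdeg C (xs ! 0) = Fin (ddeg C D + g)"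
    "xs ! 1 \<in> W\<^sub>D C D (ddeg C D + g + 1)" "pdeg C (xs ! 1) = Fin (ddeg C D + g + 1)"
proof -
  have good: "good C D" using D by (simp add: semi_typical_def)
  have N': "ddeg C D + g - 1 \<le> N" using N by simp
  show len: "2 \<le> length xs" using semi_typical_echelon_basis(1)[OF D N' xs] N by simp
  have "0 < length xs" "1 < length xs" using len by linarith+
  then have *: "xs ! 0 \<in> W\<^sub>D C D N \<and> pdeg C (xs ! 0) = Fin (ddeg C D + g + int 0)"
    "xs ! 1 \<in> W\<^sub>D C D N \<and> pdeg C (xs ! 1) = Fin (ddeg C D + g + int 1)"
    using semi_typical_echelon_basis(2)[OF D N' xs] by blast+
  then show "pdeg C (xs ! 0) = Fin (ddeg C D + g)" "pdeg C (xs ! 1) = Fin (ddeg C D + g + 1)" by simp_all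
  then show "xs ! 0 \<in> W\<^sub>D C D (ddeg C D + g)" "xs ! 1 \<in> W\<^sub>D C D (ddeg C D + g + 1)"
    using * WD_exact[OF good] by blast+
qed


subsection \<open>Least common multiples of divisors, and the intersection procedure\<close>

definition lcm_div :: "'f divisor \<Rightarrow> 'f divisor \<Rightarrow> 'f divisor" where
  "lcm_div D E = (\<lambda>v. max (D v) (E v))"

definition gcd_div :: "'f divisor \<Rightarrow> 'f divisor \<Rightarrow> 'f divisor" where
  "gcd_div D E = (\<lambda>v. min (D v) (E v))"

lemma good_gcd:
  assumes "good C D" "good C E"
  shows "good C (gcd_div D E)"
proof -
  have "{v. gcd_div D E v \<noteq> 0} \<subseteq> {v. D v \<noteq> 0} \<union> {v. E v \<noteq> 0}" by (auto simp: gcd_div_def)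
  moreover have "is_place C v" if "gcd_div D E v \<noteq> 0" for v
  proof -
    have "D v \<noteq> 0 \<or> E v \<noteq> 0" using that by (auto simp: gcd_div_def)
    then show ?thesis using assms unfolding good_def divisor_def by blast
  qed
  ultimately have "divisor C (gcd_div D E)"
    using assms unfolding good_def divisor_def by (meson finite_UnI finite_subset)
  then show ?thesis using assms by (auto simp: good_def gcd_div_def le_fun_def)
qed

lemma lcm_eq: "lcm_div D E = D + E - gcd_div D E"
  by (rule ext) (auto simp: lcm_div_def gcd_div_def)

lemma good_lcm:
  assumes "good C D" "good C E"
  shows "good C (lcm_div D E)" "ddeg C (lcm_div D E) = ddeg C D + ddeg C E - ddeg C (gcd_div D E)"
proof -
  note g = good_divisor[OF assms(1)] good_divisor[OF assms(2)] good_divisor[OF good_gcd[OF assms]]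
  have "divisor C (lcm_div D E)" unfolding lcm_eq using g by (intro divisor_diff divisor_add)
  then show "good C (lcm_div D E)" using assms by (auto simp: good_def lcm_div_def le_fun_def le_max_iff_disj)
  show "ddeg C (lcm_div D E) = ddeg C D + ddeg C E - ddeg C (gcd_div D E)"
    unfolding lcm_eq using g by (simp add: ddeg_diff ddeg_add divisor_add)
qed

lemma WD_inter:
  assumes "good C D" "good C E"
  shows "W\<^sub>D C D N \<inter> W\<^sub>D C E N = W\<^sub>D C (lcm_div D E) N"
proof (rule Set.set_eqI)
  fix f show "f \<in> W\<^sub>D C D N \<inter> W\<^sub>D C E N \<longleftrightarrow> f \<in> W\<^sub>D C (lcm_div D E) N"
  proof (cases "f = 0")
    case False
    show ?thesis
      unfolding Int_iff WD_iff[OF assms(1) False] WD_iff[OF assms(2) False] WD_iff[OF good_lcm(1)[OF assms] False]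
      by (auto simp: lcm_div_def)
  qed (simp add: WD_0)
qed

lemma disjoint_div_iff:
  assumes "good C D" "good C E"
  shows "disjoint_div D E \<longleftrightarrow> gcd_div D E = 0"
proof -
  have "D v \<noteq> 0 \<and> E v \<noteq> 0 \<longleftrightarrow> gcd_div D E v \<noteq> 0" for v
  proof -
    have "0 \<le> D v" "0 \<le> E v" using assms by (simp_all add: good_def le_fun_def)
    then show ?thesis by (auto simp: gcd_div_def)
  qed
  then show ?thesis unfolding disjoint_div_def by (auto simp: fun_eq_iff)
qed

lemma lcm_disjoint: "good C D \<Longrightarrow> good C E \<Longrightarrow> disjoint_div D E \<Longrightarrow> lcm_div D E = D + E"
  by (simp add: lcm_eq disjoint_div_iff)

text \<open>If \<open>D\<close> and \<open>D'\<close> have a common point, then their least common multiple has degree less than \<open>2g\<close>, and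
  Riemann's inequality gives a nonzero element of \<open>W\<^sup>3\<^sup>g\<^sup>-\<^sup>1\<close> that vanishes along it.\<close>

lemma intersection_trivial_iff:
  assumes D: "good C D" "ddeg C D = g" and D': "good C D'" "ddeg C D' = g"
  shows "W\<^sub>D C D (3 * g - 1) \<inter> W\<^sub>D C D' (3 * g - 1) = {0} \<longleftrightarrow>
    disjoint_div D D' \<and> semi_typical C g (D + D')"
proof (cases "disjoint_div D D'")
  case True
  have "ddeg C (D + D') = 2 * g" using D D' by (simp add: ddeg_add good_divisor)
  moreover have "2 * g + g - 1 = 3 * g - 1" by simp
  ultimately show ?thesis
    using True D D' g_pos by (simp add: WD_inter lcm_disjoint semi_typical_def good_add)
next
  case False
  let ?G = "gcd_div D D'"
  have G: "good C ?G" using D D' by (simp add: good_gcd)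
  have "?G \<noteq> 0" using False D D' by (simp add: disjoint_div_iff)
  then have "ddeg C ?G \<noteq> 0" using effective_ddeg_0 G unfolding good_def by blast
  then have "1 \<le> ddeg C ?G" using ddeg_nonneg[of ?G] G unfolding good_def by auto
  then have "1 \<le> int (K.dim (W\<^sub>D C (lcm_div D D') (3 * g - 1)))"
    using dim_WD_ge[OF good_lcm(1)[OF D(1) D'(1)], of "3 * g - 1"] good_lcm(2)[OF D(1) D'(1)] D D' by simp
  then have "W\<^sub>D C (lcm_div D D') (3 * g - 1) \<noteq> {0}"
    using K.dim_le_card[of "{0}" "{}"] by auto
  then show ?thesis using False D D' by (simp add: WD_inter)
qed

lemma intersection_proc_correct:
  assumes D: "good C D" "ddeg C D = g" "echelon_basis C (W\<^sub>D C D (3 * g + 1)) bs"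
    and D': "good C D'" "ddeg C D' = g" "echelon_basis C (W\<^sub>D C D' (3 * g + 1)) bs'"
  shows "succeeds_iff (intersection_proc C g bs bs') (disjoint_div D D' \<and> semi_typical C g (D + D'))"
    "Some xs \<in> intersection_proc C g bs bs' \<Longrightarrow>
       disjoint_div D D' \<and> semi_typical C g (D + D') \<and> echelon_basis C (W\<^sub>D C (D + D') (3 * g + 1)) xs"
proof -
  let ?V = "W\<^sub>D C D (3 * g + 1) \<inter> W\<^sub>D C D' (3 * g + 1)"
  have proc: "intersection_proc C g bs bs' =
      (if disjoint_div D D' \<and> semi_typical C g (D + D') then {Some cs | cs. echelon_basis C ?V cs} else {None})"
    unfolding intersection_proc_def Let_def echelon_basis_span[OF D(3)] echelon_basis_span[OF D'(3)]
    using D D' by (simp add: WD_inter_W intersection_trivial_iff)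
  have V: "?V = W\<^sub>D C (lcm_div D D') (3 * g + 1)" using D D' by (simp add: WD_inter)
  obtain cs where "echelon_basis C ?V cs"
    unfolding V using echelon_basis_exists[OF subspace_WD fin_dim_WD] good_lcm(1)[OF D(1) D'(1)] by blast
  then show "succeeds_iff (intersection_proc C g bs bs') (disjoint_div D D' \<and> semi_typical C g (D + D'))"
    unfolding succeeds_iff_def proc by auto
  show "disjoint_div D D' \<and> semi_typical C g (D + D') \<and> echelon_basis C (W\<^sub>D C (D + D') (3 * g + 1)) xs"
    if "Some xs \<in> intersection_proc C g bs bs'"
    using that lcm_disjoint[OF D(1) D'(1)] unfolding proc V by (auto split: if_splits)
qed


subsection \<open>The combined flip-and-double procedure\<close>

lemma independent_coeffs:
  assumes "K.independent (set xs)" "distinct xs" "(\<Sum>i<length xs. scl C (c i) (xs ! i)) = 0" "i < length xs"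
  shows "c i = 0"
proof -
  have bij: "bij_betw ((!) xs) {..<length xs} (set xs)" using assms(2) by (simp add: bij_betw_nth)
  let ?i = "the_inv_into {..<length xs} ((!) xs)"
  have inv: "?i (xs ! j) = j" if "j < length xs" for j
    using bij that by (simp add: bij_betw_def the_inv_into_f_f)
  have "(\<Sum>x\<in>set xs. scl C (c (?i x)) x) = (\<Sum>j<length xs. scl C (c (?i (xs ! j))) (xs ! j))"
    using sum.reindex_bij_betw[OF bij, of "\<lambda>x. scl C (c (?i x)) x"] by simp
  also have "\<dots> = 0" using assms(3) by (simp add: inv)
  finally have "(\<Sum>x\<in>set xs. scl C (c (?i x)) x) = 0" .
  then have "c (?i (xs ! i)) = 0"
    by (rule K.independentD[OF assms(1) finite_set order_refl]) (rule nth_mem[OF assms(4)])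
  then show ?thesis using inv[OF assms(4)] by simp
qed

lemma sum_lessThan_add:
  fixes f :: "nat \<Rightarrow> 'b::comm_monoid_add"
  shows "(\<Sum>i<m + n. f i) = (\<Sum>i<m. f i) + (\<Sum>i<n. f (m + i))"
  by (induct n) (simp_all add: add.assoc)

text \<open>
  A linear relation among the products is a relation \<open>s a + t b + c = 0\<close> in which \<open>a\<close> and \<open>b\<close> are arbitrary combinations
  of the two bases.
\<close>

lemma indep_mod_of_no_relation:
  assumes rel: "no_relation d s t"
    and ms: "echelon_basis C (W C (2 * g)) ms" and ms': "echelon_basis C (W C (2 * g - 1)) ms'"
  shows "indep_mod C (W C (d + g - 1)) (map ((*) s) ms @ map ((*) t) ms')"
  unfolding indep_mod_def
proof (intro allI impI)
  fix c i
  let ?xs = "map ((*) s) ms @ map ((*) t) ms'" and ?n = "length ms"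
  assume sum: "(\<Sum>i<length ?xs. scl C (c i) (?xs ! i)) \<in> W C (d + g - 1)" and i: "i < length ?xs"
  let ?a = "\<Sum>i<length ms. scl C (c i) (ms ! i)" and ?b = "\<Sum>i<length ms'. scl C (c (?n + i)) (ms' ! i)"
  have "(\<Sum>i<length ?xs. scl C (c i) (?xs ! i)) =
      (\<Sum>i<?n. scl C (c i) (?xs ! i)) + (\<Sum>i<length ms'. scl C (c (?n + i)) (?xs ! (?n + i)))"
    by (simp only: length_append length_map sum_lessThan_add)
  also have "\<dots> = s * ?a + t * ?b" by (simp add: scl_sum nth_append)
  finally have "s * ?a + t * ?b \<in> W C (d + g - 1)" using sum by simp
  then have neg: "- (s * ?a + t * ?b) \<in> W C (d + g - 1)" by (rule K.subspace_neg[OF subspace_W])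
  have "set ms \<subseteq> W C (2 * g)" "set ms' \<subseteq> W C (2 * g - 1)"
    using ms ms' K.span_superset unfolding echelon_basis_def kspan_def by blast+
  then have "?a \<in> W C (2 * g)" "?b \<in> W C (2 * g - 1)"
    by (auto intro!: K.subspace_sum[OF subspace_W] K.subspace_scale[OF subspace_W])
  then have ab: "?a = 0" "?b = 0" using no_relationD[OF rel _ _ neg] by auto
  have ind: "K.independent (set ms)" "K.independent (set ms')" using ms ms' by (simp_all add: echelon_basis_def kindep_def)
  show "c i = 0"
  proof (cases "i < ?n")
    case True
    then show ?thesis by (rule independent_coeffs[OF ind(1) echelon_basis_distinct[OF ms] ab(1)])
  next
    case False
    then have "i - ?n < length ms'" using i by simp
    then have "c (?n + (i - ?n)) = 0"
      by (rule independent_coeffs[where c = "\<lambda>i. c (?n + i)", OF ind(2) echelon_basis_distinct[OF ms'] ab(2)])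
    then show ?thesis using False by simp
  qed
qed

end

text \<open>
  A typical divisor \<open>Dt\<close> with generators \<open>st\<close>, \<open>tt\<close>, whose residual divisors are \<open>D\<close> and \<open>E\<close>.
  Multiplication by \<open>y = - tt / st\<close> carries functions vanishing along \<open>D\<close> to functions vanishing along \<open>E\<close>.
\<close>

locale flip_pair = pointed_curve C g for C :: "('k::field, 'f::field) pcurve" and g :: int +
  fixes Dt D :: "'f divisor" and st tt :: 'f
  assumes typical: "typical C g Dt"
    and D: "semi_typical C g D" "ddeg C D = g"
    and st: "st \<in> W\<^sub>D C Dt (ddeg C Dt + g)" "pdeg C st = Fin (ddeg C Dt + g)"
    and tt: "tt \<in> W\<^sub>D C Dt (ddeg C Dt + g + 1)" "pdeg C tt = Fin (ddeg C Dt + g + 1)"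
    and residual: "adiv C st = D + Dt"
begin

lemma good_Dt: "good C Dt"
  using typical by (simp add: typical_def)

lemma good_D: "good C D"
  using D by (simp add: semi_typical_def)

lemma rel: "no_relation (ddeg C Dt) st tt"
  using typical typical_iff_no_relation[OF typical_imp_semi_typical[OF typical] st tt] by blast

lemma st_nz: "st \<noteq> 0" "P st = - (ddeg C Dt + g)" and tt_nz: "tt \<noteq> 0" "P tt = - (ddeg C Dt + g + 1)"
  using st(2) tt(2) by (auto simp: pdeg_Fin)

definition E where "E = adiv C tt - Dt"

definition y where "y = - tt / st"

lemma good_E: "good C E" and adiv_tt: "adiv C tt = Dt + E" and ddeg_E: "ddeg C E = g + 1"
proof -
  obtain A where A: "good C A" "adiv C tt = Dt + A" "ddeg C A = - P tt - ddeg C Dt"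
    using complementary_divisor[OF good_Dt tt(1) tt_nz(1)] .
  then have "A = E" by (simp add: E_def)
  then show "good C E" "adiv C tt = Dt + E" "ddeg C E = g + 1" using A tt_nz by simp_all
qed

lemma y_nz: "y \<noteq> 0" and P_y: "P y = - 1" and adiv_y: "adiv C y = E - D"
proof -
  show "y \<noteq> 0" using st_nz tt_nz by (simp add: y_def)
  show "P y = - 1" unfolding y_def using st_nz tt_nz by (simp add: v_divide[OF place_P] v_minus[OF place_P])
  show "adiv C y = E - D"
  proof -
    have "y = - (tt / st)" by (simp add: y_def)
    then have "adiv C y = Dt + E - (D + Dt)"
      by (simp only: adiv_minus adiv_divide[OF tt_nz(1) st_nz(1)] adiv_tt residual)
    then show ?thesis by (simp add: fun_eq_iff)
  qed
qed

lemma y_shift: "y * l \<in> W\<^sub>D C E (N + 1) \<longleftrightarrow> l \<in> W\<^sub>D C D N"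
  by (rule WD_shift_iff[OF good_D good_E y_nz adiv_y]) (simp add: P_y)

lemma y_relation: "st * (y * l) = - (tt * l)"
  using st_nz by (simp add: y_def)

text \<open>
  The first components form a flip space of \<open>Dt\<close> with the bound \<open>N + 1\<close>, which is \<open>W\<^sup>N\<^sup>+\<^sup>1\<^sub>D\<close> as \<open>Dt\<close> is typical.
  The second component is determined by the first, because multiplication by \<open>st\<close> raises degrees above
  \<open>d + g - 1\<close>.
\<close>

lemma pair_space_eq:
  assumes N: "2 * g - 1 \<le> N"
  shows "pair_space C g (ddeg C Dt) N st tt = (\<lambda>l. (l, y * l)) ` W\<^sub>D C D (N + 1)"
proof -
  let ?d = "ddeg C Dt"
  have N1: "2 * g - 1 \<le> N + 1" using N by simp
  have "flip_space C g ?d (N + 1) st tt \<inter> W C (2 * g - 1) = {0}"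
    using flip_space_trivial_iff[OF _ st(2) _ N1] st(1) tt(1) WD_subset_W rel by blast
  moreover have "adiv C st = Dt + D" using residual by (simp add: add.commute)
  ultimately have flip: "flip_space C g ?d (N + 1) st tt = W\<^sub>D C D (N + 1)"
    using flip_result(2)[OF good_Dt st tt(1) good_D _ D(2) N1] by blast
  show ?thesis
  proof (intro equalityI subsetI)
    fix p assume "p \<in> pair_space C g ?d N st tt"
    then obtain l l' where p: "p = (l, l')" "l \<in> W C (N + 1)" "l' \<in> W C (N + 2)"
      "tt * l + st * l' \<in> W C (?d + g - 1)" unfolding pair_space_def by blast
    have "l * tt = st * (- l') + (tt * l + st * l')" by (simp add: mult.commute)
    moreover have "- l' \<in> W C (N + 1 + 1)" using K.subspace_neg[OF subspace_W p(3)] by (simp add: add.assoc)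
    ultimately have "l \<in> flip_space C g ?d (N + 1) st tt" unfolding flip_space_def using p(2,4) by blast
    then have l: "l \<in> W\<^sub>D C D (N + 1)" unfolding flip .
    then have "y * l \<in> W C (N + 1 + 1)" using y_shift WD_subset_W by blast
    then have "l' - y * l \<in> W C (N + 2)" using p(3) by (intro K.subspace_diff[OF subspace_W]) (simp_all add: add.assoc)
    moreover have "st * (l' - y * l) = tt * l + st * l'" by (simp add: right_diff_distrib y_relation)
    then have "st * (l' - y * l) \<in> W C (?d + g - 1)" using p(4) by simp
    ultimately have "l' - y * l \<in> W C (?d + g - 1 + P st)" using st_nz(1) by (intro degree_bound_quotient)
    then have "l' - y * l = 0" by (rule W_negative) (simp add: st_nz(2))
    then have "p = (l, y * l)" using p(1) by simp
    then show "p \<in> (\<lambda>l. (l, y * l)) ` W\<^sub>D C D (N + 1)" using l by (rule image_eqI)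
  next
    fix p assume "p \<in> (\<lambda>l. (l, y * l)) ` W\<^sub>D C D (N + 1)"
    then obtain l where l: "p = (l, y * l)" "l \<in> W\<^sub>D C D (N + 1)" by blast
    have "y * l \<in> W C (N + 1 + 1)" using l(2) y_shift WD_subset_W by blast
    moreover have "tt * l + st * (y * l) = 0" by (simp add: y_relation)
    ultimately show "p \<in> pair_space C g ?d N st tt"
      unfolding pair_space_def using l WD_subset_W W_0[of "?d + g - 1"] by (auto simp: add.assoc)
  qed
qed

lemma linear_graph: "Vector_Spaces.linear (scl C) (scl2 C) (\<lambda>l. (l, y * l))"
  by (simp add: Vector_Spaces.linear_iff K.vector_space_axioms K2.vector_space_axioms scl_def scl2_def algebra_simps)

lemma linear_fst: "Vector_Spaces.linear (scl2 C) (scl C) fst"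
  by (simp add: Vector_Spaces.linear_iff K.vector_space_axioms K2.vector_space_axioms scl_def scl2_def)

lemma pair_echelon_basis_exists:
  assumes N: "2 * g - 1 \<le> N"
  shows "\<exists>L. pair_echelon_basis C g N (pair_space C g (ddeg C Dt) N st tt) L"
proof -
  interpret pair: vector_space_pair "scl C" "scl2 C" ..
  obtain bs where bs: "echelon_basis C (W\<^sub>D C D (N + 1)) bs"
    using echelon_basis_exists[OF subspace_WD fin_dim_WD] good_D by blast
  have N': "ddeg C D + g - 1 \<le> N + 1" using N D(2) by simp
  note deg = semi_typical_echelon_basis[OF D(1) N' bs]
  have ind: "K.independent (set bs)" and span: "K.span (set bs) = W\<^sub>D C D (N + 1)"
    using bs by (simp_all add: echelon_basis_def kindep_def kspan_def)
  let ?f = "\<lambda>l. (l, y * l)" let ?L = "map ?f bs"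
  have "K2.independent (set ?L)"
    using pair.linear_independent_injective_image[OF linear_graph ind] by (simp add: inj_on_def)
  moreover have "K2.span (set ?L) = pair_space C g (ddeg C Dt) N st tt"
    unfolding pair_space_eq[OF N] using pair.linear_span_image[OF linear_graph, of "set bs"] span by simp
  moreover have "int (length ?L) = N - 2 * g + 2" using deg(1) D(2) by simp
  moreover have "pdeg C (fst (?L ! i)) = Fin (2 * g + int i) \<and> pdeg C (snd (?L ! i)) = Fin (2 * g + 1 + int i)"
    if "i < length ?L" for i
  proof -
    have "pdeg C (bs ! i) = Fin (2 * g + int i)" using deg(2)[of i] that D(2) by simp
    then show ?thesis using that y_nz by (simp add: pdeg_Fin v_mult[OF place_P] P_y)
  qed
  ultimately have "pair_echelon_basis C g N (pair_space C g (ddeg C Dt) N st tt) ?L"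
    unfolding pair_echelon_basis_def by blast
  then show ?thesis by blast
qed

text \<open>
  The last pair has a first component of degree \<open>N + 1\<close>; the first components of the others have each of the degrees
  \<open>2g, \<dots>, N\<close> once and so span \<open>W\<^sup>N\<^sub>D\<close>.
\<close>

lemma combinations:
  assumes N: "2 * g - 1 \<le> N" and L: "pair_echelon_basis C g N (pair_space C g (ddeg C Dt) N st tt) L"
  shows "fst_combs C L = {f \<in> W\<^sub>D C D N. y * f \<in> W\<^sub>D C D (N + 1)}"
    "snd_combs C L = (*) y ` {f \<in> W\<^sub>D C D N. y * f \<in> W\<^sub>D C D (N + 1)}"
proof -
  interpret pair: vector_space_pair "scl2 C" "scl C" ..
  have span: "K2.span (set L) = (\<lambda>l. (l, y * l)) ` W\<^sub>D C D (N + 1)"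
    and len: "int (length L) = N - 2 * g + 2"
    and deg: "\<And>i. i < length L \<Longrightarrow> pdeg C (fst (L ! i)) = Fin (2 * g + int i)"
    using L unfolding pair_echelon_basis_def pair_space_eq[OF N] by blast+
  have spanD: "K.span (fst ` set L) = W\<^sub>D C D (N + 1)"
    using pair.linear_span_image[OF linear_fst, of "set L"] span by (simp add: image_image)
  have mem: "fst (L ! i) \<in> W\<^sub>D C D (N + 1) \<and> snd (L ! i) = y * fst (L ! i)" if "i < length L" for i
  proof -
    have "L ! i \<in> K2.span (set L)" using that by (intro K2.span_base) simp
    then show ?thesis unfolding span by auto
  qed
  let ?n = "length L - 1" let ?l = "\<lambda>i. fst (L ! i)"
  have n: "int ?n = N - 2 * g + 1" using len N by linarith
  have lW: "?l i \<in> W\<^sub>D C D N" if "i < ?n" for i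
  proof -
    have "pdeg C (?l i) = Fin (2 * g + int i)" "?l i \<in> W\<^sub>D C D (N + 1)" using deg[of i] mem[of i] that by simp_all
    then have "?l i \<in> W\<^sub>D C D (2 * g + int i)" using WD_exact[OF good_D] by blast
    moreover have "2 * g + int i \<le> N" using that n by linarith
    ultimately show ?thesis using WD_mono by blast
  qed
  have orders: "pole_orders (W\<^sub>D C D N) = {2 * g..N}"
    using semi_typical_pole_orders[OF D(1), of N] D(2) N by simp
  have "K.span ((\<lambda>n. ?l (nat (n - 2 * g))) ` pole_orders (W\<^sub>D C D N)) = W\<^sub>D C D N"
  proof (rule span_pole_order_representatives[OF subspace_WD[OF good_D]])
    show "finite (pole_orders (W\<^sub>D C D N))" by (simp add: orders)
    fix m assume "m \<in> pole_orders (W\<^sub>D C D N)"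
    then have m: "nat (m - 2 * g) < ?n" "2 * g + int (nat (m - 2 * g)) = m" using n unfolding orders by auto
    then have "pdeg C (?l (nat (m - 2 * g))) = Fin m" using deg[of "nat (m - 2 * g)"] by simp
    then show "?l (nat (m - 2 * g)) \<in> W\<^sub>D C D N \<and> ?l (nat (m - 2 * g)) \<noteq> 0 \<and> - P (?l (nat (m - 2 * g))) = m"
      using lW[OF m(1)] by (simp add: pdeg_Fin)
  qed
  moreover have "(\<lambda>n. ?l (nat (n - 2 * g))) ` pole_orders (W\<^sub>D C D N) = ?l ` {..<?n}"
  proof -
    have "(\<lambda>m. nat (m - 2 * g)) ` {2 * g..N} = {..<?n}"
    proof (intro equalityI subsetI)
      fix i assume "i \<in> {..<?n}"
      then have "2 * g + int i \<in> {2 * g..N}" using n by simp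
      moreover have "i = nat (2 * g + int i - 2 * g)" by simp
      ultimately show "i \<in> (\<lambda>m. nat (m - 2 * g)) ` {2 * g..N}" by blast
    qed (use n in auto)
    then show ?thesis unfolding orders by (metis image_image)
  qed
  ultimately have span_l: "K.span (?l ` {..<?n}) = W\<^sub>D C D N" by simp
  have inj: "inj_on ?l {..<?n}"
  proof (rule inj_onI)
    fix i j assume ij: "i \<in> {..<?n}" "j \<in> {..<?n}" and eq: "?l i = ?l j"
    have "i < length L" "j < length L" using ij by auto
    then have "Fin (2 * g + int i) = Fin (2 * g + int j)" using deg[of i] deg[of j] unfolding eq by metis
    then show "i = j" by simp
  qed
  let ?s = "\<lambda>c. \<Sum>i<?n. scl C (c i) (?l i)"
  have range: "range ?s = W\<^sub>D C D N"
  proof (intro equalityI subsetI)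
    fix f assume "f \<in> range ?s"
    then show "f \<in> W\<^sub>D C D N"
      using lW by (auto intro!: K.subspace_sum[OF subspace_WD[OF good_D]] K.subspace_scale[OF subspace_WD[OF good_D]])
  next
    fix f assume "f \<in> W\<^sub>D C D N"
    then obtain u where "f = (\<Sum>v\<in>?l ` {..<?n}. scl C (u v) v)"
      unfolding span_l[symmetric] by (auto simp: K.span_finite)
    then have "f = ?s (u \<circ> ?l)" using inj by (simp add: sum.reindex)
    then show "f \<in> range ?s" by blast
  qed
  have snd: "(\<Sum>i<?n. scl C (c i) (snd (L ! i))) = y * ?s c" for c
    unfolding scl_sum using mem by (intro sum.cong) auto
  have tuples: "coeff_tuples C L = {c. y * ?s c \<in> W\<^sub>D C D (N + 1)}"
    unfolding coeff_tuples_def kspan_def spanD snd ..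
  show "fst_combs C L = {f \<in> W\<^sub>D C D N. y * f \<in> W\<^sub>D C D (N + 1)}"
    unfolding fst_combs_def tuples range[symmetric] by auto
  show "snd_combs C L = (*) y ` {f \<in> W\<^sub>D C D N. y * f \<in> W\<^sub>D C D (N + 1)}"
    unfolding snd_combs_def tuples range[symmetric] snd by auto
qed

text \<open>
  If \<open>v\<close> were a common point of \<open>D\<close> and \<open>E\<close>, all \<open>st a + tt b\<close> would vanish along \<open>Dt + v\<close>.  But these
  combinations are all the functions of degree at most \<open>deg Dt + 3g\<close> that vanish along \<open>Dt\<close>, and by Riemann-Roch not all
  of them vanish along \<open>Dt + v\<close>.
\<close>

lemma disjoint_D_E: "disjoint_div D E"
proof (rule ccontr)
  assume "\<not> disjoint_div D E"
  then obtain v where v: "D v \<noteq> 0" "E v \<noteq> 0" unfolding disjoint_div_def by blast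
  have place: "is_place C v" "v \<noteq> P" using v good_D unfolding good_def divisor_def by auto
  have pos: "1 \<le> D v" "1 \<le> E v"
    using v le_funD[of 0 D v] le_funD[of 0 E v] good_D good_E by (auto simp: good_def)
  let ?d = "ddeg C Dt" let ?D = "Dt + point_div v"
  have pt: "good C (point_div v)"
    unfolding good_def using divisor_point[OF place(1)] place(2) by (auto simp: point_div_def le_fun_def)
  have good: "good C ?D" using good_Dt pt by (rule good_add)
  have dv: "place_deg C v \<le> g" "1 \<le> place_deg C v"
    using ddeg_ge_point[of D v] good_D pos place D(2) place_deg_pos by (auto simp: good_def)
  have deg: "ddeg C ?D = ?d + place_deg C v"
    using good_Dt pt by (simp add: ddeg_add good_divisor ddeg_point)
  have "st \<in> W\<^sub>D C ?D (?d + g)"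
  proof -
    have "?D w \<le> w st" if "is_place C w \<and> w \<noteq> P" for w
      using fun_cong[OF residual, of w] that pos le_funD[of 0 D w] good_D
      by (auto simp: adiv_def point_div_def good_def)
    then show ?thesis using st_nz by (simp add: WD_iff[OF good])
  qed
  moreover have "tt \<in> W\<^sub>D C ?D (?d + g + 1)"
  proof -
    have "?D w \<le> w tt" if "is_place C w \<and> w \<noteq> P" for w
      using fun_cong[OF adiv_tt, of w] that pos le_funD[of 0 E w] good_E
      by (auto simp: adiv_def point_div_def good_def)
    then show ?thesis using tt_nz by (simp add: WD_iff[OF good])
  qed
  ultimately have sub: "multiples st tt \<subseteq> W\<^sub>D C ?D (?d + 3 * g)"
    by (rule multiples_subset_WD[OF good])
  have "K.dim (multiples st tt) \<le> K.dim (W\<^sub>D C ?D (?d + 3 * g))"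
    by (rule K.dim_mono_fin[OF fin_dim_WD[OF good] sub])
  moreover have "int (K.dim (W\<^sub>D C ?D (?d + 3 * g))) = 2 * g + 1 - place_deg C v"
    using dim_WD[OF good, of "?d + 3 * g"] deg dv by simp
  ultimately show False using no_relation_dim_multiples[OF rel] dv(2) by simp
qed

lemma double_shift: "y * f \<in> W\<^sub>D C (D + E) (N + 1) \<longleftrightarrow> f \<in> W\<^sub>D C (D + D) N"
  by (rule WD_shift_iff[OF good_add[OF good_D good_D] good_add[OF good_D good_E] y_nz])
    (simp_all add: adiv_y P_y)

text \<open>
  Both conditions on \<open>f\<close> say that \<open>y f\<close> vanishes along \<open>D\<close> and along \<open>E\<close>, hence along \<open>D + E\<close>, and \<open>y\<close> has the divisor
  \<open>E - D = (D + E) - (D + D)\<close> away from \<open>P\<close>.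
\<close>

lemma doubled_space: "{f \<in> W\<^sub>D C D N. y * f \<in> W\<^sub>D C D (N + 1)} = W\<^sub>D C (D + D) N"
proof (rule Set.set_eqI)
  fix f
  have "f \<in> W\<^sub>D C D N \<and> y * f \<in> W\<^sub>D C D (N + 1) \<longleftrightarrow> y * f \<in> W\<^sub>D C D (N + 1) \<inter> W\<^sub>D C E (N + 1)"
    by (auto simp: y_shift)
  also have "\<dots> \<longleftrightarrow> f \<in> W\<^sub>D C (D + D) N"
    unfolding WD_inter[OF good_D good_E] lcm_disjoint[OF good_D good_E disjoint_D_E] double_shift ..
  finally show "f \<in> {f \<in> W\<^sub>D C D N. y * f \<in> W\<^sub>D C D (N + 1)} \<longleftrightarrow> f \<in> W\<^sub>D C (D + D) N" by simp
qed

lemma doubled_trivial_iff: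
  assumes N: "3 * g - 1 \<le> N"
  shows "(*) y ` W\<^sub>D C (D + D) N \<inter> W C (3 * g) = {0} \<longleftrightarrow> semi_typical C g (D + D)"
proof -
  have good: "good C (D + D)" "good C (D + E)" by (rule good_add[OF good_D good_D], rule good_add[OF good_D good_E])
  have deg: "ddeg C (D + D) = 2 * g"
    unfolding ddeg_add[OF good_divisor[OF good_D] good_divisor[OF good_D]] D(2) by simp
  have iff: "y * f \<in> W C (3 * g) \<longleftrightarrow> f \<in> W\<^sub>D C (D + D) (3 * g - 1)" if f: "f \<in> W\<^sub>D C (D + D) N" for f
  proof -
    have "y * f \<in> W\<^sub>D C (D + E) (N + 1)" using f by (simp add: double_shift)
    then have "y * f \<in> W C (3 * g) \<longleftrightarrow> y * f \<in> W\<^sub>D C (D + E) (3 * g - 1 + 1)"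
      using WD_inter_W[OF good(2), of "3 * g" "N + 1"] N by auto
    then show ?thesis unfolding double_shift .
  qed
  have "W\<^sub>D C (D + D) (3 * g - 1) \<subseteq> W\<^sub>D C (D + D) N" using N by (rule WD_mono)
  then have "(*) y ` W\<^sub>D C (D + D) N \<inter> W C (3 * g) = (*) y ` W\<^sub>D C (D + D) (3 * g - 1)"
    using iff by blast
  also have "\<dots> = {0} \<longleftrightarrow> W\<^sub>D C (D + D) (3 * g - 1) = {0}"
  proof
    assume eq: "(*) y ` W\<^sub>D C (D + D) (3 * g - 1) = {0}"
    have "f = 0" if "f \<in> W\<^sub>D C (D + D) (3 * g - 1)" for f
      using imageI[OF that, of "(*) y"] y_nz unfolding eq by simp
    then show "W\<^sub>D C (D + D) (3 * g - 1) = {0}" using WD_0 by blast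
  qed simp
  also have "\<dots> \<longleftrightarrow> semi_typical C g (D + D)"
    using good g_pos deg by (simp add: semi_typical_def)
  finally show ?thesis .
qed

text \<open>
  Every choice of bases leads to the same spaces, and hence to the same set of results.
\<close>

lemma flip_double_proc_eq:
  assumes N: "3 * g - 1 \<le> N"
  shows "flip_double_proc C g (ddeg C Dt) N st tt =
    (if semi_typical C g (D + D) then {Some cs | cs. echelon_basis C (W\<^sub>D C (D + D) N) cs} else {None})"
    (is "_ = ?R")
proof -
  have N': "2 * g - 1 \<le> N" using N g_pos by simp
  have runs: "(if \<not> indep_mod C (W C (ddeg C Dt + g - 1)) (map ((*) st) ms @ map ((*) tt) ms') then {None}
      else (\<Union>L \<in> {L. pair_echelon_basis C g N (pair_space C g (ddeg C Dt) N st tt) L}.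
        if snd_combs C L \<inter> W C (3 * g) \<noteq> {0} then {None}
        else {Some cs | cs. echelon_basis C (fst_combs C L) cs})) = ?R" (is "?X = ?R")
    if ms: "echelon_basis C (W C (2 * g)) ms" "echelon_basis C (W C (2 * g - 1)) ms'" for ms ms'
  proof -
    have run: "(if snd_combs C L \<inter> W C (3 * g) \<noteq> {0} then {None}
        else {Some cs | cs. echelon_basis C (fst_combs C L) cs}) = ?R"
      if L: "pair_echelon_basis C g N (pair_space C g (ddeg C Dt) N st tt) L" for L
      unfolding combinations[OF N' L] doubled_space using doubled_trivial_iff[OF N] by simp
    obtain L0 where L0: "pair_echelon_basis C g N (pair_space C g (ddeg C Dt) N st tt) L0"
      using pair_echelon_basis_exists[OF N'] by blast
    have "?X = (\<Union>L \<in> {L. pair_echelon_basis C g N (pair_space C g (ddeg C Dt) N st tt) L}.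
        if snd_combs C L \<inter> W C (3 * g) \<noteq> {0} then {None}
        else {Some cs | cs. echelon_basis C (fst_combs C L) cs})"
      using indep_mod_of_no_relation[OF rel ms] by simp
    also have "\<dots> = (\<Union>L \<in> {L. pair_echelon_basis C g N (pair_space C g (ddeg C Dt) N st tt) L}. ?R)"
      by (rule SUP_cong[OF refl]) (use run in blast)
    also have "\<dots> = ?R" using L0 by blast
    finally show ?thesis .
  qed
  obtain ms ms' where ms0: "echelon_basis C (W C (2 * g)) ms" "echelon_basis C (W C (2 * g - 1)) ms'"
    using echelon_basis_exists[OF subspace_W fin_dim_W] by blast
  have "flip_double_proc C g (ddeg C Dt) N st tt =
      (\<Union>ms \<in> {ms. echelon_basis C (W C (2 * g)) ms}. \<Union>ms' \<in> {ms'. echelon_basis C (W C (2 * g - 1)) ms'}. ?R)"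
    unfolding flip_double_proc_def by (intro SUP_cong refl) (use runs in blast)
  also have "\<dots> = ?R" using ms0 by blast
  finally show ?thesis .
qed

lemma flip_double_proc_correct:
  assumes N: "3 * g - 1 \<le> N"
  shows "succeeds_iff (flip_double_proc C g (ddeg C Dt) N st tt) (semi_typical C g (D + D))"
    "Some xs \<in> flip_double_proc C g (ddeg C Dt) N st tt \<Longrightarrow>
      semi_typical C g (D + D) \<and> echelon_basis C (W\<^sub>D C (D + D) N) xs"
proof -
  obtain cs where "echelon_basis C (W\<^sub>D C (D + D) N) cs"
    using echelon_basis_exists[OF subspace_WD fin_dim_WD] good_add[OF good_D good_D] by blast
  then show "succeeds_iff (flip_double_proc C g (ddeg C Dt) N st tt) (semi_typical C g (D + D))"
    unfolding flip_double_proc_eq[OF N] succeeds_iff_def by auto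
  show "semi_typical C g (D + D) \<and> echelon_basis C (W\<^sub>D C (D + D) N) xs"
    if "Some xs \<in> flip_double_proc C g (ddeg C Dt) N st tt"
    using that unfolding flip_double_proc_eq[OF N] by (auto split: if_splits)
qed


subsection \<open>Flipping back\<close>

text \<open>
  The residual divisor \<open>A\<close> of \<open>D\<close> in a function of degree \<open>2g\<close> is linearly equivalent to \<open>Dt\<close> up to a multiple
  of \<open>P\<close>, by \<open>s / st\<close>.  Multiplication by this quotient transports the generators of \<open>Dt\<close>
  to \<open>A\<close>.
\<close>

lemma typical_flip_back:
  assumes s: "s \<in> W\<^sub>D C D (2 * g)" "pdeg C s = Fin (2 * g)" and A: "good C A" "ddeg C A = g" "adiv C s = D + A"
  shows "typical C g A"
proof -
  let ?d = "ddeg C Dt"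
  define z where "z = s / st"
  have s0: "s \<noteq> 0" "P s = - 2 * g" using s(2) by (auto simp: pdeg_Fin)
  have z: "z \<noteq> 0" "P z = ?d - g" "adiv C z = A - Dt"
    unfolding z_def using s0 st_nz by (simp_all add: v_divide[OF place_P] adiv_divide residual A(3))
  have shift: "z * f \<in> W\<^sub>D C A (N - (?d - g)) \<longleftrightarrow> f \<in> W\<^sub>D C Dt N" for f N
    by (rule WD_shift_iff[OF good_Dt A(1) z(1,3)]) (simp add: z(2))
  have z_st: "z * st = s" using st_nz by (simp add: z_def)
  have sA: "s \<in> W\<^sub>D C A (g + g)" using shift[of st "?d + g"] st(1) z_st by simp
  have tA: "z * tt \<in> W\<^sub>D C A (g + g + 1)"
  proof -
    have "?d + g + 1 - (?d - g) = g + g + 1" by simp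
    then show ?thesis using shift[of tt "?d + g + 1"] tt(1) by simp
  qed
  have "no_relation g s (z * tt)"
    unfolding no_relation_def
  proof (intro ballI impI)
    fix a b c assume abc: "a \<in> W C (2 * g)" "b \<in> W C (2 * g - 1)" "c \<in> W C (g + g - 1)" "s * a + z * tt * b + c = 0"
    let ?f = "st * a + tt * b"
    have zf: "z * ?f = - c"
      using abc(4) by (simp add: distrib_left mult.assoc[symmetric] z_st eq_neg_iff_add_eq_0)
    have "?f \<in> W\<^sub>D C Dt (?d + 3 * g)"
    proof -
      have "?f \<in> multiples st tt" unfolding multiples_def using abc by blast
      then show ?thesis unfolding multiples_eq_WD[OF good_Dt st(1) tt(1) rel] .
    qed
    then have "z * ?f \<in> W\<^sub>D C A (?d + 3 * g - (?d - g))" by (simp only: shift)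
    moreover have "z * ?f \<in> W C (g + g - 1)" unfolding zf using abc(3) by (rule K.subspace_neg[OF subspace_W])
    ultimately have "z * ?f \<in> W\<^sub>D C A (g + g - 1)"
      using WD_inter_W[OF A(1), of "g + g - 1" "?d + 3 * g - (?d - g)"] g_pos by auto
    moreover have "g + g - 1 = ?d + g - 1 - (?d - g)" by simp
    ultimately have "?f \<in> W\<^sub>D C Dt (?d + g - 1)" by (simp only: shift)
    then have "?f = 0" using typical_imp_semi_typical[OF typical] unfolding semi_typical_def by blast
    then show "a = 0 \<and> b = 0" using no_relationD[OF rel abc(1,2) W_0] by simp
  qed
  then show ?thesis unfolding typical_iff A(2) using A(1) sA tA by blast
qed

end

section \<open>Classes in the Picard group\<close>

context pointed_curve
begin

lemma Div0_group: "comm_group (Div0 C)"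
proof (rule comm_groupI)
  fix x y assume "x \<in> carrier (Div0 C)" "y \<in> carrier (Div0 C)"
  then show "x \<otimes>\<^bsub>Div0 C\<^esub> y \<in> carrier (Div0 C)"
    by (simp add: Div0_def divisor_add ddeg_add)
  show "x \<otimes>\<^bsub>Div0 C\<^esub> y = y \<otimes>\<^bsub>Div0 C\<^esub> x" by (simp add: Div0_def add.commute)
next
  fix x assume x: "x \<in> carrier (Div0 C)"
  then have "- x \<in> carrier (Div0 C)" by (simp add: Div0_def divisor_uminus ddeg_uminus)
  moreover have "- x \<otimes>\<^bsub>Div0 C\<^esub> x = \<one>\<^bsub>Div0 C\<^esub>" by (simp add: Div0_def)
  ultimately show "\<exists>y\<in>carrier (Div0 C). y \<otimes>\<^bsub>Div0 C\<^esub> x = \<one>\<^bsub>Div0 C\<^esub>" by blast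
qed (simp_all add: Div0_def divisor_0 ddeg_def add.assoc)

sublocale Div0: comm_group "Div0 C"
  by (rule Div0_group)

lemma Prin_subgroup: "subgroup (Prin C) (Div0 C)"
proof (rule Div0.subgroupI)
  show "Prin C \<subseteq> carrier (Div0 C)"
    by (auto simp: Prin_def Div0_def divisor_principal ddeg_principal)
  show "Prin C \<noteq> {}" unfolding Prin_def using one_neq_zero by blast
  fix a assume "a \<in> Prin C"
  then obtain f where f: "f \<noteq> 0" "a = principal_div C f" unfolding Prin_def by blast
  have car: "a \<in> carrier (Div0 C)" "principal_div C (inverse f) \<in> carrier (Div0 C)"
    using f by (auto simp: Div0_def divisor_principal ddeg_principal)
  have "principal_div C (inverse f) \<otimes>\<^bsub>Div0 C\<^esub> a = \<one>\<^bsub>Div0 C\<^esub>"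
    using f by (simp add: Div0_def principal_inverse)
  then have "inv\<^bsub>Div0 C\<^esub> a = principal_div C (inverse f)" using car by (intro Div0.inv_equality)
  then show "inv\<^bsub>Div0 C\<^esub> a \<in> Prin C" using f by (auto simp: Prin_def)
  fix b assume "b \<in> Prin C"
  then obtain h where h: "h \<noteq> 0" "b = principal_div C h" unfolding Prin_def by blast
  have "a \<otimes>\<^bsub>Div0 C\<^esub> b = principal_div C (f * h)"
    using f h by (simp add: Div0_def principal_mult)
  then show "a \<otimes>\<^bsub>Div0 C\<^esub> b \<in> Prin C" using f(1) h(1) by (auto simp: Prin_def)
qed

sublocale Prin: normal "Prin C" "Div0 C"
  by (rule Div0.subgroup_imp_normal[OF Prin_subgroup])

sublocale Pic0: group "Pic0 C"
  unfolding Pic0_def by (rule Prin.factorgroup_is_group)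

lemma Prin_coset_mult:
  assumes "x \<in> carrier (Div0 C)" "y \<in> carrier (Div0 C)"
  shows "(Prin C #>\<^bsub>Div0 C\<^esub> x) \<otimes>\<^bsub>Pic0 C\<^esub> (Prin C #>\<^bsub>Div0 C\<^esub> y) = Prin C #>\<^bsub>Div0 C\<^esub> (x + y)"
  using Prin.rcos_sum[OF assms] by (simp add: Pic0_def Div0_def FactGroup_def)

lemma Prin_coset_carrier: "x \<in> carrier (Div0 C) \<Longrightarrow> Prin C #>\<^bsub>Div0 C\<^esub> x \<in> carrier (Pic0 C)"
  by (auto simp: Pic0_def FactGroup_def RCOSETS_def)

lemma pic_class_eq: "pic_class C g D = Prin C #>\<^bsub>Div0 C\<^esub> (D - infty_div g)"
  by (simp add: pic_class_def infty_div_def)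

lemma class_divisor: "good C D \<Longrightarrow> ddeg C D = g \<Longrightarrow> D - infty_div g \<in> carrier (Div0 C)"
  by (simp add: Div0_def divisor_diff divisor_infty good_divisor ddeg_diff ddeg_infty)

lemma pic_class_carrier: "good C D \<Longrightarrow> ddeg C D = g \<Longrightarrow> pic_class C g D \<in> carrier (Pic0 C)"
  unfolding pic_class_eq by (intro Prin_coset_carrier class_divisor)

text \<open>
  The divisor \<open>x + y\<close> is principal, so that the two classes add up to the trivial class.
\<close>

lemma coset_inverse:
  assumes x: "x \<in> carrier (Div0 C)" and y: "y \<in> carrier (Div0 C)" and f: "f \<noteq> 0" "principal_div C f = x + y"
  shows "Prin C #>\<^bsub>Div0 C\<^esub> y = inv\<^bsub>Pic0 C\<^esub> (Prin C #>\<^bsub>Div0 C\<^esub> x)"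
proof (rule Pic0.inv_equality[symmetric])
  have xy: "y + x \<in> Prin C" unfolding Prin_def using f by (intro image_eqI[of _ _ f]) (simp_all add: add.commute)
  have "(Prin C #>\<^bsub>Div0 C\<^esub> y) \<otimes>\<^bsub>Pic0 C\<^esub> (Prin C #>\<^bsub>Div0 C\<^esub> x) = Prin C #>\<^bsub>Div0 C\<^esub> (y + x)"
    using y x by (rule Prin_coset_mult)
  also have "\<dots> = Prin C" using Div0.coset_join2[OF _ Prin_subgroup xy] Prin_subgroup xy subgroup.subset by blast
  also have "\<dots> = \<one>\<^bsub>Pic0 C\<^esub>" by (simp add: Pic0_def FactGroup_def)
  finally show "(Prin C #>\<^bsub>Div0 C\<^esub> y) \<otimes>\<^bsub>Pic0 C\<^esub> (Prin C #>\<^bsub>Div0 C\<^esub> x) = \<one>\<^bsub>Pic0 C\<^esub>" .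
qed (intro Prin_coset_carrier x y)+

lemma pic_class_negation:
  assumes D: "good C D" "ddeg C D = g" and A: "good C A" "ddeg C A = g"
    and s: "adiv C s = D + A" "pdeg C s = Fin (2 * g)"
  shows "pic_class C g A = inv\<^bsub>Pic0 C\<^esub> (pic_class C g D)"
  unfolding pic_class_eq
proof (rule coset_inverse[OF class_divisor[OF D] class_divisor[OF A]])
  show "s \<noteq> 0" using s(2) by (simp add: pdeg_Fin)
  have "P s = - 2 * g" using s(2) by (auto simp: pdeg_Fin)
  then show "principal_div C s = D - infty_div g + (A - infty_div g)"
    unfolding principal_adiv s(1) by (simp add: fun_eq_iff infty_div_def)
qed

lemma pic_class_addflip:
  assumes D: "good C D" "ddeg C D = g" and D': "good C D'" "ddeg C D' = g" and A: "good C A" "ddeg C A = g"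
    and s: "adiv C s = D + D' + A" "pdeg C s = Fin (3 * g)"
  shows "pic_class C g A = inv\<^bsub>Pic0 C\<^esub> (pic_class C g D \<otimes>\<^bsub>Pic0 C\<^esub> pic_class C g D')"
  unfolding pic_class_eq Prin_coset_mult[OF class_divisor[OF D] class_divisor[OF D']]
proof (rule coset_inverse[OF _ class_divisor[OF A]])
  show "D - infty_div g + (D' - infty_div g) \<in> carrier (Div0 C)"
    using Div0.m_closed[OF class_divisor[OF D] class_divisor[OF D']] by (simp add: Div0_def)
  show "s \<noteq> 0" using s(2) by (simp add: pdeg_Fin)
  have "P s = - 3 * g" using s(2) by (auto simp: pdeg_Fin)
  then show "principal_div C s = D - infty_div g + (D' - infty_div g) + (A - infty_div g)"
    unfolding principal_adiv s(1) by (simp add: fun_eq_iff infty_div_def)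
qed

lemma pic_class_doubleflip:
  assumes D: "good C D" "ddeg C D = g" and A: "good C A" "ddeg C A = g"
    and s: "adiv C s = D + D + A" "pdeg C s = Fin (3 * g)"
  shows "pic_class C g A = pic_class C g D [^]\<^bsub>Pic0 C\<^esub> (- 2 :: int)"
proof -
  let ?x = "pic_class C g D"
  have x: "?x \<in> carrier (Pic0 C)" by (rule pic_class_carrier[OF D])
  have "?x [^]\<^bsub>Pic0 C\<^esub> (- 2 :: int) = inv\<^bsub>Pic0 C\<^esub> (?x [^]\<^bsub>Pic0 C\<^esub> (2 :: int))"
    using Pic0.int_pow_neg[OF x, of 2] by simp
  also have "?x [^]\<^bsub>Pic0 C\<^esub> (2 :: int) = ?x \<otimes>\<^bsub>Pic0 C\<^esub> ?x"
    using Pic0.int_pow_mult[OF x, of 1 1] x by simp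
  finally show ?thesis using pic_class_addflip[OF D D A s] by simp
qed


section \<open>Correctness of the composite procedures\<close>

lemma valid_tripleD:
  assumes "valid_triple C g Dt D (bs, st, tt)"
  shows "semi_typical C g D" "ddeg C D = g" "good C D" "echelon_basis C (W\<^sub>D C D (3 * g + 1)) bs"
    "flip_pair C g Dt D st tt"
proof -
  show "semi_typical C g D" "ddeg C D = g" "echelon_basis C (W\<^sub>D C D (3 * g + 1)) bs"
    using assms unfolding valid_triple_def prod.case by blast+
  then show "good C D" by (simp add: semi_typical_def)
  show "flip_pair C g Dt D st tt"
    by unfold_locales (use assms in \<open>unfold valid_triple_def prod.case, blast+\<close>)
qed

text \<open>The second half of Addflip and Doubleflip: the first two elements of the echelon basis have the
  degrees required for a flip.\<close>

lemma flip_of_sum: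
  assumes B: "semi_typical C g B" "ddeg C B = 2 * g" and xs: "echelon_basis C (W\<^sub>D C B (3 * g + 1)) xs"
  obtains A where "2 \<le> length xs" "xs ! 0 \<in> W\<^sub>D C B (3 * g + 1)" "pdeg C (xs ! 0) = Fin (3 * g)"
    "xs ! 1 \<in> W\<^sub>D C B (3 * g + 1)" "pdeg C (xs ! 1) = Fin (3 * g + 1)"
    "good C A" "ddeg C A = g" "adiv C (xs ! 0) = B + A"
    "succeeds_iff (flip_proc C g (2 * g) (3 * g + 1) (xs ! 0) (xs ! 1)) (typical C g B)"
    "\<forall>cs. Some cs \<in> flip_proc C g (2 * g) (3 * g + 1) (xs ! 0) (xs ! 1) \<longrightarrow>
       semi_typical C g A \<and> echelon_basis C (W\<^sub>D C A (3 * g + 1)) cs \<and>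
       valid_triple C g B A (cs, xs ! 0, xs ! 1)"
proof -
  have N: "ddeg C B + g + 1 \<le> 3 * g + 1" using B(2) by simp
  note two = first_two[OF B(1) N xs]
  have e: "ddeg C B + g = 3 * g" using B(2) by simp
  obtain A where A: "good C A" "ddeg C A = g" "adiv C (xs ! 0) = B + A"
    "succeeds_iff (flip_proc C g (ddeg C B) (3 * g + 1) (xs ! 0) (xs ! 1)) (typical C g B)"
    "\<forall>cs. Some cs \<in> flip_proc C g (ddeg C B) (3 * g + 1) (xs ! 0) (xs ! 1) \<longrightarrow>
       typical C g B \<and> semi_typical C g A \<and> echelon_basis C (W\<^sub>D C A (3 * g + 1)) cs"
    using flip_step[OF B(1) two(2-5)] .
  have deg: "ddeg C B \<in> {g, 2 * g}" using B(2) by simp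
  show thesis
  proof (rule that[OF two(1) _ _ _ _ A(1-3)])
    show "xs ! 0 \<in> W\<^sub>D C B (3 * g + 1)"
      using two(2) WD_mono[of "3 * g" "3 * g + 1" B] unfolding e by auto
    show "xs ! 1 \<in> W\<^sub>D C B (3 * g + 1)" "pdeg C (xs ! 0) = Fin (3 * g)" "pdeg C (xs ! 1) = Fin (3 * g + 1)"
      using two(3-5) unfolding e by blast+
    show "succeeds_iff (flip_proc C g (2 * g) (3 * g + 1) (xs ! 0) (xs ! 1)) (typical C g B)"
      using A(4) unfolding B(2) .
    show "\<forall>cs. Some cs \<in> flip_proc C g (2 * g) (3 * g + 1) (xs ! 0) (xs ! 1) \<longrightarrow>
       semi_typical C g A \<and> echelon_basis C (W\<^sub>D C A (3 * g + 1)) cs \<and>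
       valid_triple C g B A (cs, xs ! 0, xs ! 1)"
    proof (intro allI impI)
      fix cs assume "Some cs \<in> flip_proc C g (2 * g) (3 * g + 1) (xs ! 0) (xs ! 1)"
      then have cs: "typical C g B" "semi_typical C g A" "echelon_basis C (W\<^sub>D C A (3 * g + 1)) cs"
        using A(5) unfolding B(2) by blast+
      then show "semi_typical C g A \<and> echelon_basis C (W\<^sub>D C A (3 * g + 1)) cs \<and>
         valid_triple C g B A (cs, xs ! 0, xs ! 1)"
        using valid_triple_flip[OF cs(1) deg cs(2) A(2) cs(3) two(2-5) A(3)] by blast
    qed
  qed
qed

text \<open>
  The common shape of Addflip and Doubleflip: a procedure \<open>R\<close> that yields a basis of \<open>W\<^sup>3\<^sup>g\<^sup>+\<^sup>1\<^sub>B\<close> for \<open>B = D + D'\<close> or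
  \<open>B = 2D\<close> when \<open>B\<close> is semi-typical, followed by a flip that succeeds when \<open>B\<close> is typical.  \<open>Q\<close> is the disjointness condition of
  Addflip.
\<close>

lemma procedure_then_flip:
  assumes B: "ddeg C B = 2 * g"
    and R: "succeeds_iff R (Q \<and> semi_typical C g B)"
      "\<forall>xs. Some xs \<in> R \<longrightarrow> Q \<and> semi_typical C g B \<and> echelon_basis C (W\<^sub>D C B (3 * g + 1)) xs"
  shows "\<forall>xs s t. Some xs \<in> R \<and> s = xs ! 0 \<and> t = xs ! 1 \<longrightarrow>
      echelon_basis C (W\<^sub>D C B (3 * g + 1)) xs \<and> 2 \<le> length xs \<and>
      s \<in> W\<^sub>D C B (3 * g + 1) \<and> pdeg C s = Fin (3 * g) \<and>
      t \<in> W\<^sub>D C B (3 * g + 1) \<and> pdeg C t = Fin (3 * g + 1) \<and>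
      (\<exists>A. good C A \<and> ddeg C A = g \<and> adiv C s = B + A \<and>
         succeeds_iff (flip_proc C g (2 * g) (3 * g + 1) s t) (typical C g B) \<and>
         (\<forall>cs. Some cs \<in> flip_proc C g (2 * g) (3 * g + 1) s t \<longrightarrow>
            echelon_basis C (W\<^sub>D C A (3 * g + 1)) cs \<and> semi_typical C g A \<and>
            Some (cs, s, t) \<in> and_then R (flip_first_two C g (2 * g))))" (is ?outcome)
    and "succeeds_iff (and_then R (flip_first_two C g (2 * g))) (Q \<and> typical C g B)" (is ?success)
    and "Some (cs, s, t) \<in> and_then R (flip_first_two C g (2 * g)) \<Longrightarrow>
      \<exists>A. good C A \<and> ddeg C A = g \<and> adiv C s = B + A \<and> pdeg C s = Fin (3 * g) \<and>
        valid_triple C g B A (cs, s, t)"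
proof -
  have R': "Q" "semi_typical C g B" "echelon_basis C (W\<^sub>D C B (3 * g + 1)) xs" if "Some xs \<in> R" for xs
    using R(2) that by blast+
  show ?outcome
  proof (intro allI impI, elim conjE)
    fix xs s t assume xs: "Some xs \<in> R" "s = xs ! 0" "t = xs ! 1"
    have mem: "Some (cs, s, t) \<in> and_then R (flip_first_two C g (2 * g))"
      if "Some cs \<in> flip_proc C g (2 * g) (3 * g + 1) s t" for cs
      unfolding Some_and_then Some_flip_first_two using that xs by blast
    show "echelon_basis C (W\<^sub>D C B (3 * g + 1)) xs \<and> 2 \<le> length xs \<and>
        s \<in> W\<^sub>D C B (3 * g + 1) \<and> pdeg C s = Fin (3 * g) \<and>
        t \<in> W\<^sub>D C B (3 * g + 1) \<and> pdeg C t = Fin (3 * g + 1) \<and>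
        (\<exists>A. good C A \<and> ddeg C A = g \<and> adiv C s = B + A \<and>
           succeeds_iff (flip_proc C g (2 * g) (3 * g + 1) s t) (typical C g B) \<and>
           (\<forall>cs. Some cs \<in> flip_proc C g (2 * g) (3 * g + 1) s t \<longrightarrow>
              echelon_basis C (W\<^sub>D C A (3 * g + 1)) cs \<and> semi_typical C g A \<and>
              Some (cs, s, t) \<in> and_then R (flip_first_two C g (2 * g))))"
      by (rule flip_of_sum[OF R'(2)[OF xs(1)] B R'(3)[OF xs(1)], folded xs(2,3)])
        (use R'(3)[OF xs(1)] mem in blast)
  qed
  show ?success
  proof (rule succeeds_iff_and_then[OF R(1)])
    fix xs assume xs: "Some xs \<in> R"
    have "succeeds_iff (flip_proc C g (2 * g) (3 * g + 1) (xs ! 0) (xs ! 1)) (typical C g B)"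
      by (rule flip_of_sum[OF R'(2)[OF xs] B R'(3)[OF xs]])
    then show "succeeds_iff (flip_first_two C g (2 * g) xs) (Q \<and> typical C g B)"
      using R'(1)[OF xs] by (simp add: flip_first_two_succeeds)
  qed (use typical_imp_semi_typical in blast)
  assume "Some (cs, s, t) \<in> and_then R (flip_first_two C g (2 * g))"
  then obtain xs where xs: "Some xs \<in> R" "s = xs ! 0" "t = xs ! 1"
    "Some cs \<in> flip_proc C g (2 * g) (3 * g + 1) (xs ! 0) (xs ! 1)"
    unfolding Some_and_then Some_flip_first_two by blast
  show "\<exists>A. good C A \<and> ddeg C A = g \<and> adiv C s = B + A \<and> pdeg C s = Fin (3 * g) \<and>
      valid_triple C g B A (cs, s, t)"
    by (rule flip_of_sum[OF R'(2)[OF xs(1)] B R'(3)[OF xs(1)]]) (use xs in blast)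
qed

lemma negation_correct:
  assumes v: "valid_triple C g Dt D (bs, st, tt)" and st_def: "s = bs ! 0" "t = bs ! 1"
  shows "2 \<le> length bs \<and>
       s \<in> W\<^sub>D C D (2 * g) \<and> pdeg C s = Fin (2 * g) \<and>
       t \<in> W\<^sub>D C D (2 * g + 1) \<and> pdeg C t = Fin (2 * g + 1) \<and>
       (\<exists>A. good C A \<and> ddeg C A = g \<and> adiv C s = D + A \<and> typical C g A \<and>
          (\<forall>cs. Some cs \<in> flip_proc C g g (3 * g + 1) s t \<longrightarrow>
             echelon_basis C (W\<^sub>D C A (3 * g + 1)) cs) \<and>
          (\<forall>r. Some r \<in> negation C g bs \<longrightarrow>
             (\<exists>cs. r = (cs, s, t)) \<and> valid_triple C g D A r \<and>
             pic_class C g A = inv\<^bsub>Pic0 C\<^esub> (pic_class C g D))) \<and>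
       succeeds_iff (negation C g bs) (typical C g D)"
proof -
  interpret flip_pair C g Dt D st tt by (rule valid_tripleD(5)[OF v])
  note D = valid_tripleD(1-4)[OF v]
  have N: "ddeg C D + g + 1 \<le> 3 * g + 1" using D(2) g_pos by simp
  note two = first_two[OF D(1) N D(4), folded st_def]
  have e: "ddeg C D + g = 2 * g" using D(2) by simp
  note two' = two[unfolded e]
  obtain A where A: "good C A" "ddeg C A = g" "adiv C s = D + A"
    "succeeds_iff (flip_proc C g (ddeg C D) (3 * g + 1) s t) (typical C g D)"
    "\<forall>cs. Some cs \<in> flip_proc C g (ddeg C D) (3 * g + 1) s t \<longrightarrow>
       typical C g D \<and> semi_typical C g A \<and> echelon_basis C (W\<^sub>D C A (3 * g + 1)) cs"
    using flip_step[OF D(1) two(2-5)] .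
  note flips = A(4,5)[unfolded D(2)]
  have "typical C g A" by (rule typical_flip_back[OF two'(2,3) A(1-3)])
  moreover have "echelon_basis C (W\<^sub>D C A (3 * g + 1)) cs"
    if "Some cs \<in> flip_proc C g g (3 * g + 1) s t" for cs
    using flips(2) that by blast
  moreover have "(\<exists>cs. r = (cs, s, t)) \<and> valid_triple C g D A r \<and>
      pic_class C g A = inv\<^bsub>Pic0 C\<^esub> (pic_class C g D)" if r: "Some r \<in> negation C g bs" for r
  proof -
    obtain cs where cs: "r = (cs, s, t)" "Some cs \<in> flip_proc C g g (3 * g + 1) s t"
      using r unfolding negation_def Some_flip_first_two st_def by blast
    note F = flips(2)[rule_format, OF cs(2)]
    have deg: "ddeg C D \<in> {g, 2 * g}" using D(2) by simp
    have "valid_triple C g D A (cs, s, t)"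
      using F by (intro valid_triple_flip[OF _ deg _ A(2) _ two(2-5) A(3)]) auto
    then show ?thesis using cs(1) pic_class_negation[OF D(3,2) A(1-3) two'(3)] by blast
  qed
  moreover have "succeeds_iff (negation C g bs) (typical C g D)"
    unfolding negation_def by (rule flip_first_two_succeeds) (use flips(1) in \<open>simp add: st_def\<close>)
  ultimately show ?thesis using two' A(1-3) by blast
qed

end

theorem theorem4p3:
  fixes C :: "('k::field, 'f::field) pcurve" and g :: int
  assumes curve: "smooth_curve C"
    and point: "rational_place C (pinf C)"
    and genus: "has_genus C g" "1 \<le> g"
  shows
   "(\<forall>Dt D bs st tt Dt' D' bs' st' tt'.
       valid_triple C g Dt D (bs, st, tt) \<and> valid_triple C g Dt' D' (bs', st', tt') \<longrightarrow>
       succeeds_iff (intersection_proc C g bs bs')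
         (disjoint_div D D' \<and> semi_typical C g (D + D')) \<and>
       (\<forall>xs s t. Some xs \<in> intersection_proc C g bs bs' \<and> s = xs ! 0 \<and> t = xs ! 1 \<longrightarrow>
          echelon_basis C (W\<^sub>D C (D + D') (3 * g + 1)) xs \<and> 2 \<le> length xs \<and>
          s \<in> W\<^sub>D C (D + D') (3 * g + 1) \<and> pdeg C s = Fin (3 * g) \<and>
          t \<in> W\<^sub>D C (D + D') (3 * g + 1) \<and> pdeg C t = Fin (3 * g + 1) \<and>
          (\<exists>D''. good C D'' \<and> ddeg C D'' = g \<and> adiv C s = D + D' + D'' \<and>
             succeeds_iff (flip_proc C g (2 * g) (3 * g + 1) s t) (typical C g (D + D')) \<and>
             (\<forall>cs. Some cs \<in> flip_proc C g (2 * g) (3 * g + 1) s t \<longrightarrow>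
                echelon_basis C (W\<^sub>D C D'' (3 * g + 1)) cs \<and> semi_typical C g D'' \<and>
                Some (cs, s, t) \<in> addflip C g bs bs'))) \<and>
       succeeds_iff (addflip C g bs bs') (disjoint_div D D' \<and> typical C g (D + D')) \<and>
       (\<forall>cs s t. Some (cs, s, t) \<in> addflip C g bs bs' \<longrightarrow>
          (\<exists>D''. adiv C s = D + D' + D'' \<and> valid_triple C g (D + D') D'' (cs, s, t) \<and>
             pic_class C g D'' =
               inv\<^bsub>Pic0 C\<^esub> (pic_class C g D \<otimes>\<^bsub>Pic0 C\<^esub> pic_class C g D'))))
    \<and>
    (\<forall>Dt D bs st tt.
       valid_triple C g Dt D (bs, st, tt) \<longrightarrow>
       succeeds_iff (flip_double_proc C g (ddeg C Dt) (3 * g + 1) st tt)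
         (semi_typical C g (D + D)) \<and>
       (\<forall>xs s t. Some xs \<in> flip_double_proc C g (ddeg C Dt) (3 * g + 1) st tt \<and>
            s = xs ! 0 \<and> t = xs ! 1 \<longrightarrow>
          echelon_basis C (W\<^sub>D C (D + D) (3 * g + 1)) xs \<and> 2 \<le> length xs \<and>
          s \<in> W\<^sub>D C (D + D) (3 * g + 1) \<and> pdeg C s = Fin (3 * g) \<and>
          t \<in> W\<^sub>D C (D + D) (3 * g + 1) \<and> pdeg C t = Fin (3 * g + 1) \<and>
          (\<exists>D''. good C D'' \<and> ddeg C D'' = g \<and> adiv C s = D + D + D'' \<and>
             succeeds_iff (flip_proc C g (2 * g) (3 * g + 1) s t) (typical C g (D + D)) \<and>
             (\<forall>cs. Some cs \<in> flip_proc C g (2 * g) (3 * g + 1) s t \<longrightarrow>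
                echelon_basis C (W\<^sub>D C D'' (3 * g + 1)) cs \<and>
                Some (cs, s, t) \<in> doubleflip C g (ddeg C Dt) st tt))) \<and>
       succeeds_iff (doubleflip C g (ddeg C Dt) st tt) (typical C g (D + D)) \<and>
       (\<forall>cs s t. Some (cs, s, t) \<in> doubleflip C g (ddeg C Dt) st tt \<longrightarrow>
          (\<exists>D''. adiv C s = D + D + D'' \<and> valid_triple C g (D + D) D'' (cs, s, t) \<and>
             pic_class C g D'' = pic_class C g D [^]\<^bsub>Pic0 C\<^esub> (- 2 :: int))))
    \<and>
    (\<forall>Dt D bs st tt s t.
       valid_triple C g Dt D (bs, st, tt) \<and> s = bs ! 0 \<and> t = bs ! 1 \<longrightarrow>
       2 \<le> length bs \<and>
       s \<in> W\<^sub>D C D (2 * g) \<and> pdeg C s = Fin (2 * g) \<and>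
       t \<in> W\<^sub>D C D (2 * g + 1) \<and> pdeg C t = Fin (2 * g + 1) \<and>
       (\<exists>A. good C A \<and> ddeg C A = g \<and> adiv C s = D + A \<and> typical C g A \<and>
          (\<forall>cs. Some cs \<in> flip_proc C g g (3 * g + 1) s t \<longrightarrow>
             echelon_basis C (W\<^sub>D C A (3 * g + 1)) cs) \<and>
          (\<forall>r. Some r \<in> negation C g bs \<longrightarrow>
             (\<exists>cs. r = (cs, s, t)) \<and> valid_triple C g D A r \<and>
             pic_class C g A = inv\<^bsub>Pic0 C\<^esub> (pic_class C g D))) \<and>
       succeeds_iff (negation C g bs) (typical C g D))"
proof -
  interpret pointed_curve C g
    by unfold_locales (use curve point genus in \<open>simp_all add: smooth_curve_def\<close>)
  show ?thesis
  proof (rule conjI[OF _ conjI], goal_cases)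
    case 1
    show ?case
    proof (intro allI impI, elim conjE, goal_cases)
      case (1 Dt D bs st tt Dt' D' bs' st' tt')
      note D = valid_tripleD(1-4)[OF 1(1)] and D' = valid_tripleD(1-4)[OF 1(2)]
      have deg: "ddeg C (D + D') = 2 * g" using D D' by (simp add: ddeg_add good_divisor)
      note I = intersection_proc_correct[OF D(3,2,4) D'(3,2,4)]
      have J: "\<forall>xs. Some xs \<in> intersection_proc C g bs bs' \<longrightarrow> disjoint_div D D' \<and>
          semi_typical C g (D + D') \<and> echelon_basis C (W\<^sub>D C (D + D') (3 * g + 1)) xs"
        using I(2) by blast
      note F = procedure_then_flip[OF deg I(1) J, folded addflip_def]
      have "\<exists>D''. adiv C s = D + D' + D'' \<and> valid_triple C g (D + D') D'' (cs, s, t) \<and>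
          pic_class C g D'' = inv\<^bsub>Pic0 C\<^esub> (pic_class C g D \<otimes>\<^bsub>Pic0 C\<^esub> pic_class C g D')"
        if "Some (cs, s, t) \<in> addflip C g bs bs'" for cs s t
        using F(3)[OF that] pic_class_addflip[OF D(3,2) D'(3,2)] by blast
      then have P: "\<forall>cs s t. Some (cs, s, t) \<in> addflip C g bs bs' \<longrightarrow>
          (\<exists>D''. adiv C s = D + D' + D'' \<and> valid_triple C g (D + D') D'' (cs, s, t) \<and>
            pic_class C g D'' = inv\<^bsub>Pic0 C\<^esub> (pic_class C g D \<otimes>\<^bsub>Pic0 C\<^esub> pic_class C g D'))"
        by blast
      show ?case by (rule conjI[OF I(1) conjI[OF F(1) conjI[OF F(2) P]]])
    qed
  next
    case 2
    show ?case
    proof (intro allI impI, goal_cases)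
      case (1 Dt D bs st tt)
      interpret flip_pair C g Dt D st tt by (rule valid_tripleD(5)[OF 1])
      note D = valid_tripleD(1-4)[OF 1]
      have deg: "ddeg C (D + D) = 2 * g"
        unfolding ddeg_add[OF good_divisor[OF D(3)] good_divisor[OF D(3)]] D(2) by simp
      have I: "succeeds_iff (flip_double_proc C g (ddeg C Dt) (3 * g + 1) st tt) (True \<and> semi_typical C g (D + D))"
        "\<forall>xs. Some xs \<in> flip_double_proc C g (ddeg C Dt) (3 * g + 1) st tt \<longrightarrow>
           True \<and> semi_typical C g (D + D) \<and> echelon_basis C (W\<^sub>D C (D + D) (3 * g + 1)) xs"
        using flip_double_proc_correct[of "3 * g + 1"] by simp_all
      note F = procedure_then_flip[OF deg I, folded doubleflip_def, unfolded simp_thms]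
      have P: "\<exists>D''. adiv C s = D + D + D'' \<and> valid_triple C g (D + D) D'' (cs, s, t) \<and>
          pic_class C g D'' = pic_class C g D [^]\<^bsub>Pic0 C\<^esub> (- 2 :: int)"
        if "Some (cs, s, t) \<in> doubleflip C g (ddeg C Dt) st tt" for cs s t
        using F(3)[OF that] pic_class_doubleflip[OF D(3,2)] by blast
      show ?case
      proof (rule conjI[OF _ conjI[OF _ conjI]], goal_cases)
        case 1
        show ?case using I(1) by simp
      next
        case 2
        show ?case
        proof (intro allI impI, goal_cases)
          case (1 xs s t)
          from F(1)[rule_format, OF 1] show ?case by (elim conjE exE) (intro conjI exI; blast)
        qed
      next
        case 3
        show ?case by (rule F(2))
      next
        case 4
        show ?case using P by blast
      qed
    qed
  next
    case 3
    show ?case by (intro allI impI, elim conjE, rule negation_correct)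
  qed
qed

end
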